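(* $(\mathcal M,\mathcal W^{a,b}_p)$ is a geodesic space. In particular, for any $\mu_0,\mu_1\in\mathcal M$ and any $(\mu_t,V_t,h_t)_{t\in[0,1]}\in\mathcal{CE}_p(\mu_0,\mu_1;[0,1])$ with $\mathfrak E^{a,b}_{\rm Quad}((\mu_t,V_t,h_t)_{t\in[0,1]})=\mathcal W^{a,b}_p(\mu_0,\mu_1)^2$, the curve $(\mu_t)_{t\in[0,1]}$ is a constant-speed geodesic.
   Context: Setting. $\mathcal X$ is a finite set, $K:\mathcal X\times\mathcal X\to[0,\infty)$ an irreducible Markov kernel ($\sum_y K(x,y)=1$) with unique invariant probability $\varpi$ ($\varpi(x)=\sum_y\varpi(y)K(y,x)$, $\sum_y\varpi(y)=1$), assumed reversible: $K(x,y)\varpi(x)=K(y,x)\varpi(y)$. $\mathcal M$ is the set of $\mu:\mathcal X\to[0,\infty)$ and $\mathcal M_+$ the set of $\mu:\mathcal X\to(0,\infty)$. Fix $a,b>0$ and $p\in\mathcal M_+$ with $\sum_x p(x)\varpi(x)=1$. Notation. $(\nabla\cdot\Psi)(x)=\frac12\sum_y(\Psi(x,y)-\Psi(y,x))K(x,y)$ for $\Psi\in\mathbb R^{\mathcal X\times\mathcal X}$. Logarithmic mean: $\theta(u,v)=\int_0^1u^\xi v^{1-\xi}\,d\xi$ for $u,v\ge0$, i.e. $\theta(u,u)=u$, $\theta(u,v)=\frac{u-v}{\log u-\log v}$ for $u\ne v$ positive, and $\theta(u,v)=0$ if $u=0$ or $v=0$. $\hat\mu(x,y)=\theta(\mu(x),\mu(y))$.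 Metric. $\mathcal W^{a,b}_p(\mu_0,\mu_1)\ge0$ and $\mathcal W^{a,b}_p(\mu_0,\mu_1)^2$ is the infimum of $a^2\int_0^1h_t^2\,dt+b^2\int_0^1\frac12\sum_{x,y}(\psi_t(y)-\psi_t(x))^2\hat\mu_t(x,y)K(x,y)\varpi(x)\,dt$ over all triples $(\mu_t,\psi_t,h_t)_{t\in[0,1]}$ with $t\mapsto\mu_t\in\mathcal M$ absolutely continuous on $[0,1]$ with the given endpoints $\mu_0,\mu_1$, $\psi:[0,1]\to\mathbb R^{\mathcal X}$ and $h:[0,1]\to\mathbb R$ measurable, and $\dot\mu_t(x)+\sum_y(\psi_t(y)-\psi_t(x))\hat\mu_t(x,y)K(x,y)=h_tp(x)$ for a.e. $t$ and all $x$. It is known from earlier work that $\mathcal W^{a,b}_p$ is a (finite) metric on $\mathcal M$. Flux formulation. $\mathcal{CE}_p(\mu_0,\mu_1;[0,1])$ is the set of triples $(\mu_t,V_t,h_t)_{t\in[0,1]}$ with $t\mapsto\mu_t\in\mathcal M$ absolutely continuous with endpoints $\mu_0$ (at $t=0$) and $\mu_1$ (at $t=1$), $V:[0,1]\to\mathbb R^{\mathcal X\times\mathcal X}$ and $h:[0,1]\to\mathbb R$ measurable, and $\dot\mu_t+\nabla\cdot V_t=h_tp$ for a.e. $t$. Let $\alpha(v,s,t)=v^2/\theta(s,t)$ for $v\in\mathbb R$, $s,t\ge0$, with $v^2/0=0$ if $v=0$ and $v^2/0=+\infty$ if $v\neq0$; $A'(\mu,V)=\frac12\sum_{x,y}\alpha(V(x,y),\mu(x),\mu(y))K(x,y)\varpi(x)$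 (with $0\cdot\infty=0$); and $\mathfrak E^{a,b}_{\rm Quad}((\mu_t,V_t,h_t)_{t\in[0,1]})=a^2\int_0^1|h_t|^2dt+b^2\int_0^1A'(\mu_t,V_t)\,dt\in[0,\infty]$. Geodesics. A constant-speed geodesic is a curve $(\mu_t)_{t\in[0,1]}$ in $\mathcal M$ with $\mathcal W^{a,b}_p(\mu_s,\mu_t)=|t-s|\,\mathcal W^{a,b}_p(\mu_0,\mu_1)$ for all $s,t\in[0,1]$. A metric space is a geodesic space if any two points are joined by a constant-speed geodesic. *)

theory Defs
  imports "HOL-Analysis.Analysis"
begin

definition markov_kernel :: "('x::finite \<Rightarrow> 'x \<Rightarrow> real) \<Rightarrow> bool" where
  "markov_kernel K \<longleftrightarrow> (\<forall>x y. 0 \<le> K x y) \<and> (\<forall>x. (\<Sum>y\<in>UNIV. K x y) = 1)"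

definition irreducible_kernel :: "('x::finite \<Rightarrow> 'x \<Rightarrow> real) \<Rightarrow> bool" where
  "irreducible_kernel K \<longleftrightarrow> (\<forall>x y. (x, y) \<in> {(u, v). 0 < K u v}\<^sup>*)"

definition invariant_probability :: "('x::finite \<Rightarrow> 'x \<Rightarrow> real) \<Rightarrow> ('x \<Rightarrow> real) \<Rightarrow> bool" where
  "invariant_probability K \<pi> \<longleftrightarrow>
     (\<forall>x. 0 \<le> \<pi> x) \<and> (\<Sum>y\<in>UNIV. \<pi> y) = 1 \<and> (\<forall>x. \<pi> x = (\<Sum>y\<in>UNIV. \<pi> y * K y x))"

definition reversible_kernel :: "('x::finite \<Rightarrow> 'x \<Rightarrow> real) \<Rightarrow> ('x \<Rightarrow> real) \<Rightarrow> bool" where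
  "reversible_kernel K \<pi> \<longleftrightarrow> (\<forall>x y. K x y * \<pi> x = K y x * \<pi> y)"

definition nonneg_densities :: "('x::finite \<Rightarrow> real) set" where
  "nonneg_densities = {\<mu>. \<forall>x. 0 \<le> \<mu> x}"

definition pos_densities :: "('x::finite \<Rightarrow> real) set" where
  "pos_densities = {\<mu>. \<forall>x. 0 < \<mu> x}"

definition log_mean :: "real \<Rightarrow> real \<Rightarrow> real" where
  "log_mean u v = integral {0..1} (\<lambda>\<xi>. u powr \<xi> * v powr (1 - \<xi>))"

lemma log_mean_closed_form:
  assumes "0 \<le> u" "0 \<le> v"
  shows "log_mean u v =
    (if u = 0 \<or> v = 0 then 0 else if u = v then u else (u - v) / (ln u - ln v))"
proof (cases "u = 0 \<or> v = 0")
  case True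
  then show ?thesis by (auto simp: log_mean_def)
next
  case False
  then have pos: "0 < u" "0 < v" using assms by auto
  show ?thesis
  proof (cases "u = v")
    case True
    have "u powr \<xi> * u powr (1 - \<xi>) = u" for \<xi>
      using pos by (simp flip: powr_add)
    then show ?thesis using True pos by (simp add: log_mean_def)
  next
    case neq: False
    define c where "c = ln u - ln v"
    have c: "c \<noteq> 0" using neq pos by (simp add: c_def)
    have eq: "u powr \<xi> * v powr (1 - \<xi>) = v * exp (\<xi> * c)" for \<xi>
      using pos by (simp add: powr_def c_def algebra_simps exp_add exp_diff)
    have "((\<lambda>\<xi>. v * exp (\<xi> * c)) has_integral (v * exp (1 * c) / c - v * exp (0 * c) / c)) {0..1}"
    proof (rule fundamental_theorem_of_calculus)
      fix x :: real assume "x \<in> {0..1}"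
      show "((\<lambda>\<xi>. v * exp (\<xi> * c) / c) has_vector_derivative v * exp (x * c)) (at x within {0..1})"
        unfolding has_real_derivative_iff_has_vector_derivative[symmetric]
        using c by (auto intro!: derivative_eq_intros)
    qed simp
    moreover have "v * exp c = u" using pos by (simp add: c_def exp_diff)
    ultimately have "log_mean u v = (u - v) / c"
      unfolding log_mean_def eq by (simp add: integral_unique diff_divide_distrib del: integral_mult_right)
    then show ?thesis using neq pos by (simp add: c_def)
  qed
qed

definition abs_continuous_on_interval :: "real \<Rightarrow> real \<Rightarrow> (real \<Rightarrow> real) \<Rightarrow> bool" where
  "abs_continuous_on_interval l r f \<longleftrightarrow>
     (\<forall>\<epsilon>>0. \<exists>\<delta>>0. \<forall>(n::nat) u v.
        (\<forall>i<n. l \<le> u i \<and> u i \<le> v i \<and> v i \<le> r) \<and>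
        disjoint_family_on (\<lambda>i. {u i<..<v i}) {..<n} \<and>
        (\<Sum>i<n. v i - u i) < \<delta> \<longrightarrow>
        (\<Sum>i<n. \<bar>f (v i) - f (u i)\<bar>) < \<epsilon>)"

text \<open>
  Curves indexed by the unit interval are total functions on the reals; everything below
  depends only on their values on the unit interval.
\<close>

definition ac_curve :: "('x::finite \<Rightarrow> real) \<Rightarrow> ('x \<Rightarrow> real) \<Rightarrow> (real \<Rightarrow> 'x \<Rightarrow> real) \<Rightarrow> bool" where
  "ac_curve \<mu>0 \<mu>1 \<mu> \<longleftrightarrow>
     (\<forall>t\<in>{0..1}. \<mu> t \<in> nonneg_densities) \<and> \<mu> 0 = \<mu>0 \<and> \<mu> 1 = \<mu>1 \<and>
     (\<forall>x. abs_continuous_on_interval 0 1 (\<lambda>t. \<mu> t x))"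

definition potential_solutions ::
  "('x::finite \<Rightarrow> 'x \<Rightarrow> real) \<Rightarrow> ('x \<Rightarrow> real) \<Rightarrow> ('x \<Rightarrow> real) \<Rightarrow> ('x \<Rightarrow> real) \<Rightarrow>
    ((real \<Rightarrow> 'x \<Rightarrow> real) \<times> (real \<Rightarrow> 'x \<Rightarrow> real) \<times> (real \<Rightarrow> real)) set" where
  "potential_solutions K p \<mu>0 \<mu>1 =
     {(\<mu>, \<psi>, h). ac_curve \<mu>0 \<mu>1 \<mu> \<and>
        (\<forall>x. (\<lambda>t. \<psi> t x) \<in> borel_measurable (lebesgue_on {0..1})) \<and>
        h \<in> borel_measurable (lebesgue_on {0..1}) \<and>
        (AE t in lebesgue_on {0..1}. \<forall>x. \<exists>d.
           ((\<lambda>s. \<mu> s x) has_real_derivative d) (at t within {0..1}) \<and>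
           d + (\<Sum>y\<in>UNIV. (\<psi> t y - \<psi> t x) * log_mean (\<mu> t x) (\<mu> t y) * K x y) = h t * p x)}"

definition potential_energy ::
  "('x::finite \<Rightarrow> 'x \<Rightarrow> real) \<Rightarrow> ('x \<Rightarrow> real) \<Rightarrow> real \<Rightarrow> real \<Rightarrow>
    (real \<Rightarrow> 'x \<Rightarrow> real) \<Rightarrow> (real \<Rightarrow> 'x \<Rightarrow> real) \<Rightarrow> (real \<Rightarrow> real) \<Rightarrow> ennreal" where
  "potential_energy K \<pi> a b \<mu> \<psi> h =
     ennreal (a\<^sup>2) * (\<integral>\<^sup>+t. ennreal ((h t)\<^sup>2) \<partial>lebesgue_on {0..1}) +
     ennreal (b\<^sup>2) * (\<integral>\<^sup>+t. ennreal (1/2 * (\<Sum>x\<in>UNIV. \<Sum>y\<in>UNIV.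
        (\<psi> t y - \<psi> t x)\<^sup>2 * log_mean (\<mu> t x) (\<mu> t y) * K x y * \<pi> x)) \<partial>lebesgue_on {0..1})"

text \<open>
  The infimum is taken in the extended nonnegative reals. As \<^const>\<open>enn2real\<close> sends infinity
  to 0, a metric of this form in particular has a finite infimum between any two distinct points.
\<close>

definition transport_dist ::
  "('x::finite \<Rightarrow> 'x \<Rightarrow> real) \<Rightarrow> ('x \<Rightarrow> real) \<Rightarrow> ('x \<Rightarrow> real) \<Rightarrow> real \<Rightarrow> real \<Rightarrow>
    ('x \<Rightarrow> real) \<Rightarrow> ('x \<Rightarrow> real) \<Rightarrow> real" where
  "transport_dist K \<pi> p a b \<mu>0 \<mu>1 =
     sqrt (enn2real (INF (\<mu>, \<psi>, h) \<in> potential_solutions K p \<mu>0 \<mu>1.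
       potential_energy K \<pi> a b \<mu> \<psi> h))"

definition discrete_divergence ::
  "('x::finite \<Rightarrow> 'x \<Rightarrow> real) \<Rightarrow> ('x \<Rightarrow> 'x \<Rightarrow> real) \<Rightarrow> 'x \<Rightarrow> real" where
  "discrete_divergence K \<Psi> x = 1/2 * (\<Sum>y\<in>UNIV. (\<Psi> x y - \<Psi> y x) * K x y)"

definition continuity_equation ::
  "('x::finite \<Rightarrow> 'x \<Rightarrow> real) \<Rightarrow> ('x \<Rightarrow> real) \<Rightarrow> ('x \<Rightarrow> real) \<Rightarrow> ('x \<Rightarrow> real) \<Rightarrow>
    ((real \<Rightarrow> 'x \<Rightarrow> real) \<times> (real \<Rightarrow> 'x \<Rightarrow> 'x \<Rightarrow> real) \<times> (real \<Rightarrow> real)) set" where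
  "continuity_equation K p \<mu>0 \<mu>1 =
     {(\<mu>, V, h). ac_curve \<mu>0 \<mu>1 \<mu> \<and>
        (\<forall>x y. (\<lambda>t. V t x y) \<in> borel_measurable (lebesgue_on {0..1})) \<and>
        h \<in> borel_measurable (lebesgue_on {0..1}) \<and>
        (AE t in lebesgue_on {0..1}. \<forall>x. \<exists>d.
           ((\<lambda>s. \<mu> s x) has_real_derivative d) (at t within {0..1}) \<and>
           d + discrete_divergence K (V t) x = h t * p x)}"

text \<open>
  Division and multiplication on \<^typ>\<open>ennreal\<close> satisfy \<open>0 / 0 = 0\<close>, \<open>c / 0 = \<infinity>\<close> for \<open>c \<noteq> 0\<close>
  and \<open>0 * \<infinity> = 0\<close>, which are the conventions wanted in the next two definitions.
\<close>

definition flux_cost :: "real \<Rightarrow> real \<Rightarrow> real \<Rightarrow> ennreal" where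
  "flux_cost v s t = ennreal (v\<^sup>2) / ennreal (log_mean s t)"

definition flux_action ::
  "('x::finite \<Rightarrow> 'x \<Rightarrow> real) \<Rightarrow> ('x \<Rightarrow> real) \<Rightarrow> ('x \<Rightarrow> real) \<Rightarrow> ('x \<Rightarrow> 'x \<Rightarrow> real) \<Rightarrow> ennreal" where
  "flux_action K \<pi> \<mu> V =
     ennreal (1/2) * (\<Sum>x\<in>UNIV. \<Sum>y\<in>UNIV. flux_cost (V x y) (\<mu> x) (\<mu> y) * ennreal (K x y * \<pi> x))"

definition quad_energy ::
  "('x::finite \<Rightarrow> 'x \<Rightarrow> real) \<Rightarrow> ('x \<Rightarrow> real) \<Rightarrow> real \<Rightarrow> real \<Rightarrow>
    (real \<Rightarrow> 'x \<Rightarrow> real) \<Rightarrow> (real \<Rightarrow> 'x \<Rightarrow> 'x \<Rightarrow> real) \<Rightarrow> (real \<Rightarrow> real) \<Rightarrow> ennreal" where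
  "quad_energy K \<pi> a b \<mu> V h =
     ennreal (a\<^sup>2) * (\<integral>\<^sup>+t. ennreal (\<bar>h t\<bar>\<^sup>2) \<partial>lebesgue_on {0..1}) +
     ennreal (b\<^sup>2) * (\<integral>\<^sup>+t. flux_action K \<pi> (\<mu> t) (V t) \<partial>lebesgue_on {0..1})"

definition constant_speed_geodesic :: "'a set \<Rightarrow> ('a \<Rightarrow> 'a \<Rightarrow> real) \<Rightarrow> (real \<Rightarrow> 'a) \<Rightarrow> bool" where
  "constant_speed_geodesic M d \<gamma> \<longleftrightarrow>
     (\<forall>t\<in>{0..1}. \<gamma> t \<in> M) \<and>
     (\<forall>s\<in>{0..1}. \<forall>t\<in>{0..1}. d (\<gamma> s) (\<gamma> t) = \<bar>t - s\<bar> * d (\<gamma> 0) (\<gamma> 1))"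

definition geodesic_space :: "'a set \<Rightarrow> ('a \<Rightarrow> 'a \<Rightarrow> real) \<Rightarrow> bool" where
  "geodesic_space M d \<longleftrightarrow>
     Metric_space M d \<and>
     (\<forall>x\<in>M. \<forall>y\<in>M. \<exists>\<gamma>. \<gamma> 0 = x \<and> \<gamma> 1 = y \<and> constant_speed_geodesic M d \<gamma>)"

end

theory Submission
  imports Defs "HOL-Complex_Analysis.Great_Picard"
begin

text \<open>
  Geodesics are obtained as limits of almost minimal curves, and only the metric passes to the
  limit, not the action.

  Let \<open>D\<close> be the distance of the endpoints of a curve of energy \<open>E\<close>. Rescaling time bounds the
  squared distance between two points of the curve by the elapsed time times the energy spent
  in between. Cutting the curve at \<open>s \<le> t\<close> and comparing the three pieces with the triangle
  inequality gives
  \<open>(d(\<mu>\<^sub>s, \<mu>\<^sub>t) - (t - s) * D)\<^sup>2 \<le> (t - s) * (E - D\<^sup>2)\<close>  (\<open>path_speed\<close>).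
  A curve with \<open>E = D\<^sup>2\<close> is therefore a constant-speed geodesic. A sequence of curves with
  \<open>E \<rightarrow> D\<^sup>2\<close> has asymptotically constant speed, and so has every pointwise limit, as soon as \<open>d\<close> is
  continuous for the Euclidean topology on densities.

  Two estimates compare \<open>d\<close> with that topology. From below, the mass of a curve changes only
  through \<open>h\<close>, so curves of bounded energy stay in a bounded set of densities
  (\<open>path_density_bound\<close>); there the logarithmic mean is bounded and the curves are uniformly
  Hoelder continuous of exponent one half (\<open>path_holder\<close>). This makes \<open>d\<close> definite and supplies
  convergent subsequences by the theorem of Arzela and Ascoli. From above
  (\<open>dist_ab_tendsto_0\<close>), two nearby densities are joined by first adding a small multiple of \<open>p\<close>,
  then interpolating linearly between densities that are bounded away from zero, and finally
  removing the multiple of \<open>p\<close>; this also shows that \<open>d\<close> is finite.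

  All these estimates are made for fluxes, whereas \<open>d\<close> is defined by potentials. The two
  infima agree because a flux of finite action can be replaced, at almost every time, by the
  gradient flux of least action with the same divergence. The potential solves a degenerate
  Laplace equation, and it depends measurably on time because it is a limit of resolvents,
  which Cramer's rule expresses by determinants (\<open>flux_potential_solves\<close>,
  \<open>flux_potential_measurable\<close>).
\<close>

section \<open>Absolutely continuous functions\<close>

text \<open>
  Families of intervals that come from tagged divisions, or from restricting and reflecting
  other families, carry no natural numbering, so the definition is transferred to arbitrary finite
  index sets.
\<close>
lemma abs_continuous_on_interval_finite_family:
  assumes "abs_continuous_on_interval l r f" "0 < \<epsilon>"
  obtains \<delta> where "0 < \<delta>"
    "\<And>(I :: 'i set) u v. \<lbrakk>finite I; \<And>i. i \<in> I \<Longrightarrow> l \<le> u i \<and> u i \<le> v i \<and> v i \<le> r;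
       disjoint_family_on (\<lambda>i. {u i<..<v i}) I; (\<Sum>i\<in>I. v i - u i) < \<delta>\<rbrakk> \<Longrightarrow>
       (\<Sum>i\<in>I. \<bar>f (v i) - f (u i)\<bar>) < \<epsilon>"
proof -
  obtain \<delta> where "0 < \<delta>" and \<delta>: "\<And>(n::nat) u v.
        (\<forall>i<n. l \<le> u i \<and> u i \<le> v i \<and> v i \<le> r) \<and>
        disjoint_family_on (\<lambda>i. {u i<..<v i}) {..<n} \<and>
        (\<Sum>i<n. v i - u i) < \<delta> \<Longrightarrow>
        (\<Sum>i<n. \<bar>f (v i) - f (u i)\<bar>) < \<epsilon>"
    using assms unfolding abs_continuous_on_interval_def by meson
  show thesis
  proof (rule that[OF \<open>0 < \<delta>\<close>])
    fix I :: "'i set" and u v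
    assume I: "finite I" "\<And>i. i \<in> I \<Longrightarrow> l \<le> u i \<and> u i \<le> v i \<and> v i \<le> r"
       "disjoint_family_on (\<lambda>i. {u i<..<v i}) I" "(\<Sum>i\<in>I. v i - u i) < \<delta>"
    obtain \<phi> where "bij_betw \<phi> {0..<card I} I"
      using ex_bij_betw_nat_finite[OF I(1)] by blast
    then have \<phi>: "bij_betw \<phi> {..<card I} I" by (simp add: atLeast0LessThan)
    have "(\<Sum>i<card I. \<bar>f (v (\<phi> i)) - f (u (\<phi> i))\<bar>) < \<epsilon>"
    proof (intro \<delta> conjI allI impI)
      show "disjoint_family_on (\<lambda>i. {u (\<phi> i)<..<v (\<phi> i)}) {..<card I}"
        using I(3) \<phi> unfolding disjoint_family_on_def bij_betw_def inj_on_def by blast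
      show "(\<Sum>i<card I. v (\<phi> i) - u (\<phi> i)) < \<delta>"
        using I(4) sum.reindex_bij_betw[OF \<phi>, of "\<lambda>i. v i - u i"] by simp
    qed (use I(2) \<phi> in \<open>auto simp: bij_betw_def\<close>)
    then show "(\<Sum>i\<in>I. \<bar>f (v i) - f (u i)\<bar>) < \<epsilon>"
      using sum.reindex_bij_betw[OF \<phi>, of "\<lambda>i. \<bar>f (v i) - f (u i)\<bar>"] by simp
  qed
qed

lemma abs_continuous_on_interval_subinterval:
  assumes "abs_continuous_on_interval l r f" "l \<le> l'" "r' \<le> r"
  shows "abs_continuous_on_interval l' r' f"
  unfolding abs_continuous_on_interval_def
proof (intro allI impI)
  fix \<epsilon> :: real assume "0 < \<epsilon>"
  then obtain \<delta> where "0 < \<delta>" and \<delta>: "\<And>(n::nat) u v.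
        (\<forall>i<n. l \<le> u i \<and> u i \<le> v i \<and> v i \<le> r) \<and>
        disjoint_family_on (\<lambda>i. {u i<..<v i}) {..<n} \<and>
        (\<Sum>i<n. v i - u i) < \<delta> \<Longrightarrow>
        (\<Sum>i<n. \<bar>f (v i) - f (u i)\<bar>) < \<epsilon>"
    using assms unfolding abs_continuous_on_interval_def by meson
  moreover have "l \<le> u \<and> u \<le> v \<and> v \<le> r" if "l' \<le> u \<and> u \<le> v \<and> v \<le> r'" for u v
    using that assms by auto
  ultimately show "\<exists>\<delta>>0. \<forall>(n::nat) u v.
        (\<forall>i<n. l' \<le> u i \<and> u i \<le> v i \<and> v i \<le> r') \<and>
        disjoint_family_on (\<lambda>i. {u i<..<v i}) {..<n} \<and>
        (\<Sum>i<n. v i - u i) < \<delta> \<longrightarrow>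
        (\<Sum>i<n. \<bar>f (v i) - f (u i)\<bar>) < \<epsilon>"
    by meson
qed

lemma abs_continuous_on_interval_cong:
  assumes "abs_continuous_on_interval l r f" "\<And>t. t \<in> {l..r} \<Longrightarrow> g t = f t"
  shows "abs_continuous_on_interval l r g"
  unfolding abs_continuous_on_interval_def
proof (intro allI impI)
  fix \<epsilon> :: real assume "0 < \<epsilon>"
  then obtain \<delta> where "0 < \<delta>" and \<delta>: "\<And>(n::nat) u v.
        (\<forall>i<n. l \<le> u i \<and> u i \<le> v i \<and> v i \<le> r) \<and>
        disjoint_family_on (\<lambda>i. {u i<..<v i}) {..<n} \<and>
        (\<Sum>i<n. v i - u i) < \<delta> \<Longrightarrow>
        (\<Sum>i<n. \<bar>f (v i) - f (u i)\<bar>) < \<epsilon>"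
    using assms(1) unfolding abs_continuous_on_interval_def by meson
  show "\<exists>\<delta>>0. \<forall>(n::nat) u v.
        (\<forall>i<n. l \<le> u i \<and> u i \<le> v i \<and> v i \<le> r) \<and>
        disjoint_family_on (\<lambda>i. {u i<..<v i}) {..<n} \<and>
        (\<Sum>i<n. v i - u i) < \<delta> \<longrightarrow>
        (\<Sum>i<n. \<bar>g (v i) - g (u i)\<bar>) < \<epsilon>"
  proof (intro exI[of _ \<delta>] conjI allI impI \<open>0 < \<delta>\<close>)
    fix n :: nat and u v
    assume *: "(\<forall>i<n. l \<le> u i \<and> u i \<le> v i \<and> v i \<le> r) \<and>
        disjoint_family_on (\<lambda>i. {u i<..<v i}) {..<n} \<and> (\<Sum>i<n. v i - u i) < \<delta>"
    then have "g (v i) = f (v i)" "g (u i) = f (u i)" if "i < n" for i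
      using that by (force intro!: assms(2))+
    then show "(\<Sum>i<n. \<bar>g (v i) - g (u i)\<bar>) < \<epsilon>"
      using \<delta>[OF *] by simp
  qed
qed

lemma abs_continuous_on_interval_const: "abs_continuous_on_interval l r (\<lambda>_. c)"
  unfolding abs_continuous_on_interval_def by (auto intro: zero_less_one)

lemma abs_continuous_on_interval_lipschitz:
  assumes "\<And>s t. l \<le> s \<Longrightarrow> s \<le> t \<Longrightarrow> t \<le> r \<Longrightarrow> \<bar>f t - f s\<bar> \<le> C * (t - s)"
  shows "abs_continuous_on_interval l r f"
  unfolding abs_continuous_on_interval_def
proof (intro allI impI)
  fix \<epsilon> :: real assume "0 < \<epsilon>"
  show "\<exists>\<delta>>0. \<forall>(n::nat) u v.
        (\<forall>i<n. l \<le> u i \<and> u i \<le> v i \<and> v i \<le> r) \<and>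
        disjoint_family_on (\<lambda>i. {u i<..<v i}) {..<n} \<and>
        (\<Sum>i<n. v i - u i) < \<delta> \<longrightarrow>
        (\<Sum>i<n. \<bar>f (v i) - f (u i)\<bar>) < \<epsilon>"
  proof (intro exI[of _ "\<epsilon> / (1 + \<bar>C\<bar>)"] conjI allI impI)
    show "0 < \<epsilon> / (1 + \<bar>C\<bar>)" using \<open>0 < \<epsilon>\<close> by (simp add: add_pos_nonneg)
    fix n :: nat and u v
    assume *: "(\<forall>i<n. l \<le> u i \<and> u i \<le> v i \<and> v i \<le> r) \<and>
        disjoint_family_on (\<lambda>i. {u i<..<v i}) {..<n} \<and> (\<Sum>i<n. v i - u i) < \<epsilon> / (1 + \<bar>C\<bar>)"
    have "(\<Sum>i<n. \<bar>f (v i) - f (u i)\<bar>) \<le> (\<Sum>i<n. (1 + \<bar>C\<bar>) * (v i - u i))"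
    proof (rule sum_mono)
      fix i assume "i \<in> {..<n}"
      then have i: "l \<le> u i" "u i \<le> v i" "v i \<le> r" using * by auto
      then have "\<bar>f (v i) - f (u i)\<bar> \<le> C * (v i - u i)" by (intro assms)
      also have "\<dots> \<le> (1 + \<bar>C\<bar>) * (v i - u i)" using i by (intro mult_right_mono) auto
      finally show "\<bar>f (v i) - f (u i)\<bar> \<le> (1 + \<bar>C\<bar>) * (v i - u i)" .
    qed
    also have "\<dots> = (1 + \<bar>C\<bar>) * (\<Sum>i<n. v i - u i)" by (simp add: sum_distrib_left)
    also have "\<dots> < (1 + \<bar>C\<bar>) * (\<epsilon> / (1 + \<bar>C\<bar>))"
      using * by (intro mult_strict_left_mono) auto
    also have "\<dots> = \<epsilon>" by (simp add: add_pos_nonneg[THEN less_imp_neq, symmetric] field_simps)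
    finally show "(\<Sum>i<n. \<bar>f (v i) - f (u i)\<bar>) < \<epsilon>" .
  qed
qed

lemma abs_continuous_on_interval_imp_continuous_on:
  assumes "abs_continuous_on_interval l r f"
  shows "continuous_on {l..r} f"
  unfolding continuous_on_iff
proof (intro ballI allI impI)
  fix x \<epsilon> :: real assume x: "x \<in> {l..r}" and "0 < \<epsilon>"
  obtain \<delta> where "0 < \<delta>" and \<delta>:
    "\<And>(I :: nat set) u v. \<lbrakk>finite I; \<And>i. i \<in> I \<Longrightarrow> l \<le> u i \<and> u i \<le> v i \<and> v i \<le> r;
       disjoint_family_on (\<lambda>i. {u i<..<v i}) I; (\<Sum>i\<in>I. v i - u i) < \<delta>\<rbrakk> \<Longrightarrow>
       (\<Sum>i\<in>I. \<bar>f (v i) - f (u i)\<bar>) < \<epsilon>"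
    by (rule abs_continuous_on_interval_finite_family[OF assms \<open>0 < \<epsilon>\<close>]) blast
  have "dist (f y) (f x) < \<epsilon>" if y: "y \<in> {l..r}" "dist y x < \<delta>" for y
  proof (cases "x \<le> y")
    case True
    then show ?thesis using \<delta>[of "{0}" "\<lambda>_. x" "\<lambda>_. y"] x y
      by (simp add: disjoint_family_on_def dist_real_def)
  next
    case False
    then show ?thesis using \<delta>[of "{0}" "\<lambda>_. y" "\<lambda>_. x"] x y
      by (simp add: disjoint_family_on_def dist_real_def abs_minus_commute)
  qed
  then show "\<exists>d>0. \<forall>x'\<in>{l..r}. dist x' x < d \<longrightarrow> dist (f x') (f x) < \<epsilon>"
    using \<open>0 < \<delta>\<close> by auto
qed

text \<open>
  The slope may be negative: this covers time reversal along with rescaling.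
\<close>
lemma abs_continuous_on_interval_affine:
  assumes f: "abs_continuous_on_interval l r f" and "c \<noteq> 0"
    and \<sigma>: "\<And>t. t \<in> {l'..r'} \<Longrightarrow> s + c * t \<in> {l..r}"
  shows "abs_continuous_on_interval l' r' (\<lambda>t. f (s + c * t))"
  unfolding abs_continuous_on_interval_def
proof (intro allI impI)
  fix \<epsilon> :: real assume "0 < \<epsilon>"
  obtain \<delta> where "0 < \<delta>" and \<delta>:
    "\<And>(I :: nat set) u v. \<lbrakk>finite I; \<And>i. i \<in> I \<Longrightarrow> l \<le> u i \<and> u i \<le> v i \<and> v i \<le> r;
       disjoint_family_on (\<lambda>i. {u i<..<v i}) I; (\<Sum>i\<in>I. v i - u i) < \<delta>\<rbrakk> \<Longrightarrow>
       (\<Sum>i\<in>I. \<bar>f (v i) - f (u i)\<bar>) < \<epsilon>"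
    by (rule abs_continuous_on_interval_finite_family[OF f \<open>0 < \<epsilon>\<close>]) blast
  show "\<exists>\<delta>>0. \<forall>(n::nat) u v.
        (\<forall>i<n. l' \<le> u i \<and> u i \<le> v i \<and> v i \<le> r') \<and>
        disjoint_family_on (\<lambda>i. {u i<..<v i}) {..<n} \<and>
        (\<Sum>i<n. v i - u i) < \<delta> \<longrightarrow>
        (\<Sum>i<n. \<bar>f (s + c * v i) - f (s + c * u i)\<bar>) < \<epsilon>"
  proof (intro exI[of _ "\<delta> / \<bar>c\<bar>"] conjI allI impI)
    show "0 < \<delta> / \<bar>c\<bar>" using \<open>0 < \<delta>\<close> \<open>c \<noteq> 0\<close> by simp
    fix n :: nat and u v
    assume *: "(\<forall>i<n. l' \<le> u i \<and> u i \<le> v i \<and> v i \<le> r') \<and>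
        disjoint_family_on (\<lambda>i. {u i<..<v i}) {..<n} \<and> (\<Sum>i<n. v i - u i) < \<delta> / \<bar>c\<bar>"
    \<comment> \<open>A negative slope exchanges the endpoints of every interval.\<close>
    define u' where "u' i = (if c > 0 then s + c * u i else s + c * v i)" for i
    define v' where "v' i = (if c > 0 then s + c * v i else s + c * u i)" for i
    have len: "v' i - u' i = \<bar>c\<bar> * (v i - u i)" for i
      using \<open>c \<noteq> 0\<close> by (auto simp: u'_def v'_def algebra_simps)
    have pre: "(z - s) / c \<in> {u i<..<v i}" if "z \<in> {u' i<..<v' i}" for z i
      using that \<open>c \<noteq> 0\<close> by (auto simp: u'_def v'_def field_simps split: if_splits)
    have "(\<Sum>i<n. \<bar>f (v' i) - f (u' i)\<bar>) < \<epsilon>"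
    proof (rule \<delta>)
      fix i assume i: "i \<in> {..<n}"
      have le: "u' i \<le> v' i" using len[of i] * i by (smt (verit) lessThan_iff mult_nonneg_nonneg abs_ge_zero)
      have "u i \<in> {l'..r'}" "v i \<in> {l'..r'}" using * i by force+
      then have "s + c * u i \<in> {l..r}" "s + c * v i \<in> {l..r}" using \<sigma> by blast+
      then show "l \<le> u' i \<and> u' i \<le> v' i \<and> v' i \<le> r"
        using le by (auto simp: u'_def v'_def split: if_splits)
    next
      show "disjoint_family_on (\<lambda>i. {u' i<..<v' i}) {..<n}"
        unfolding disjoint_family_on_def
      proof (intro ballI impI)
        fix i j assume "i \<in> {..<n}" "j \<in> {..<n}" "i \<noteq> j"
        then have "{u i<..<v i} \<inter> {u j<..<v j} = {}"
          using * unfolding disjoint_family_on_def by blast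
        then show "{u' i<..<v' i} \<inter> {u' j<..<v' j} = {}" using pre by blast
      qed
      have "(\<Sum>i<n. v' i - u' i) = \<bar>c\<bar> * (\<Sum>i<n. v i - u i)"
        by (simp add: len sum_distrib_left)
      also have "\<dots> < \<bar>c\<bar> * (\<delta> / \<bar>c\<bar>)" using * \<open>c \<noteq> 0\<close> by (intro mult_strict_left_mono) auto
      finally show "(\<Sum>i<n. v' i - u' i) < \<delta>" using \<open>c \<noteq> 0\<close> by simp
    qed simp
    also have "(\<Sum>i<n. \<bar>f (v' i) - f (u' i)\<bar>) = (\<Sum>i<n. \<bar>f (s + c * v i) - f (s + c * u i)\<bar>)"
      by (intro sum.cong) (auto simp: u'_def v'_def)
    finally show "(\<Sum>i<n. \<bar>f (s + c * v i) - f (s + c * u i)\<bar>) < \<epsilon>" .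
  qed
qed

text \<open>
  Up to a constant, \<open>f\<close> is the sum of its restrictions frozen beyond \<open>m\<close> on either side, that is of
  \<open>f (min t m)\<close> and \<open>f (max t m)\<close>; an interval that straddles \<open>m\<close> is thereby cut in two.
\<close>
lemma abs_continuous_on_interval_join:
  assumes "l \<le> m" "m \<le> r" "abs_continuous_on_interval l m f" "abs_continuous_on_interval m r f"
  shows "abs_continuous_on_interval l r f"
  unfolding abs_continuous_on_interval_def
proof (intro allI impI)
  fix \<epsilon> :: real assume "0 < \<epsilon>"
  then have e2: "0 < \<epsilon> / 2" by simp
  obtain \<delta>1 where "0 < \<delta>1" and \<delta>1:
    "\<And>(I :: nat set) u v. \<lbrakk>finite I; \<And>i. i \<in> I \<Longrightarrow> l \<le> u i \<and> u i \<le> v i \<and> v i \<le> m;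
       disjoint_family_on (\<lambda>i. {u i<..<v i}) I; (\<Sum>i\<in>I. v i - u i) < \<delta>1\<rbrakk> \<Longrightarrow>
       (\<Sum>i\<in>I. \<bar>f (v i) - f (u i)\<bar>) < \<epsilon>/2"
    by (rule abs_continuous_on_interval_finite_family[OF assms(3) e2]) blast
  obtain \<delta>2 where "0 < \<delta>2" and \<delta>2:
    "\<And>(I :: nat set) u v. \<lbrakk>finite I; \<And>i. i \<in> I \<Longrightarrow> m \<le> u i \<and> u i \<le> v i \<and> v i \<le> r;
       disjoint_family_on (\<lambda>i. {u i<..<v i}) I; (\<Sum>i\<in>I. v i - u i) < \<delta>2\<rbrakk> \<Longrightarrow>
       (\<Sum>i\<in>I. \<bar>f (v i) - f (u i)\<bar>) < \<epsilon>/2"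
    by (rule abs_continuous_on_interval_finite_family[OF assms(4) e2]) blast
  show "\<exists>\<delta>>0. \<forall>(n::nat) u v.
        (\<forall>i<n. l \<le> u i \<and> u i \<le> v i \<and> v i \<le> r) \<and>
        disjoint_family_on (\<lambda>i. {u i<..<v i}) {..<n} \<and>
        (\<Sum>i<n. v i - u i) < \<delta> \<longrightarrow>
        (\<Sum>i<n. \<bar>f (v i) - f (u i)\<bar>) < \<epsilon>"
  proof (intro exI[of _ "min \<delta>1 \<delta>2"] conjI allI impI)
    show "0 < min \<delta>1 \<delta>2" using \<open>0 < \<delta>1\<close> \<open>0 < \<delta>2\<close> by simp
    fix n :: nat and u v
    assume *: "(\<forall>i<n. l \<le> u i \<and> u i \<le> v i \<and> v i \<le> r) \<and>
        disjoint_family_on (\<lambda>i. {u i<..<v i}) {..<n} \<and> (\<Sum>i<n. v i - u i) < min \<delta>1 \<delta>2"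
    have disj: "{u i<..<v i} \<inter> {u j<..<v j} = {}" if "i < n" "j < n" "i \<noteq> j" for i j
      using * that unfolding disjoint_family_on_def by blast
    have "(\<Sum>i<n. \<bar>f (min (v i) m) - f (min (u i) m)\<bar>) < \<epsilon>/2"
    proof (rule \<delta>1)
      show "disjoint_family_on (\<lambda>i. {min (u i) m<..<min (v i) m}) {..<n}"
        unfolding disjoint_family_on_def
      proof (intro ballI impI)
        fix i j assume "i \<in> {..<n}" "j \<in> {..<n}" "i \<noteq> j"
        moreover have "{min (u i) m<..<min (v i) m} \<subseteq> {u i<..<v i}" for i by auto
        ultimately show "{min (u i) m<..<min (v i) m} \<inter> {min (u j) m<..<min (v j) m} = {}"
          using disj[of i j] by blast
      qed
      have "(\<Sum>i<n. min (v i) m - min (u i) m) \<le> (\<Sum>i<n. v i - u i)"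
        using * by (intro sum_mono) (auto simp: min_def)
      then show "(\<Sum>i<n. min (v i) m - min (u i) m) < \<delta>1" using * by simp
    qed (use * assms in \<open>auto simp: min_def\<close>)
    moreover have "(\<Sum>i<n. \<bar>f (max (v i) m) - f (max (u i) m)\<bar>) < \<epsilon>/2"
    proof (rule \<delta>2)
      show "disjoint_family_on (\<lambda>i. {max (u i) m<..<max (v i) m}) {..<n}"
        unfolding disjoint_family_on_def
      proof (intro ballI impI)
        fix i j assume "i \<in> {..<n}" "j \<in> {..<n}" "i \<noteq> j"
        moreover have "{max (u i) m<..<max (v i) m} \<subseteq> {u i<..<v i}" for i by auto
        ultimately show "{max (u i) m<..<max (v i) m} \<inter> {max (u j) m<..<max (v j) m} = {}"
          using disj[of i j] by blast
      qed
      have "(\<Sum>i<n. max (v i) m - max (u i) m) \<le> (\<Sum>i<n. v i - u i)"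
        using * by (intro sum_mono) (auto simp: max_def)
      then show "(\<Sum>i<n. max (v i) m - max (u i) m) < \<delta>2" using * by simp
    qed (use * assms in \<open>auto simp: max_def\<close>)
    moreover have "(\<Sum>i<n. \<bar>f (v i) - f (u i)\<bar>) \<le>
        (\<Sum>i<n. \<bar>f (min (v i) m) - f (min (u i) m)\<bar> + \<bar>f (max (v i) m) - f (max (u i) m)\<bar>)"
      by (rule sum_mono) (auto simp: min_def max_def)
    ultimately show "(\<Sum>i<n. \<bar>f (v i) - f (u i)\<bar>) < \<epsilon>"
      by (simp add: sum.distrib)
  qed
qed

text \<open>
  In a fine tagged division, the intervals tagged outside the exceptional null set are handled by
  differentiability at the tag. The other intervals lie in an open set of small measure, so
  absolute continuity makes their total contribution to \<open>f r - f l\<close> small, while the integrand may be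
  taken to vanish at their tags.
\<close>
lemma fundamental_theorem_of_calculus_abs_continuous:
  fixes f g :: "real \<Rightarrow> real"
  assumes "l \<le> r" and ac: "abs_continuous_on_interval l r f"
    and deriv: "AE t in lebesgue. l < t \<and> t < r \<longrightarrow> (f has_real_derivative g t) (at t)"
  shows "(g has_integral f r - f l) {l..r}"
proof (cases "l = r")
  case True then show ?thesis using has_integral_refl(2)[of g r] by simp
next
  case False
  with \<open>l \<le> r\<close> have lr: "l < r" by simp
  obtain N0 where N0: "N0 \<in> null_sets lebesgue"
    "{t. \<not> (l < t \<and> t < r \<longrightarrow> (f has_real_derivative g t) (at t))} \<subseteq> N0"
    using deriv unfolding eventually_ae_filter by auto
  define N where "N = N0 \<union> {l, r}"
  have N: "N \<in> null_sets lebesgue" unfolding N_def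
    using N0(1) by (intro null_sets.Un) (auto simp flip: negligible_iff_null_sets)
  have good: "(f has_real_derivative g t) (at t)" if "t \<in> {l..r}" "t \<notin> N" for t
    using that N0(2) by (force simp: N_def)
  \<comment> \<open>Changing the integrand on the null set removes its contribution at bad tags.\<close>
  define g' where "g' t = (if t \<in> N then 0 else g t)" for t
  have "(g' has_integral f r - f l) {l..r}"
    unfolding has_integral_factor_content_real
  proof (intro allI impI)
    fix e :: real assume "0 < e"
    then have e2: "0 < e / 2" and e3: "0 < e / 2 * (r - l)" using lr by auto
    \<comment> \<open>Half of the error is spent on good tags, the other half on tags in \<open>N\<close>.\<close>
    have "\<exists>d>0. x \<in> {l..r} - N \<longrightarrow>
         (\<forall>y. \<bar>y-x\<bar> < d \<longrightarrow> \<bar>f y - f x - (y-x) * g x\<bar> \<le> e/2 * \<bar>y-x\<bar>)" for x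
    proof (cases "x \<in> {l..r} - N")
      case True
      then have "(f has_derivative (\<lambda>h. h * g x)) (at x)"
        using good[of x] by (simp add: has_field_derivative_def mult_commute_abs)
      then show ?thesis using e2
        unfolding has_derivative_within_alt by (metis UNIV_I real_norm_def)
    qed (auto intro: zero_less_one)
    then obtain d where d0: "\<And>x. 0 < d x" and
      d: "\<And>x y. \<lbrakk>x \<in> {l..r} - N; \<bar>y-x\<bar> < d x\<rbrakk> \<Longrightarrow> \<bar>f y - f x - (y-x) * g x\<bar> \<le> e/2 * \<bar>y-x\<bar>"
      by metis
    obtain \<delta> where "0 < \<delta>" and \<delta>:
      "\<And>(I :: (real \<times> real set) set) u v. \<lbrakk>finite I; \<And>i. i \<in> I \<Longrightarrow> l \<le> u i \<and> u i \<le> v i \<and> v i \<le> r;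
         disjoint_family_on (\<lambda>i. {u i<..<v i}) I; (\<Sum>i\<in>I. v i - u i) < \<delta>\<rbrakk> \<Longrightarrow>
         (\<Sum>i\<in>I. \<bar>f (v i) - f (u i)\<bar>) < e/2 * (r - l)"
      by (rule abs_continuous_on_interval_finite_family[OF ac e3]) blast
    obtain U where U: "open U" "N \<subseteq> U" "(U - N) \<in> lmeasurable" "emeasure lebesgue (U - N) < ennreal \<delta>"
      using sets_lebesgue_outer_open[of N \<delta>] N \<open>0 < \<delta>\<close> by (auto simp: null_sets_def)
    have Ud: "emeasure lebesgue U < ennreal \<delta>"
      using U(4) N emeasure_Diff_null_set[of N lebesgue U] U(1) by auto
    have "\<exists>\<rho>>0. x \<in> N \<longrightarrow> ball x \<rho> \<subseteq> U" for x
      using U(1,2) by (meson open_contains_ball subsetD zero_less_one)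
    then obtain \<rho> where \<rho>0: "\<And>x. 0 < \<rho> x" and \<rho>: "\<And>x. x \<in> N \<Longrightarrow> ball x (\<rho> x) \<subseteq> U"
      by metis
    define G where "G x = ball x (if x \<in> N then \<rho> x else d x)" for x
    show "\<exists>d. gauge d \<and> (\<forall>p. p tagged_division_of {l..r} \<and> d fine p \<longrightarrow>
        norm (sum (\<lambda>(x,k). measure lborel k *\<^sub>R g' x) p - (f r - f l)) \<le> e * measure lborel {l..r})"
    proof (rule exI[of _ G], intro conjI allI impI)
      show "gauge G" unfolding G_def using \<rho>0 d0 by (intro gauge_ball_dependent) auto
      fix p assume "p tagged_division_of {l..r} \<and> G fine p"
      then have p: "p tagged_division_of {l..r}" and fine: "G fine p" by auto
      note pD = tagged_division_ofD[OF p]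
      have intv: "\<exists>u v. K = {u..v} \<and> u \<le> v \<and> l \<le> u \<and> v \<le> r \<and> x \<in> {u..v}" if "(x, K) \<in> p" for x K
        using pD(2,3,4)[OF that] by (auto simp: box_real)
      let ?u = "\<lambda>i :: real \<times> real set. Inf (snd i)"
      let ?v = "\<lambda>i :: real \<times> real set. Sup (snd i)"
      define P where "P = {i \<in> p. fst i \<in> N}"
      have "finite P" unfolding P_def using pD(1) by simp
      have PI: "l \<le> ?u i \<and> ?u i \<le> ?v i \<and> ?v i \<le> r" "snd i = {?u i..?v i}" if "i \<in> P" for i
      proof -
        obtain u v where "snd i = {u..v}" "u \<le> v" "l \<le> u" "v \<le> r"
          using intv[of "fst i" "snd i"] \<open>i \<in> P\<close> unfolding P_def by (metis (no_types, lifting) mem_Collect_eq prod.collapse)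
        then show "l \<le> ?u i \<and> ?u i \<le> ?v i \<and> ?v i \<le> r" "snd i = {?u i..?v i}" by simp_all
      qed
      have disj: "disjoint_family_on (\<lambda>i. {?u i<..<?v i}) P"
        unfolding disjoint_family_on_def
      proof (intro ballI impI)
        fix i j assume ij: "i \<in> P" "j \<in> P" "i \<noteq> j"
        then have "interior (snd i) \<inter> interior (snd j) = {}"
          using pD(5)[of "fst i" "snd i" "fst j" "snd j"] by (auto simp: P_def prod_eq_iff)
        moreover have "interior (snd k) = {?u k<..<?v k}" if "k \<in> P" for k
          using PI(2)[OF that] by (metis interior_atLeastAtMost_real)
        ultimately show "{?u i<..<?v i} \<inter> {?u j<..<?v j} = {}" using ij by simp
      qed
      have bad: "(\<Sum>i\<in>P. \<bar>f (?v i) - f (?u i)\<bar>) < e/2 * (r - l)"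
      proof (rule \<delta>[OF \<open>finite P\<close> _ disj])
        show "l \<le> ?u i \<and> ?u i \<le> ?v i \<and> ?v i \<le> r" if "i \<in> P" for i
          using PI(1)[OF that] .
        have sub: "(\<Union>i\<in>P. {?u i<..<?v i}) \<subseteq> U"
        proof (rule UN_least)
          fix i assume i: "i \<in> P"
          then have "snd i \<subseteq> ball (fst i) (\<rho> (fst i))"
            using fineD[OF fine, of "fst i" "snd i"] by (auto simp: P_def G_def)
          moreover have "{?u i<..<?v i} \<subseteq> snd i"
            using PI(2)[OF i] by (metis greaterThanLessThan_subseteq_atLeastAtMost_iff order_refl)
          ultimately show "{?u i<..<?v i} \<subseteq> U" using \<rho>[of "fst i"] i by (auto simp: P_def)
        qed
        have "ennreal (\<Sum>i\<in>P. ?v i - ?u i) = (\<Sum>i\<in>P. ennreal (?v i - ?u i))"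
          using PI(1) by (intro sum_ennreal[symmetric]) simp
        also have "\<dots> = (\<Sum>i\<in>P. emeasure lebesgue {?u i<..<?v i})"
          using PI(1) by (intro sum.cong) simp_all
        also have "\<dots> = emeasure lebesgue (\<Union>i\<in>P. {?u i<..<?v i})"
          using disj \<open>finite P\<close> by (intro sum_emeasure) auto
        also have "\<dots> \<le> emeasure lebesgue U"
          using sub U(1) by (intro emeasure_mono) auto
        also have "\<dots> < ennreal \<delta>" by (rule Ud)
        finally show "(\<Sum>i\<in>P. ?v i - ?u i) < \<delta>"
          using \<open>0 < \<delta>\<close> ennreal_less_iff by (metis (no_types, lifting) ennreal_leI linorder_not_less)
      qed
      have ba: "r - l = (\<Sum>(x,K)\<in>p. Sup K - Inf K)" "f r - f l = (\<Sum>(x,K)\<in>p. f(Sup K) - f(Inf K))"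
        using additive_tagged_division_1[where f= "\<lambda>x. x"] additive_tagged_division_1[where f= f]
            \<open>l \<le> r\<close> p by auto
      have "\<bar>\<Sum>(x, K) \<in> p. measure lborel K * g' x - (f (Sup K) - f (Inf K))\<bar>
          \<le> (\<Sum>i\<in>p. e/2 * (?v i - ?u i) + (if i \<in> P then \<bar>f (?v i) - f (?u i)\<bar> else 0))"
      proof (rule order_trans[OF sum_abs], rule sum_mono, clarify)
        fix x K assume xK: "(x, K) \<in> p"
        then obtain u v where K: "K = {u..v}" "u \<le> v" "l \<le> u" "v \<le> r" "x \<in> {u..v}"
          using intv by meson
        show "\<bar>measure lborel K * g' x - (f (Sup K) - f (Inf K))\<bar> \<le>
           e/2 * (Sup (snd (x, K)) - Inf (snd (x, K))) + (if (x, K) \<in> P then \<bar>f (Sup (snd (x, K))) - f (Inf (snd (x, K)))\<bar> else 0)"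
        proof (cases "x \<in> N")
          case True
          moreover have "0 \<le> e/2 * (v - u)" using e2 K by (intro mult_nonneg_nonneg) auto
          ultimately show ?thesis using K xK by (auto simp: P_def g'_def abs_minus_commute)
        next
          case False
          then have "K \<subseteq> ball x (d x)" using fineD[OF fine xK] by (auto simp: G_def)
          moreover have "u \<in> K" "v \<in> K" using K by auto
          ultimately have "u \<in> ball x (d x)" "v \<in> ball x (d x)" by blast+
          then have "\<bar>u - x\<bar> < d x" "\<bar>v - x\<bar> < d x"
            by (auto simp: dist_real_def)
          then have "\<bar>f u - f x - (u-x) * g x\<bar> \<le> e/2 * (x - u)" "\<bar>f v - f x - (v-x) * g x\<bar> \<le> e/2 * (v - x)"
            using d[of x u] d[of x v] K False by auto
          moreover have "(v - u) * g x - (f v - f u) = (f u - f x - (u-x) * g x) - (f v - f x - (v-x) * g x)"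
            by (simp add: algebra_simps)
          ultimately have "\<bar>(v - u) * g x - (f v - f u)\<bar> \<le> e/2 * (x - u) + e/2 * (v - x)" by linarith
          also have "\<dots> = e/2 * (v - u)" by (simp flip: distrib_left)
          finally show ?thesis using K False by (auto simp: P_def g'_def)
        qed
      qed
      also have "\<dots> = e/2 * (r - l) + (\<Sum>i\<in>P. \<bar>f (?v i) - f (?u i)\<bar>)"
      proof -
        have "(\<Sum>i\<in>p. if i \<in> P then \<bar>f (?v i) - f (?u i)\<bar> else 0) = (\<Sum>i\<in>P. \<bar>f (?v i) - f (?u i)\<bar>)"
          using pD(1) by (subst sum.inter_restrict[symmetric]) (auto simp: P_def intro!: sum.cong)
        then show ?thesis by (simp add: ba(1) sum.distrib sum_distrib_left split_def)
      qed
      also have "\<dots> \<le> e * (r - l)" using bad by (simp add: field_simps)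
      finally show "norm (sum (\<lambda>(x,k). measure lborel k *\<^sub>R g' x) p - (f r - f l)) \<le> e * measure lborel {l..r}"
        using \<open>l \<le> r\<close> by (simp add: ba(2) split_def sum_subtractf)
    qed
  qed
  then show ?thesis
    by (rule has_integral_spike[of N, rotated 2])
       (use N in \<open>auto simp: negligible_iff_null_sets g'_def\<close>)
qed

text \<open>
  The Cauchy--Schwarz inequality for a Henstock--Kurzweil integral whose integrand has a square of
  finite Lebesgue integral. Absolute integrability comes out of the same estimate.
\<close>
lemma has_integral_square_le:
  fixes g :: "real \<Rightarrow> real"
  assumes "l \<le> r" and I: "(g has_integral I) {l..r}" and "0 \<le> Q"
    and Q: "(\<integral>\<^sup>+t\<in>{l..r}. ennreal ((g t)\<^sup>2) \<partial>lebesgue) \<le> ennreal Q"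
  shows "I\<^sup>2 \<le> (r - l) * Q"
proof -
  let ?M = "lebesgue_on {l..r}"
  have meas: "g \<in> borel_measurable ?M"
    using I by (intro integrable_imp_measurable) (auto simp: integrable_on_def)
  have eM: "emeasure ?M (space ?M) = ennreal (r - l)"
    using \<open>l \<le> r\<close> by (simp add: emeasure_restrict_space)
  have Q': "(\<integral>\<^sup>+t. ennreal ((g t)\<^sup>2) \<partial>?M) \<le> ennreal Q"
    using Q by (simp add: nn_integral_restrict_space)
  \<comment> \<open>Young's inequality with a free parameter; the choice \<open>\<eta> = \<bar>I\<bar> / (r - l)\<close> below is optimal.\<close>
  have key: "\<bar>I\<bar> \<le> \<eta> / 2 * (r - l) + Q / (2 * \<eta>)" if "0 < \<eta>" for \<eta>
  proof -
    have am: "\<bar>x\<bar> \<le> \<eta> / 2 + x\<^sup>2 / (2 * \<eta>)" for x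
    proof -
      have "0 \<le> (\<bar>x\<bar> - \<eta>)\<^sup>2" by simp
      then have "2 * \<eta> * \<bar>x\<bar> \<le> \<eta>\<^sup>2 + x\<^sup>2" by (simp add: power2_diff algebra_simps)
      then show ?thesis using \<open>0 < \<eta>\<close> by (simp add: field_simps power2_eq_square)
    qed
    have "(\<integral>\<^sup>+t. ennreal (norm (g t)) \<partial>?M) \<le> (\<integral>\<^sup>+t. ennreal (\<eta> / 2) + ennreal (1 / (2 * \<eta>)) * ennreal ((g t)\<^sup>2) \<partial>?M)"
    proof (rule nn_integral_mono)
      fix t
      have "ennreal (norm (g t)) \<le> ennreal (\<eta> / 2 + 1 / (2 * \<eta>) * (g t)\<^sup>2)"
        using am[of "g t"] by (intro ennreal_leI) simp
      also have "\<dots> = ennreal (\<eta> / 2) + ennreal (1 / (2 * \<eta>)) * ennreal ((g t)\<^sup>2)"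
        using \<open>0 < \<eta>\<close> by (simp add: ennreal_plus ennreal_mult[symmetric])
      finally show "ennreal (norm (g t)) \<le> \<dots>" .
    qed
    also have "\<dots> = ennreal (\<eta> / 2) * ennreal (r - l) + ennreal (1 / (2 * \<eta>)) * (\<integral>\<^sup>+t. ennreal ((g t)\<^sup>2) \<partial>?M)"
      using meas eM by (subst nn_integral_add) (simp_all add: nn_integral_cmult)
    also have "\<dots> \<le> ennreal (\<eta> / 2) * ennreal (r - l) + ennreal (1 / (2 * \<eta>)) * ennreal Q"
      using Q' by (intro add_mono mult_left_mono) auto
    also have "\<dots> = ennreal (\<eta> / 2 * (r - l) + Q / (2 * \<eta>))"
      using \<open>0 < \<eta>\<close> \<open>l \<le> r\<close> \<open>0 \<le> Q\<close> by (simp add: ennreal_plus ennreal_mult[symmetric])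
    finally have bound: "(\<integral>\<^sup>+t. ennreal (norm (g t)) \<partial>?M) \<le> ennreal (\<eta> / 2 * (r - l) + Q / (2 * \<eta>))" .
    then have int: "integrable ?M g"
      using meas by (intro integrableI_bounded) (auto intro: le_less_trans)
    have "integral\<^sup>L ?M g = I"
      using has_integral_integral_lebesgue_on[OF int] I by (auto intro: has_integral_unique)
    then have "ennreal \<bar>I\<bar> \<le> ennreal (\<eta> / 2 * (r - l) + Q / (2 * \<eta>))"
      using integral_norm_bound_ennreal[OF int] bound by (auto intro: order_trans)
    then show ?thesis
      using \<open>0 < \<eta>\<close> \<open>l \<le> r\<close> \<open>0 \<le> Q\<close> by (subst (asm) ennreal_le_iff) auto
  qed
  show ?thesis
  proof (cases "I = 0 \<or> l = r")
    case True
    then show ?thesis using I \<open>l \<le> r\<close> \<open>0 \<le> Q\<close> has_integral_refl(2)[of g r] by (auto dest: has_integral_unique)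
  next
    case False
    then have "0 < \<bar>I\<bar>" "0 < r - l" using \<open>l \<le> r\<close> by auto
    moreover have "\<bar>I\<bar> / L / 2 * L = \<bar>I\<bar> / 2" "Q / (2 * (\<bar>I\<bar> / L)) = Q * L / (2 * \<bar>I\<bar>)" if "0 < L" for L :: real
      using that by simp_all
    ultimately have "\<bar>I\<bar> \<le> \<bar>I\<bar> / 2 + Q * (r - l) / (2 * \<bar>I\<bar>)"
      using key[of "\<bar>I\<bar> / (r - l)"] by (metis divide_pos_pos)
    then have "\<bar>I\<bar> * \<bar>I\<bar> \<le> Q * (r - l)"
      using \<open>0 < \<bar>I\<bar>\<close> by (simp add: field_simps)
    then show ?thesis by (simp add: power2_eq_square mult.commute)
  qed
qed

section \<open>Logarithmic mean and flux cost\<close>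

lemma log_mean_commute:
  assumes "0 \<le> u" "0 \<le> v"
  shows "log_mean u v = log_mean v u"
proof -
  have "(u - v) / (ln u - ln v) = (v - u) / (ln v - ln u)"
    by (metis minus_diff_eq minus_divide_divide)
  then show ?thesis using assms by (simp add: log_mean_closed_form)
qed

lemma log_mean_bounds:
  assumes "0 < c" "c \<le> u" "c \<le> v" "u \<le> B" "v \<le> B"
  shows "c \<le> log_mean u v" "log_mean u v \<le> B"
proof -
  have pos: "0 < u" "0 < v" "0 < B" using assms by auto
  have int: "(\<lambda>\<xi>. u powr \<xi> * v powr (1 - \<xi>)) integrable_on {0..1}"
    using pos by (intro integrable_continuous_real continuous_intros) auto
  have "c powr \<xi> * c powr (1 - \<xi>) \<le> u powr \<xi> * v powr (1 - \<xi>)"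
    "u powr \<xi> * v powr (1 - \<xi>) \<le> B powr \<xi> * B powr (1 - \<xi>)" if "\<xi> \<in> {0..1}" for \<xi>
    using that assms pos by (auto intro!: mult_mono powr_mono2)
  moreover have "z powr \<xi> * z powr (1 - \<xi>) = z" if "0 < z" for z \<xi> :: real
    using that by (simp flip: powr_add)
  ultimately have le: "c \<le> u powr \<xi> * v powr (1 - \<xi>)" "u powr \<xi> * v powr (1 - \<xi>) \<le> B"
    if "\<xi> \<in> {0..1}" for \<xi>
    using that assms pos by force+
  have "integral {0..1::real} (\<lambda>_. c) \<le> log_mean u v"
    unfolding log_mean_def using le int by (intro integral_le) auto
  then show "c \<le> log_mean u v" by simp
  have "log_mean u v \<le> integral {0..1::real} (\<lambda>_. B)"
    unfolding log_mean_def using le int by (intro integral_le) auto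
  then show "log_mean u v \<le> B" by simp
qed

lemma log_mean_nonneg: "0 \<le> u \<Longrightarrow> 0 \<le> v \<Longrightarrow> 0 \<le> log_mean u v"
  using log_mean_bounds(1)[of "min u v" u v "max u v"]
  by (cases "u = 0 \<or> v = 0") (force simp: log_mean_closed_form, fastforce)

lemma log_mean_le: "0 \<le> u \<Longrightarrow> 0 \<le> v \<Longrightarrow> u \<le> B \<Longrightarrow> v \<le> B \<Longrightarrow> log_mean u v \<le> B"
  using log_mean_bounds(2)[of "min u v" u v B]
  by (cases "u = 0 \<or> v = 0") (force simp: log_mean_closed_form, fastforce)

lemma borel_measurable_log_mean:
  assumes [measurable]: "f \<in> borel_measurable M" "g \<in> borel_measurable M"
    and "\<And>t. t \<in> space M \<Longrightarrow> 0 \<le> f t \<and> 0 \<le> g t"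
  shows "(\<lambda>t. log_mean (f t) (g t)) \<in> borel_measurable M"
proof -
  have "(\<lambda>t. if f t = 0 \<or> g t = 0 then 0 else if f t = g t then f t else (f t - g t) / (ln (f t) - ln (g t)))
      \<in> borel_measurable M"
    by measurable
  then show ?thesis
    using assms(3) by (subst measurable_cong[where g = "\<lambda>t. if f t = 0 \<or> g t = 0 then 0 else if f t = g t then f t else (f t - g t) / (ln (f t) - ln (g t))"]) (auto simp: log_mean_closed_form)
qed

lemma flux_cost_scale: "flux_cost (c * v) s t = ennreal (c\<^sup>2) * flux_cost v s t"
  by (simp add: flux_cost_def power_mult_distrib ennreal_mult ennreal_times_divide)

lemma flux_cost_pos_mean:
  "0 < log_mean s t \<Longrightarrow> flux_cost v s t = ennreal (v\<^sup>2 / log_mean s t)"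
  by (simp add: flux_cost_def divide_ennreal)

lemma flux_cost_zero_mean:
  "log_mean s t = 0 \<Longrightarrow> flux_cost v s t = (if v = 0 then 0 else \<infinity>)"
  by (simp add: flux_cost_def)

text \<open>
  On a bounded set of densities the action dominates the square of the flux, because the
  logarithmic mean of two numbers is at most their maximum.
\<close>
lemma flux_cost_ge:
  assumes "0 \<le> s" "0 \<le> t" "s \<le> B" "t \<le> B" "0 < B"
  shows "ennreal (v\<^sup>2) \<le> ennreal B * flux_cost v s t"
proof (cases "log_mean s t = 0")
  case True
  then show ?thesis using \<open>0 < B\<close> by (simp add: flux_cost_zero_mean ennreal_mult_top)
next
  case False
  then have pos: "0 < log_mean s t" using log_mean_nonneg[of s t] assms by simp
  have "v\<^sup>2 * log_mean s t \<le> v\<^sup>2 * B"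
    using log_mean_le[of s t B] assms by (intro mult_left_mono) auto
  then have "v\<^sup>2 \<le> B * (v\<^sup>2 / log_mean s t)"
    using pos by (simp add: field_simps)
  then show ?thesis
    using pos \<open>0 < B\<close> by (simp add: flux_cost_pos_mean ennreal_mult[symmetric])
qed

section \<open>Resolvents of self-adjoint operators\<close>

text \<open>
  The equation \<open>L \<psi> = g\<close> is solvable because the range of a self-adjoint operator is the orthogonal
  complement of its kernel, but the solution is not unique. Tikhonov regularisation selects the
  solution in the range of \<open>L\<close>. This gives a limit of explicit expressions in \<open>L\<close> and \<open>g\<close>, hence
  measurable dependence on a parameter.
\<close>
lemma selfadjoint_resolvent_limit:
  fixes L :: "'a::euclidean_space \<Rightarrow> 'a"
  assumes lin: "linear L" and sym: "\<And>x y. L x \<bullet> y = x \<bullet> L y" and psd: "\<And>x. 0 \<le> L x \<bullet> x"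
    and ker: "\<And>z. L z = 0 \<Longrightarrow> g \<bullet> z = 0"
    and u: "\<And>n. L (u n) + (1 / real (Suc n)) *\<^sub>R u n = g"
  obtains \<psi> where "L \<psi> = g" "u \<longlonglongrightarrow> \<psi>"
proof -
  \<comment> \<open>The space is the orthogonal sum of the range and the kernel of \<open>L\<close>.\<close>
  have decomp: "\<exists>\<phi> z. x = L \<phi> + z \<and> L z = 0" for x
  proof -
    have sub: "span (range L) = range L"
      using lin by (simp add: subspace_UNIV linear_subspace_image)
    obtain y z where y: "y \<in> span (range L)" and z: "\<And>w. w \<in> span (range L) \<Longrightarrow> orthogonal z w"
      and x: "x = y + z"
      using orthogonal_subspace_decomp_exists by blast
    have "orthogonal z (L (L z))" using z sub by blast
    then have "L z \<bullet> L z = 0" by (simp add: orthogonal_def sym inner_commute)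
    then show ?thesis using x y sub by auto
  qed
  obtain \<psi>0 z where g: "g = L \<psi>0 + z" and z: "L z = 0" using decomp by blast
  have "z \<bullet> z = 0"
  proof -
    have "g \<bullet> z = \<psi>0 \<bullet> L z + z \<bullet> z" by (simp add: g inner_add_left sym)
    then show ?thesis using ker[OF z] z by simp
  qed
  then have g0: "g = L \<psi>0" using g by simp
  obtain \<phi> z' where \<psi>0: "\<psi>0 = L \<phi> + z'" and z': "L z' = 0" using decomp by blast
  \<comment> \<open>Writing the distinguished solution as \<open>L \<phi>\<close> turns the residual \<open>\<epsilon> *\<^sub>R \<psi>\<close> of the
    resolvent equation into a term that positivity of \<open>L\<close> absorbs up to order \<open>\<epsilon>\<^sup>2\<close>.\<close>
  define \<psi> where "\<psi> = L \<phi>"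
  have L\<psi>: "L \<psi> = g" using g0 \<psi>0 z' by (simp add: \<psi>_def linear_add[OF lin])
  have bound: "(norm (u n - \<psi>))\<^sup>2 \<le> (L \<phi> \<bullet> \<phi>) / 4 * (1 / real (Suc n))" for n
  proof -
    define \<epsilon> where "\<epsilon> = 1 / real (Suc n)"
    define e where "e = u n - \<psi>"
    have \<epsilon>: "0 < \<epsilon>" by (simp add: \<epsilon>_def)
    have "L e + \<epsilon> *\<^sub>R e = - \<epsilon> *\<^sub>R L \<phi>"
      using u[of n] L\<psi> by (simp add: e_def \<epsilon>_def \<psi>_def linear_diff[OF lin] algebra_simps)
    then have "(L e + \<epsilon> *\<^sub>R e) \<bullet> e = (- \<epsilon> *\<^sub>R L \<phi>) \<bullet> e" by simp
    then have eq: "L e \<bullet> e + \<epsilon> * (norm e)\<^sup>2 = - \<epsilon> * (L \<phi> \<bullet> e)"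
      by (simp add: inner_add_left power2_norm_eq_inner)
    \<comment> \<open>The shift by \<open>\<epsilon> / 2\<close> is chosen so that the cross term cancels against \<open>eq\<close>.\<close>
    have "0 \<le> L (e + (\<epsilon>/2) *\<^sub>R \<phi>) \<bullet> (e + (\<epsilon>/2) *\<^sub>R \<phi>)" by (rule psd)
    also have "\<dots> = L e \<bullet> e + \<epsilon> * (L \<phi> \<bullet> e) + \<epsilon>\<^sup>2 / 4 * (L \<phi> \<bullet> \<phi>)"
      using sym[of e \<phi>]
      by (simp add: linear_add[OF lin] linear_scale[OF lin] inner_add_left inner_add_right
          power2_eq_square algebra_simps inner_commute)
    finally have "\<epsilon> * (norm e)\<^sup>2 \<le> \<epsilon> * (\<epsilon> / 4 * (L \<phi> \<bullet> \<phi>))"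
      using eq by (simp add: power2_eq_square)
    then have "(norm e)\<^sup>2 \<le> \<epsilon> / 4 * (L \<phi> \<bullet> \<phi>)" using \<epsilon> by simp
    then show ?thesis by (simp add: e_def \<epsilon>_def mult.commute)
  qed
  have "(\<lambda>n. (L \<phi> \<bullet> \<phi>) / 4 * (1 / real (Suc n))) \<longlonglongrightarrow> (L \<phi> \<bullet> \<phi>) / 4 * 0"
    by (intro tendsto_intros LIMSEQ_Suc[OF lim_1_over_n])
  then have "(\<lambda>n. (L \<phi> \<bullet> \<phi>) / 4 * (1 / real (Suc n))) \<longlonglongrightarrow> 0" by simp
  then have "(\<lambda>n. (norm (u n - \<psi>))\<^sup>2) \<longlonglongrightarrow> 0"
    by (rule real_tendsto_sandwich[OF _ _ tendsto_const, rotated 2]) (use bound in \<open>auto intro!: always_eventually\<close>)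
  then have "(\<lambda>n. norm (u n - \<psi>)) \<longlonglongrightarrow> 0"
    using tendsto_real_sqrt[of "\<lambda>n. (norm (u n - \<psi>))\<^sup>2" 0] by simp
  then have "u \<longlonglongrightarrow> \<psi>" by (simp add: tendsto_norm_zero_iff LIM_zero_iff)
  with L\<psi> show thesis by (rule that)
qed

lemma borel_measurable_det:
  fixes A :: "'a \<Rightarrow> real^'n^'n"
  assumes "\<And>i j. (\<lambda>t. A t $ i $ j) \<in> borel_measurable M"
  shows "(\<lambda>t. det (A t)) \<in> borel_measurable M"
  unfolding det_def using assms by (intro borel_measurable_sum borel_measurable_times borel_measurable_prod) auto

section \<open>Curves driven by a flux\<close>

locale transport_setting =
  fixes K :: "'x::finite \<Rightarrow> 'x \<Rightarrow> real" and \<pi> p :: "'x \<Rightarrow> real" and a b :: real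
  assumes markov: "markov_kernel K"
    and irreducible: "irreducible_kernel K"
    and invariant: "invariant_probability K \<pi>"
    and reversible: "reversible_kernel K \<pi>"
    and a_pos: "0 < a" and b_pos: "0 < b"
    and p_pos_densities: "p \<in> pos_densities"
    and p_mass: "(\<Sum>x\<in>UNIV. p x * \<pi> x) = 1"
begin

lemma K_nonneg: "0 \<le> K x y"
  using markov by (simp add: markov_kernel_def)

lemma detailed_balance: "K x y * \<pi> x = K y x * \<pi> y"
  using reversible by (simp add: reversible_kernel_def)

lemma p_pos: "0 < p x"
  using p_pos_densities by (simp add: pos_densities_def)

text \<open>
  Detailed balance carries positivity along edges, and irreducibility reaches every state.
\<close>
lemma \<pi>_pos: "0 < \<pi> x"
proof -
  have nn: "0 \<le> \<pi> y" for y using invariant unfolding invariant_probability_def by blast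
  have "(\<Sum>y\<in>UNIV. \<pi> y) = 1" using invariant unfolding invariant_probability_def by blast
  then obtain z where "\<pi> z \<noteq> 0" by (metis sum.neutral zero_neq_one)
  then have "0 < \<pi> z" using nn[of z] by simp
  have "(z, x) \<in> {(u, v). 0 < K u v}\<^sup>*"
    using irreducible by (simp add: irreducible_kernel_def)
  then show ?thesis using \<open>0 < \<pi> z\<close>
  proof (induction rule: rtrancl_induct)
    case (step u v)
    then have "0 < K u v * \<pi> u" by simp
    then have "0 < K v u * \<pi> v" by (metis detailed_balance)
    then show ?case using nn[of v] by (metis less_eq_real_def mult_zero_right less_irrefl)
  qed
qed

text \<open>
  The continuity equation on an arbitrary interval, so that curves can be cut and glued. The
  derivative is two-sided at interior times only, which is the same condition up to a null set and
  is stable under restriction.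
\<close>
definition flux_path :: "real \<Rightarrow> real \<Rightarrow> (real \<Rightarrow> 'x \<Rightarrow> real) \<Rightarrow> (real \<Rightarrow> 'x \<Rightarrow> 'x \<Rightarrow> real) \<Rightarrow> (real \<Rightarrow> real) \<Rightarrow> bool" where
  "flux_path l r \<mu> V h \<longleftrightarrow>
     (\<forall>t\<in>{l..r}. \<mu> t \<in> nonneg_densities) \<and>
     (\<forall>x. abs_continuous_on_interval l r (\<lambda>t. \<mu> t x)) \<and>
     (\<forall>x y. (\<lambda>t. V t x y) \<in> borel_measurable (lebesgue_on {l..r})) \<and>
     h \<in> borel_measurable (lebesgue_on {l..r}) \<and>
     (AE t in lebesgue. l < t \<and> t < r \<longrightarrow>
        (\<forall>x. ((\<lambda>s. \<mu> s x) has_real_derivative h t * p x - discrete_divergence K (V t) x) (at t)))"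

definition action_density :: "('x \<Rightarrow> real) \<Rightarrow> ('x \<Rightarrow> 'x \<Rightarrow> real) \<Rightarrow> real \<Rightarrow> ennreal" where
  "action_density \<mu> V h = ennreal (a\<^sup>2) * ennreal (h\<^sup>2) + ennreal (b\<^sup>2) * flux_action K \<pi> \<mu> V"

definition path_energy :: "real \<Rightarrow> real \<Rightarrow> (real \<Rightarrow> 'x \<Rightarrow> real) \<Rightarrow> (real \<Rightarrow> 'x \<Rightarrow> 'x \<Rightarrow> real) \<Rightarrow> (real \<Rightarrow> real) \<Rightarrow> ennreal" where
  "path_energy l r \<mu> V h = (\<integral>\<^sup>+t\<in>{l..r}. action_density (\<mu> t) (V t) (h t) \<partial>lebesgue)"

lemma flux_path_measurable:
  assumes "flux_path l r \<mu> V h"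
  shows "(\<lambda>t. \<mu> t x) \<in> borel_measurable (lebesgue_on {l..r})"
    and "(\<lambda>t. V t x y) \<in> borel_measurable (lebesgue_on {l..r})"
    and "h \<in> borel_measurable (lebesgue_on {l..r})"
    and "(\<lambda>t. flux_action K \<pi> (\<mu> t) (V t)) \<in> borel_measurable (lebesgue_on {l..r})"
    and "(\<lambda>t. action_density (\<mu> t) (V t) (h t)) \<in> borel_measurable (lebesgue_on {l..r})"
proof -
  show \<mu>[measurable]: "(\<lambda>t. \<mu> t x) \<in> borel_measurable (lebesgue_on {l..r})" for x
    using assms by (intro continuous_imp_measurable_on_sets_lebesgue abs_continuous_on_interval_imp_continuous_on)
      (auto simp: flux_path_def)
  show V[measurable]: "(\<lambda>t. V t x y) \<in> borel_measurable (lebesgue_on {l..r})" for x y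
    using assms by (simp add: flux_path_def)
  show h[measurable]: "h \<in> borel_measurable (lebesgue_on {l..r})"
    using assms by (simp add: flux_path_def)
  have [measurable]: "(\<lambda>t. log_mean (\<mu> t x) (\<mu> t y)) \<in> borel_measurable (lebesgue_on {l..r})" for x y
    using assms by (intro borel_measurable_log_mean \<mu>) (auto simp: flux_path_def nonneg_densities_def)
  show A[measurable]: "(\<lambda>t. flux_action K \<pi> (\<mu> t) (V t)) \<in> borel_measurable (lebesgue_on {l..r})"
    unfolding flux_action_def flux_cost_def by measurable
  show "(\<lambda>t. action_density (\<mu> t) (V t) (h t)) \<in> borel_measurable (lebesgue_on {l..r})"
    unfolding action_density_def by measurable
qed

lemma continuity_equation_iff_flux_path:
  "(\<mu>, V, h) \<in> continuity_equation K p \<mu>0 \<mu>1 \<longleftrightarrow> flux_path 0 1 \<mu> V h \<and> \<mu> 0 = \<mu>0 \<and> \<mu> 1 = \<mu>1"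
proof -
  have within: "at t within {0..1} = at t" if "0 < t" "t < 1" for t :: real
    using that by (intro at_within_interior) auto
  have ne: "AE t in lebesgue. t \<noteq> (0::real) \<and> t \<noteq> 1"
    using AE_completion[OF AE_lborel_singleton[of "0::real"]] AE_completion[OF AE_lborel_singleton[of "1::real"]]
    by eventually_elim simp
  have "(AE t in lebesgue_on {0..1}. \<forall>x. \<exists>d.
           ((\<lambda>s. \<mu> s x) has_real_derivative d) (at t within {0..1}) \<and>
           d + discrete_divergence K (V t) x = h t * p x) \<longleftrightarrow>
        (AE t in lebesgue. t \<in> {0..1} \<longrightarrow> (\<forall>x. \<exists>d.
           ((\<lambda>s. \<mu> s x) has_real_derivative d) (at t within {0..1}) \<and>
           d + discrete_divergence K (V t) x = h t * p x))"
    by (subst AE_restrict_space_iff) simp_all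
  also have "\<dots> \<longleftrightarrow> (AE t in lebesgue. 0 < t \<and> t < 1 \<longrightarrow>
        (\<forall>x. ((\<lambda>s. \<mu> s x) has_real_derivative h t * p x - discrete_divergence K (V t) x) (at t)))"
    (is "?L \<longleftrightarrow> ?R")
  proof
    have eq: "d = h t * p x - discrete_divergence K (V t) x"
      if "d + discrete_divergence K (V t) x = h t * p x" for d t x
      using that by simp
    assume ?L then show ?R
      by eventually_elim (use eq within in fastforce)
  next
    assume ?R
    with ne show ?L
    proof eventually_elim
      case (elim t)
      then show ?case
        using within[of t] by (force intro!: exI[of _ "h t * p x - discrete_divergence K (V t) x" for x])
    qed
  qed
  finally show ?thesis
    by (auto simp: continuity_equation_def ac_curve_def flux_path_def)
qed

lemma quad_energy_eq_path_energy:
  assumes "flux_path 0 1 \<mu> V h"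
  shows "quad_energy K \<pi> a b \<mu> V h = path_energy 0 1 \<mu> V h"
proof -
  note [measurable] = flux_path_measurable(3,4)[OF assms]
  have "quad_energy K \<pi> a b \<mu> V h = (\<integral>\<^sup>+t. action_density (\<mu> t) (V t) (h t) \<partial>lebesgue_on {0..1})"
    unfolding quad_energy_def action_density_def
    by (simp add: nn_integral_add nn_integral_cmult)
  then show ?thesis by (simp add: path_energy_def nn_integral_restrict_space)
qed

lemma flux_path_subinterval:
  assumes "flux_path l r \<mu> V h" "l \<le> l'" "r' \<le> r"
  shows "flux_path l' r' \<mu> V h"
proof -
  have sub: "{l'..r'} \<subseteq> {l..r}" using assms by auto
  have "f \<in> borel_measurable (lebesgue_on {l'..r'})"
    if "f \<in> borel_measurable (lebesgue_on {l..r})" for f :: "real \<Rightarrow> real"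
    using measurable_restrict_mono[OF that sub] .
  moreover have "abs_continuous_on_interval l' r' (\<lambda>t. \<mu> t x)" for x
    using assms unfolding flux_path_def by (blast intro: abs_continuous_on_interval_subinterval)
  moreover have "AE t in lebesgue. l' < t \<and> t < r' \<longrightarrow>
        (\<forall>x. ((\<lambda>s. \<mu> s x) has_real_derivative h t * p x - discrete_divergence K (V t) x) (at t))"
    by (rule eventually_mono[OF conjunct2[OF conjunct2[OF conjunct2[OF conjunct2[OF assms(1)[unfolded flux_path_def]]]]]])
       (use assms(2,3) in simp)
  ultimately show ?thesis using assms(1) sub unfolding flux_path_def by blast
qed

lemma action_density_scale: "action_density \<mu> (\<lambda>x y. c * V x y) (c * h) = ennreal (c\<^sup>2) * action_density \<mu> V h"
  by (simp add: action_density_def flux_action_def flux_cost_scale power_mult_distrib ennreal_mult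
      sum_distrib_left distrib_left mult_ac)

lemma discrete_divergence_scale: "discrete_divergence K (\<lambda>x y. c * V x y) x = c * discrete_divergence K V x"
  by (simp add: discrete_divergence_def sum_distrib_left algebra_simps)

text \<open>
  Flux and growth rate scale with the slope \<open>c\<close>, the action with its square, and the change of
  variables gives back one factor \<open>1 / \<bar>c\<bar>\<close>.
\<close>
lemma flux_path_affine:
  assumes path: "flux_path l r \<mu> V h" and "c \<noteq> 0"
    and \<sigma>: "\<And>t. t \<in> {l'..r'} \<longleftrightarrow> s + c * t \<in> {l..r}"
  defines "\<mu>' \<equiv> \<lambda>t. \<mu> (s + c * t)" and "V' \<equiv> \<lambda>t x y. c * V (s + c * t) x y" and "h' \<equiv> \<lambda>t. c * h (s + c * t)"
  shows "flux_path l' r' \<mu>' V' h'"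
    and "path_energy l' r' \<mu>' V' h' = ennreal \<bar>c\<bar> * path_energy l r \<mu> V h"
proof -
  have \<sigma>m: "(\<lambda>t. s + c * t) \<in> lebesgue \<rightarrow>\<^sub>M lebesgue"
    using lebesgue_affine_measurable[of "\<lambda>_. c" s] \<open>c \<noteq> 0\<close> by simp
  have "(\<lambda>t. s + c * t) \<in> lebesgue_on {l'..r'} \<rightarrow>\<^sub>M lebesgue_on {l..r}"
    by (rule measurable_restrict_space3[OF \<sigma>m]) (use \<sigma> in auto)
  then have comp: "(\<lambda>t. f (s + c * t)) \<in> borel_measurable (lebesgue_on {l'..r'})"
    if "f \<in> borel_measurable (lebesgue_on {l..r})" for f :: "real \<Rightarrow> real"
    using measurable_compose that by blast
  have \<sigma>i: "l < s + c * t \<and> s + c * t < r" if "l' < t" "t < r'" for t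
  proof -
    have "s + c * l' \<in> {l..r}" "s + c * r' \<in> {l..r}" using \<sigma>[of l'] \<sigma>[of r'] that by auto
    moreover have "c * t < c * r' \<and> c * l' < c * t \<or> c * r' < c * t \<and> c * t < c * l'"
      using that \<open>c \<noteq> 0\<close> by (cases "c > 0") auto
    ultimately show ?thesis by auto
  qed
  let ?P = "\<lambda>t. l < t \<and> t < r \<longrightarrow>
        (\<forall>x. ((\<lambda>s. \<mu> s x) has_real_derivative h t * p x - discrete_divergence K (V t) x) (at t))"
  have "AE t in density (distr lebesgue lebesgue (\<lambda>x. s + c * x)) (\<lambda>_. ennreal \<bar>c\<bar>). ?P t"
    using path unfolding flux_path_def lebesgue_real_affine[OF \<open>c \<noteq> 0\<close>, of s, symmetric] by blast
  then have "AE t in distr lebesgue lebesgue (\<lambda>x. s + c * x). ?P t"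
    using \<open>c \<noteq> 0\<close> by (subst (asm) AE_density) auto
  then have "AE t in lebesgue. ?P (s + c * t)"
    by (rule AE_distrD[OF \<sigma>m])
  then have "AE t in lebesgue. l' < t \<and> t < r' \<longrightarrow>
        (\<forall>x. ((\<lambda>s. \<mu>' s x) has_real_derivative h' t * p x - discrete_divergence K (V' t) x) (at t))"
  proof eventually_elim
    case (elim t)
    show ?case
    proof (intro impI allI)
      fix x assume "l' < t \<and> t < r'"
      with elim \<sigma>i have "((\<lambda>s. \<mu> s x) has_real_derivative h (s + c * t) * p x - discrete_divergence K (V (s + c * t)) x) (at (s + c * t))"
        by blast
      moreover have "((\<lambda>t. s + c * t) has_real_derivative c) (at t)"
        by (auto intro!: derivative_eq_intros)
      ultimately show "((\<lambda>s. \<mu>' s x) has_real_derivative h' t * p x - discrete_divergence K (V' t) x) (at t)"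
        unfolding \<mu>'_def h'_def V'_def discrete_divergence_scale
        by (auto intro: DERIV_chain'[THEN DERIV_cong] simp: algebra_simps)
    qed
  qed
  then show "flux_path l' r' \<mu>' V' h'"
    using path \<sigma> \<open>c \<noteq> 0\<close> unfolding flux_path_def \<mu>'_def h'_def V'_def
    by (auto intro!: comp borel_measurable_times abs_continuous_on_interval_affine[of l r])
  let ?e = "\<lambda>t. action_density (\<mu> t) (V t) (h t) * indicator {l..r} t"
  have meas: "?e \<in> borel_measurable lebesgue"
    using flux_path_measurable(5)[OF path] by (subst (asm) borel_measurable_restrict_space_iff_ennreal) auto
  have meas': "(\<lambda>t. ?e (s + c * t)) \<in> borel_measurable lebesgue"
    using measurable_compose[OF \<sigma>m meas] .
  have ind: "indicator {l'..r'} t = (indicator {l..r} (s + c * t) :: ennreal)" for t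
    unfolding indicator_def \<sigma> ..
  have "path_energy l' r' \<mu>' V' h' = (\<integral>\<^sup>+t. ennreal (c\<^sup>2) * ?e (s + c * t) \<partial>lebesgue)"
    unfolding path_energy_def \<mu>'_def h'_def V'_def
    by (simp only: action_density_scale ind mult.assoc)
  also have "\<dots> = ennreal (c\<^sup>2) * (\<integral>\<^sup>+t. ?e (s + c * t) \<partial>lebesgue)"
    using meas' by (rule nn_integral_cmult)
  also have "\<dots> = ennreal \<bar>c\<bar> * (ennreal \<bar>c\<bar> * (\<integral>\<^sup>+t. ?e (s + c * t) \<partial>lebesgue))"
    by (simp add: mult.assoc[symmetric] ennreal_mult[symmetric] power2_eq_square)
  also have "\<dots> = ennreal \<bar>c\<bar> * path_energy l r \<mu> V h"
    unfolding path_energy_def by (subst nn_integral_real_affine_lebesgue[OF meas \<open>c \<noteq> 0\<close>, of s]) simp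
  finally show "path_energy l' r' \<mu>' V' h' = ennreal \<bar>c\<bar> * path_energy l r \<mu> V h" .
qed

lemma path_energy_split:
  assumes "flux_path l r \<mu> V h" "l \<le> m" "m \<le> r"
  shows "path_energy l m \<mu> V h + path_energy m r \<mu> V h = path_energy l r \<mu> V h"
proof -
  let ?e = "\<lambda>t. action_density (\<mu> t) (V t) (h t)"
  have meas: "(\<lambda>t. ?e t * indicator {l'..r'} t) \<in> borel_measurable lebesgue" if "l \<le> l'" "r' \<le> r" for l' r'
    using flux_path_measurable(5)[OF flux_path_subinterval[OF assms(1) that]]
    by (subst (asm) borel_measurable_restrict_space_iff_ennreal) auto
  have ne: "AE t in lebesgue. t \<noteq> m"
    by (rule AE_completion[OF AE_lborel_singleton])
  have "path_energy l m \<mu> V h + path_energy m r \<mu> V h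
      = (\<integral>\<^sup>+t. ?e t * indicator {l..m} t + ?e t * indicator {m..r} t \<partial>lebesgue)"
    unfolding path_energy_def using assms meas by (intro nn_integral_add[symmetric]) auto
  also have "\<dots> = path_energy l r \<mu> V h"
    unfolding path_energy_def
    by (intro nn_integral_cong_AE eventually_mono[OF ne]) (use assms in \<open>auto simp: indicator_def\<close>)
  finally show ?thesis .
qed

lemma flux_path_join:
  assumes path1: "flux_path l m \<mu>1 V1 h1" and path2: "flux_path m r \<mu>2 V2 h2"
    and "l \<le> m" "m \<le> r" "\<mu>1 m = \<mu>2 m"
  defines "\<mu> \<equiv> \<lambda>t. if t \<le> m then \<mu>1 t else \<mu>2 t"
    and "V \<equiv> \<lambda>t. if t \<le> m then V1 t else V2 t"
    and "h \<equiv> \<lambda>t. if t \<le> m then h1 t else h2 t"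
  shows "flux_path l r \<mu> V h"
    and "path_energy l r \<mu> V h \<le> path_energy l m \<mu>1 V1 h1 + path_energy m r \<mu>2 V2 h2"
proof -
  have meas: "(\<lambda>t. if t \<le> m then f t else g t) \<in> borel_measurable (lebesgue_on {l..r})"
    if f: "f \<in> borel_measurable (lebesgue_on {l..m})" and g: "g \<in> borel_measurable (lebesgue_on {m..r})"
    for f g :: "real \<Rightarrow> real"
  proof -
    have fg: "(\<lambda>t. indicator {l..m} t *\<^sub>R f t) \<in> borel_measurable lebesgue"
      "(\<lambda>t. indicator {m..r} t *\<^sub>R g t) \<in> borel_measurable lebesgue"
      using f g by (simp_all add: borel_measurable_restrict_space_iff)
    have "{t \<in> space lebesgue. t \<le> m} = {..m}" by auto
    then have "(\<lambda>t. if t \<le> m then indicator {l..m} t *\<^sub>R f t else indicator {m..r} t *\<^sub>R g t) \<in> borel_measurable lebesgue"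
      by (intro measurable_If fg) simp
    also have "(\<lambda>t. if t \<le> m then indicator {l..m} t *\<^sub>R f t else indicator {m..r} t *\<^sub>R g t)
       = (\<lambda>t. indicator {l..r} t *\<^sub>R (if t \<le> m then f t else g t))"
      using \<open>l \<le> m\<close> \<open>m \<le> r\<close> by (auto simp: indicator_def)
    finally show ?thesis by (simp add: borel_measurable_restrict_space_iff)
  qed
  have ne: "AE t in lebesgue. t \<noteq> m"
    by (rule AE_completion[OF AE_lborel_singleton])
  have "AE t in lebesgue. l < t \<and> t < m \<longrightarrow>
        (\<forall>x. ((\<lambda>s. \<mu>1 s x) has_real_derivative h1 t * p x - discrete_divergence K (V1 t) x) (at t))"
    "AE t in lebesgue. m < t \<and> t < r \<longrightarrow>
        (\<forall>x. ((\<lambda>s. \<mu>2 s x) has_real_derivative h2 t * p x - discrete_divergence K (V2 t) x) (at t))"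
    using path1 path2 by (simp_all add: flux_path_def)
  with ne have "AE t in lebesgue. l < t \<and> t < r \<longrightarrow>
        (\<forall>x. ((\<lambda>s. \<mu> s x) has_real_derivative h t * p x - discrete_divergence K (V t) x) (at t))"
  proof eventually_elim
    case (elim t)
    show ?case
    proof (intro impI allI)
      fix x assume t: "l < t \<and> t < r"
      show "((\<lambda>s. \<mu> s x) has_real_derivative h t * p x - discrete_divergence K (V t) x) (at t)"
      proof (cases "t < m")
        case True
        then have "((\<lambda>s. \<mu>1 s x) has_real_derivative h t * p x - discrete_divergence K (V t) x) (at t)"
          using elim t by (simp add: h_def V_def)
        then show ?thesis
          by (rule has_field_derivative_transform_within_open[where S = "{..<m}"])
             (use True in \<open>auto simp: \<mu>_def\<close>)
      next
        case False
        then have "m < t" using elim(1) by simp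
        then have "((\<lambda>s. \<mu>2 s x) has_real_derivative h t * p x - discrete_divergence K (V t) x) (at t)"
          using elim t by (simp add: h_def V_def)
        then show ?thesis
          by (rule has_field_derivative_transform_within_open[where S = "{m<..}"])
             (use \<open>m < t\<close> in \<open>auto simp: \<mu>_def\<close>)
      qed
    qed
  qed
  moreover have "abs_continuous_on_interval l r (\<lambda>t. \<mu> t x)" for x
  proof (rule abs_continuous_on_interval_join[OF \<open>l \<le> m\<close> \<open>m \<le> r\<close>])
    show "abs_continuous_on_interval l m (\<lambda>t. \<mu> t x)"
      using path1 by (auto simp: flux_path_def \<mu>_def intro: abs_continuous_on_interval_cong[of l m "\<lambda>t. \<mu>1 t x"])
    show "abs_continuous_on_interval m r (\<lambda>t. \<mu> t x)"
    proof (rule abs_continuous_on_interval_cong)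
      show "abs_continuous_on_interval m r (\<lambda>t. \<mu>2 t x)" using path2 unfolding flux_path_def by blast
      show "\<mu> t x = \<mu>2 t x" if "t \<in> {m..r}" for t
        using \<open>\<mu>1 m = \<mu>2 m\<close> that unfolding \<mu>_def by (cases "t = m") simp_all
    qed
  qed
  moreover have "(\<lambda>t. V t x y) \<in> borel_measurable (lebesgue_on {l..r})" for x y
    using meas[OF flux_path_measurable(2)[OF path1] flux_path_measurable(2)[OF path2], of x y x y]
    unfolding V_def by (simp add: if_distribR)
  moreover have "h \<in> borel_measurable (lebesgue_on {l..r})"
    unfolding h_def by (rule meas[OF flux_path_measurable(3)[OF path1] flux_path_measurable(3)[OF path2]])
  moreover have "\<mu> t \<in> nonneg_densities" if "t \<in> {l..r}" for t
    using path1 path2 that unfolding flux_path_def \<mu>_def by auto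
  ultimately show "flux_path l r \<mu> V h"
    by (auto simp: flux_path_def)
  have m1: "(\<lambda>t. action_density (\<mu>1 t) (V1 t) (h1 t) * indicator {l..m} t) \<in> borel_measurable lebesgue"
    using flux_path_measurable(5)[OF path1] by (subst (asm) borel_measurable_restrict_space_iff_ennreal) auto
  have m2: "(\<lambda>t. action_density (\<mu>2 t) (V2 t) (h2 t) * indicator {m..r} t) \<in> borel_measurable lebesgue"
    using flux_path_measurable(5)[OF path2] by (subst (asm) borel_measurable_restrict_space_iff_ennreal) auto
  show "path_energy l r \<mu> V h \<le> path_energy l m \<mu>1 V1 h1 + path_energy m r \<mu>2 V2 h2"
    unfolding path_energy_def nn_integral_add[OF m1 m2, symmetric]
    by (intro nn_integral_mono) (auto simp: \<mu>_def V_def h_def indicator_def)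
qed

section \<open>Optimal potentials for a given flux\<close>

text \<open>
  The conductance of an edge in the network with density \<open>\<mu>\<close>. It may vanish, so the associated
  Laplacian can have a kernel larger than the constants.
\<close>
definition edge_weight :: "('x \<Rightarrow> real) \<Rightarrow> 'x \<Rightarrow> 'x \<Rightarrow> real" where
  "edge_weight \<mu> x y = log_mean (\<mu> x) (\<mu> y) * K x y * \<pi> x"

definition laplacian :: "('x \<Rightarrow> real) \<Rightarrow> real^'x \<Rightarrow> real^'x" where
  "laplacian \<mu> \<phi> = (\<chi> x. \<Sum>y\<in>UNIV. (\<phi> $ x - \<phi> $ y) * edge_weight \<mu> x y)"

definition resolvent_matrix :: "('x \<Rightarrow> real) \<Rightarrow> real \<Rightarrow> real^'x^'x" where
  "resolvent_matrix \<mu> \<epsilon> = (\<chi> x y. (if x = y then \<epsilon> + (\<Sum>z\<in>UNIV. edge_weight \<mu> x z) else 0) - edge_weight \<mu> x y)"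

text \<open>
  Cramer's rule for the regularised Laplace equation. Writing the solution with determinants makes its
  measurability in \<open>\<mu>\<close> and \<open>V\<close> a matter of finite sums and products.
\<close>
definition resolvent_solution :: "('x \<Rightarrow> real) \<Rightarrow> ('x \<Rightarrow> 'x \<Rightarrow> real) \<Rightarrow> real \<Rightarrow> real^'x" where
  "resolvent_solution \<mu> V \<epsilon> = (\<chi> k. det (\<chi> i j. if j = k then - (\<pi> i * discrete_divergence K V i)
     else resolvent_matrix \<mu> \<epsilon> $ i $ j) / det (resolvent_matrix \<mu> \<epsilon>))"

definition flux_potential :: "('x \<Rightarrow> real) \<Rightarrow> ('x \<Rightarrow> 'x \<Rightarrow> real) \<Rightarrow> 'x \<Rightarrow> real" where
  "flux_potential \<mu> V x = lim (\<lambda>n. resolvent_solution \<mu> V (1 / real (Suc n)) $ x)"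

lemma edge_weight_nonneg: "\<mu> \<in> nonneg_densities \<Longrightarrow> 0 \<le> edge_weight \<mu> x y"
  using log_mean_nonneg[of "\<mu> x" "\<mu> y"] K_nonneg[of x y] \<pi>_pos[of x]
  by (simp add: edge_weight_def nonneg_densities_def)

lemma edge_weight_commute: "\<mu> \<in> nonneg_densities \<Longrightarrow> edge_weight \<mu> x y = edge_weight \<mu> y x"
  using log_mean_commute[of "\<mu> x" "\<mu> y"] detailed_balance[of x y]
  by (simp add: edge_weight_def nonneg_densities_def mult.assoc)

lemma sum_divergence_by_parts:
  "(\<Sum>x\<in>UNIV. \<phi> x * (\<pi> x * discrete_divergence K V x)) =
     1/2 * (\<Sum>x\<in>UNIV. \<Sum>y\<in>UNIV. (\<phi> x - \<phi> y) * V x y * (K x y * \<pi> x))"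
proof -
  have "(\<Sum>x\<in>UNIV. \<phi> x * (\<pi> x * discrete_divergence K V x)) =
     1/2 * ((\<Sum>x\<in>UNIV. \<Sum>y\<in>UNIV. \<phi> x * V x y * (K x y * \<pi> x)) - (\<Sum>x\<in>UNIV. \<Sum>y\<in>UNIV. \<phi> x * V y x * (K x y * \<pi> x)))"
    by (simp add: discrete_divergence_def sum_distrib_left algebra_simps sum_subtractf)
  also have "(\<Sum>x\<in>UNIV. \<Sum>y\<in>UNIV. \<phi> x * V y x * (K x y * \<pi> x)) = (\<Sum>x\<in>UNIV. \<Sum>y\<in>UNIV. \<phi> y * V x y * (K x y * \<pi> x))"
    by (subst sum.swap) (simp add: detailed_balance)
  finally show ?thesis by (simp add: sum_subtractf[symmetric] algebra_simps)
qed

lemma laplacian_inner: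
  assumes "\<mu> \<in> nonneg_densities"
  shows "laplacian \<mu> \<phi> \<bullet> \<eta> =
     1/2 * (\<Sum>x\<in>UNIV. \<Sum>y\<in>UNIV. (\<phi> $ x - \<phi> $ y) * (\<eta> $ x - \<eta> $ y) * edge_weight \<mu> x y)"
proof -
  let ?w = "edge_weight \<mu>"
  have "laplacian \<mu> \<phi> \<bullet> \<eta> = (\<Sum>x\<in>UNIV. \<Sum>y\<in>UNIV. (\<phi> $ x - \<phi> $ y) * \<eta> $ x * ?w x y)"
    by (simp add: laplacian_def inner_vec_def sum_distrib_left sum_distrib_right mult_ac)
  moreover have "\<dots> = (\<Sum>x\<in>UNIV. \<Sum>y\<in>UNIV. (\<phi> $ y - \<phi> $ x) * \<eta> $ y * ?w x y)"
    by (subst sum.swap) (simp add: edge_weight_commute[OF assms])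
  ultimately have "2 * (laplacian \<mu> \<phi> \<bullet> \<eta>) = (\<Sum>x\<in>UNIV. \<Sum>y\<in>UNIV. (\<phi> $ x - \<phi> $ y) * \<eta> $ x * ?w x y)
      + (\<Sum>x\<in>UNIV. \<Sum>y\<in>UNIV. (\<phi> $ y - \<phi> $ x) * \<eta> $ y * ?w x y)" by simp
  also have "\<dots> = (\<Sum>x\<in>UNIV. \<Sum>y\<in>UNIV. (\<phi> $ x - \<phi> $ y) * (\<eta> $ x - \<eta> $ y) * ?w x y)"
    by (simp add: sum.distrib[symmetric] algebra_simps)
  finally show ?thesis by simp
qed

lemma laplacian_nonneg: "\<mu> \<in> nonneg_densities \<Longrightarrow> 0 \<le> laplacian \<mu> \<phi> \<bullet> \<phi>"
  by (auto simp: laplacian_inner intro!: sum_nonneg mult_nonneg_nonneg[OF zero_le_square edge_weight_nonneg])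

lemma linear_laplacian: "linear (laplacian \<mu>)"
  by (rule linearI) (simp_all add: laplacian_def vec_eq_iff sum.distrib[symmetric] sum_distrib_left algebra_simps)

lemma resolvent_matrix_mult: "resolvent_matrix \<mu> \<epsilon> *v \<phi> = laplacian \<mu> \<phi> + \<epsilon> *\<^sub>R \<phi>"
proof (rule vec_eq_iff[THEN iffD2], rule allI)
  fix x
  have "(resolvent_matrix \<mu> \<epsilon> *v \<phi>) $ x =
      (\<Sum>y\<in>UNIV. (if x = y then (\<epsilon> + (\<Sum>z\<in>UNIV. edge_weight \<mu> x z)) * \<phi> $ y else 0) - edge_weight \<mu> x y * \<phi> $ y)"
    unfolding matrix_vector_mult_def resolvent_matrix_def by (auto simp: algebra_simps intro!: sum.cong)
  also have "\<dots> = (\<epsilon> + (\<Sum>z\<in>UNIV. edge_weight \<mu> x z)) * \<phi> $ x - (\<Sum>y\<in>UNIV. edge_weight \<mu> x y * \<phi> $ y)"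
    by (simp add: sum_subtractf)
  also have "\<dots> = (laplacian \<mu> \<phi> + \<epsilon> *\<^sub>R \<phi>) $ x"
    by (simp add: laplacian_def sum_subtractf left_diff_distrib sum_distrib_left algebra_simps)
  finally show "(resolvent_matrix \<mu> \<epsilon> *v \<phi>) $ x = (laplacian \<mu> \<phi> + \<epsilon> *\<^sub>R \<phi>) $ x" .
qed

lemma laplacian_resolvent_solution:
  assumes "\<mu> \<in> nonneg_densities" "0 < \<epsilon>"
  shows "laplacian \<mu> (resolvent_solution \<mu> V \<epsilon>) + \<epsilon> *\<^sub>R resolvent_solution \<mu> V \<epsilon>
     = (\<chi> x. - (\<pi> x * discrete_divergence K V x))"
proof -
  have "x = 0" if "resolvent_matrix \<mu> \<epsilon> *v x = 0" for x
  proof -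
    have "(laplacian \<mu> x + \<epsilon> *\<^sub>R x) \<bullet> x = 0" using that by (simp add: resolvent_matrix_mult)
    then have "laplacian \<mu> x \<bullet> x + \<epsilon> * (x \<bullet> x) = 0" by (simp add: inner_add_left)
    moreover have "0 \<le> laplacian \<mu> x \<bullet> x" by (rule laplacian_nonneg[OF assms(1)])
    ultimately have "\<epsilon> * (x \<bullet> x) \<le> 0" by linarith
    then show "x = 0" using \<open>0 < \<epsilon>\<close> by (metis inner_gt_zero_iff mult_pos_pos not_less)
  qed
  then have "det (resolvent_matrix \<mu> \<epsilon>) \<noteq> 0"
    using matrix_left_invertible_ker[of "resolvent_matrix \<mu> \<epsilon>"]
    by (metis invertible_det_nz invertible_left_inverse)
  then have "resolvent_matrix \<mu> \<epsilon> *v resolvent_solution \<mu> V \<epsilon> = (\<chi> x. - (\<pi> x * discrete_divergence K V x))"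
    by (subst cramer) (simp_all add: resolvent_solution_def cong: if_cong)
  then show ?thesis by (simp add: resolvent_matrix_mult)
qed

text \<open>
  Finite action forces the flux to vanish on edges of zero conductance. This is what makes
  the divergence orthogonal to the kernel of the Laplacian.
\<close>
lemma flux_action_finite:
  assumes \<mu>: "\<mu> \<in> nonneg_densities" and fin: "flux_action K \<pi> \<mu> V \<noteq> \<infinity>"
  shows "flux_action K \<pi> \<mu> V = ennreal (1/2 * (\<Sum>x\<in>UNIV. \<Sum>y\<in>UNIV. (V x y)\<^sup>2 / log_mean (\<mu> x) (\<mu> y) * (K x y * \<pi> x)))"
    and "log_mean (\<mu> x) (\<mu> y) = 0 \<Longrightarrow> K x y \<noteq> 0 \<Longrightarrow> V x y = 0"
proof -
  have Kpi: "0 \<le> K x y * \<pi> x" for x y using K_nonneg[of x y] \<pi>_pos[of x] by simp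
  have lm: "0 \<le> log_mean (\<mu> x) (\<mu> y)" for x y
    using \<mu> by (intro log_mean_nonneg) (auto simp: nonneg_densities_def)
  let ?S = "\<Sum>x\<in>UNIV. \<Sum>y\<in>UNIV. flux_cost (V x y) (\<mu> x) (\<mu> y) * ennreal (K x y * \<pi> x)"
  have "?S \<noteq> top"
  proof
    assume "?S = top"
    then have "flux_action K \<pi> \<mu> V = ennreal (1/2) * top" by (simp only: flux_action_def)
    also have "\<dots> = top" by (subst ennreal_mult_top) auto
    finally show False using fin by simp
  qed
  then have terms: "flux_cost (V x y) (\<mu> x) (\<mu> y) * ennreal (K x y * \<pi> x) \<noteq> top" for x y
    by simp
  show zero: "V x y = 0" if "log_mean (\<mu> x) (\<mu> y) = 0" "K x y \<noteq> 0" for x y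
    using terms[of x y] that \<pi>_pos[of x] K_nonneg[of x y]
    by (auto simp: flux_cost_zero_mean ennreal_top_mult split: if_splits)
  have eq: "flux_cost (V x y) (\<mu> x) (\<mu> y) * ennreal (K x y * \<pi> x)
      = ennreal ((V x y)\<^sup>2 / log_mean (\<mu> x) (\<mu> y) * (K x y * \<pi> x))" for x y
  proof (cases "log_mean (\<mu> x) (\<mu> y) = 0")
    case True then show ?thesis using zero[OF True] by (cases "K x y = 0") (auto simp: flux_cost_zero_mean)
  next
    case False
    then show ?thesis using lm[of x y] Kpi[of x y] by (simp add: flux_cost_pos_mean ennreal_mult[symmetric])
  qed
  moreover have nn: "0 \<le> (V x y)\<^sup>2 / log_mean (\<mu> x) (\<mu> y) * (K x y * \<pi> x)" for x y
    by (rule mult_nonneg_nonneg[OF divide_nonneg_nonneg[OF zero_le_power2 lm] Kpi])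
  ultimately show "flux_action K \<pi> \<mu> V = ennreal (1/2 * (\<Sum>x\<in>UNIV. \<Sum>y\<in>UNIV. (V x y)\<^sup>2 / log_mean (\<mu> x) (\<mu> y) * (K x y * \<pi> x)))"
    unfolding flux_action_def eq
    by (simp only: sum_ennreal sum_nonneg nn) (simp only: ennreal_mult'[of "1/2", symmetric])
qed

text \<open>
  Among all fluxes with the same divergence, the gradient flux has the least action: the energy
  of \<open>\<psi>\<close> equals the pairing of \<open>\<psi>\<close> with the divergence of \<open>V\<close>, which after summation by parts is at
  most the mean of the energy of \<open>\<psi>\<close> and the action of \<open>V\<close>.
\<close>
lemma flux_potential_solves:
  assumes \<mu>: "\<mu> \<in> nonneg_densities" and fin: "flux_action K \<pi> \<mu> V \<noteq> \<infinity>"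
  defines "\<psi> \<equiv> flux_potential \<mu> V"
  shows "(\<Sum>y\<in>UNIV. (\<psi> y - \<psi> x) * log_mean (\<mu> x) (\<mu> y) * K x y) = discrete_divergence K V x"
    and "ennreal (1/2 * (\<Sum>x\<in>UNIV. \<Sum>y\<in>UNIV. (\<psi> y - \<psi> x)\<^sup>2 * log_mean (\<mu> x) (\<mu> y) * K x y * \<pi> x)) \<le> flux_action K \<pi> \<mu> V"
proof -
  let ?w = "edge_weight \<mu>" and ?\<theta> = "\<lambda>x y. log_mean (\<mu> x) (\<mu> y)"
  define g where "g = (\<chi> x. - (\<pi> x * discrete_divergence K V x))"
  have g_inner: "g \<bullet> z = 1/2 * (\<Sum>x\<in>UNIV. \<Sum>y\<in>UNIV. (z $ y - z $ x) * V x y * (K x y * \<pi> x))" for z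
  proof -
    have "g \<bullet> z = - (\<Sum>x\<in>UNIV. z $ x * (\<pi> x * discrete_divergence K V x))"
      by (simp add: g_def inner_vec_def sum_negf mult_ac)
    then show ?thesis
      unfolding sum_divergence_by_parts by (simp add: sum_negf[symmetric] algebra_simps)
  qed
  have ker: "g \<bullet> z = 0" if "laplacian \<mu> z = 0" for z
  proof -
    have "(\<Sum>x\<in>UNIV. \<Sum>y\<in>UNIV. (z $ x - z $ y)\<^sup>2 * ?w x y) = 0"
      using laplacian_inner[OF \<mu>, of z z] that by (simp add: power2_eq_square)
    then have eq0: "(z $ x - z $ y)\<^sup>2 * ?w x y = 0" for x y
      by (simp add: sum_nonneg_eq_0_iff sum_nonneg edge_weight_nonneg[OF \<mu>])
    have nz: "z $ x = z $ y \<or> ?\<theta> x y = 0 \<or> K x y = 0" for x y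
      using eq0[of x y] \<pi>_pos[of x] by (auto simp: edge_weight_def)
    have "(z $ y - z $ x) * V x y * (K x y * \<pi> x) = 0" for x y
      using nz[of x y] flux_action_finite(2)[OF \<mu> fin, of x y] by auto
    then show ?thesis unfolding g_inner by (simp only: sum.neutral_const mult_zero_right)
  qed
  obtain \<psi>' where \<psi>': "laplacian \<mu> \<psi>' = g" "(\<lambda>n. resolvent_solution \<mu> V (1 / real (Suc n))) \<longlonglongrightarrow> \<psi>'"
  proof (rule selfadjoint_resolvent_limit[OF linear_laplacian _ laplacian_nonneg[OF \<mu>] ker])
    show "laplacian \<mu> x \<bullet> y = x \<bullet> laplacian \<mu> y" for x y
      by (subst inner_commute[of x]) (simp add: laplacian_inner[OF \<mu>] mult_ac)
    show "laplacian \<mu> (resolvent_solution \<mu> V (1 / real (Suc n))) + (1 / real (Suc n)) *\<^sub>R resolvent_solution \<mu> V (1 / real (Suc n)) = g" for n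
      unfolding g_def by (rule laplacian_resolvent_solution[OF \<mu>]) simp
  qed blast
  have \<psi>: "\<psi> x = \<psi>' $ x" for x
    unfolding \<psi>_def flux_potential_def using tendsto_vec_nth[OF \<psi>'(2)] by (rule limI)
  have "(\<Sum>y\<in>UNIV. (\<psi> x - \<psi> y) * ?w x y) = - (\<pi> x * discrete_divergence K V x)"
    using \<psi>'(1) by (simp add: vec_eq_iff laplacian_def g_def \<psi>)
  moreover have "\<pi> x * (\<Sum>y\<in>UNIV. (\<psi> y - \<psi> x) * ?\<theta> x y * K x y) = - (\<Sum>y\<in>UNIV. (\<psi> x - \<psi> y) * ?w x y)"
    unfolding sum_distrib_left sum_negf[symmetric] by (intro sum.cong) (simp_all add: edge_weight_def algebra_simps)
  ultimately have "\<pi> x * (\<Sum>y\<in>UNIV. (\<psi> y - \<psi> x) * ?\<theta> x y * K x y) = \<pi> x * discrete_divergence K V x"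
    by simp
  then show "(\<Sum>y\<in>UNIV. (\<psi> y - \<psi> x) * ?\<theta> x y * K x y) = discrete_divergence K V x"
    using \<pi>_pos[of x] by simp
  let ?S = "\<Sum>x\<in>UNIV. \<Sum>y\<in>UNIV. (\<psi> y - \<psi> x)\<^sup>2 * ?\<theta> x y * K x y * \<pi> x"
  let ?A = "\<Sum>x\<in>UNIV. \<Sum>y\<in>UNIV. (V x y)\<^sup>2 / ?\<theta> x y * (K x y * \<pi> x)"
  have "1/2 * ?S = laplacian \<mu> \<psi>' \<bullet> \<psi>'"
    by (simp add: laplacian_inner[OF \<mu>] \<psi> edge_weight_def power2_eq_square algebra_simps)
  also have "\<dots> = 1/2 * (\<Sum>x\<in>UNIV. \<Sum>y\<in>UNIV. (\<psi> y - \<psi> x) * V x y * (K x y * \<pi> x))"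
    unfolding \<psi>'(1) g_inner by (simp add: \<psi>)
  also have "\<dots> \<le> 1/2 * (\<Sum>x\<in>UNIV. \<Sum>y\<in>UNIV. 1/2 * ((\<psi> y - \<psi> x)\<^sup>2 * ?\<theta> x y * K x y * \<pi> x) + 1/2 * ((V x y)\<^sup>2 / ?\<theta> x y * (K x y * \<pi> x)))"
  proof (intro mult_left_mono sum_mono)
    fix x y
    have Kpi: "0 \<le> K x y * \<pi> x" using K_nonneg[of x y] \<pi>_pos[of x] by simp
    show "(\<psi> y - \<psi> x) * V x y * (K x y * \<pi> x) \<le> 1/2 * ((\<psi> y - \<psi> x)\<^sup>2 * ?\<theta> x y * K x y * \<pi> x) + 1/2 * ((V x y)\<^sup>2 / ?\<theta> x y * (K x y * \<pi> x))"
    proof (cases "?\<theta> x y = 0")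
      case True
      then show ?thesis using flux_action_finite(2)[OF \<mu> fin True] by (cases "K x y = 0") auto
    next
      case False
      then have pos: "0 < ?\<theta> x y" using log_mean_nonneg[of "\<mu> x" "\<mu> y"] \<mu> by (simp add: nonneg_densities_def order_less_le)
      have "0 \<le> ((\<psi> y - \<psi> x) * ?\<theta> x y - V x y)\<^sup>2 / ?\<theta> x y" using pos by simp
      also have "\<dots> = (\<psi> y - \<psi> x)\<^sup>2 * ?\<theta> x y + (V x y)\<^sup>2 / ?\<theta> x y - 2 * ((\<psi> y - \<psi> x) * V x y)"
        using pos by (simp add: power2_eq_square field_simps)
      finally have "(\<psi> y - \<psi> x) * V x y \<le> 1/2 * ((\<psi> y - \<psi> x)\<^sup>2 * ?\<theta> x y) + 1/2 * ((V x y)\<^sup>2 / ?\<theta> x y)" by linarith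
      from mult_right_mono[OF this Kpi] show ?thesis by (simp add: algebra_simps)
    qed
  qed auto
  also have "\<dots> = 1/2 * (1/2 * ?S + 1/2 * ?A)"
    by (simp add: sum.distrib sum_distrib_left)
  finally have *: "1/2 * ?S \<le> 1/2 * (1/2 * ?S + 1/2 * ?A)" .
  have absorb: "1/2 * S \<le> 1/2 * A" if "1/2 * S \<le> 1/2 * (1/2 * S + 1/2 * A)" for S A :: real
    using that by simp
  have "1/2 * ?S \<le> 1/2 * ?A" by (rule absorb[OF *])
  then show "ennreal (1/2 * ?S) \<le> flux_action K \<pi> \<mu> V"
    unfolding flux_action_finite(1)[OF \<mu> fin] by (rule ennreal_leI)
qed

lemma flux_potential_measurable:
  assumes "flux_path l r \<mu> V h"
  shows "(\<lambda>t. flux_potential (\<mu> t) (V t) x) \<in> borel_measurable (lebesgue_on {l..r})"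
proof -
  note [measurable] = flux_path_measurable(1,2)[OF assms]
  have [measurable]: "(\<lambda>t. log_mean (\<mu> t x) (\<mu> t y)) \<in> borel_measurable (lebesgue_on {l..r})" for x y
    using assms by (intro borel_measurable_log_mean) (auto simp: flux_path_def nonneg_densities_def)
  have [measurable]: "(\<lambda>t. edge_weight (\<mu> t) x y) \<in> borel_measurable (lebesgue_on {l..r})" for x y
    unfolding edge_weight_def by measurable
  have [measurable]: "(\<lambda>t. resolvent_matrix (\<mu> t) \<epsilon> $ i $ j) \<in> borel_measurable (lebesgue_on {l..r})" for \<epsilon> i j
    unfolding resolvent_matrix_def by simp
  have [measurable]: "(\<lambda>t. discrete_divergence K (V t) i) \<in> borel_measurable (lebesgue_on {l..r})" for i
    unfolding discrete_divergence_def by measurable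
  have [measurable]: "(\<lambda>t. resolvent_solution (\<mu> t) (V t) \<epsilon> $ x) \<in> borel_measurable (lebesgue_on {l..r})" for \<epsilon>
    unfolding resolvent_solution_def by (auto intro!: borel_measurable_divide borel_measurable_det)
  show ?thesis unfolding flux_potential_def by (rule borel_measurable_lim_metric) measurable
qed

section \<open>The distance as an infimum over fluxes\<close>

text \<open>
  The infimum before conversion to the reals, where infinity is still distinguished from zero.
\<close>
definition squared_dist :: "('x \<Rightarrow> real) \<Rightarrow> ('x \<Rightarrow> real) \<Rightarrow> ennreal" where
  "squared_dist \<mu>0 \<mu>1 =
     (INF (\<mu>, \<psi>, h) \<in> potential_solutions K p \<mu>0 \<mu>1. potential_energy K \<pi> a b \<mu> \<psi> h)"

abbreviation "dist_ab \<equiv> transport_dist K \<pi> p a b"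

lemma dist_ab_eq: "dist_ab \<mu>0 \<mu>1 = sqrt (enn2real (squared_dist \<mu>0 \<mu>1))"
  by (simp add: transport_dist_def squared_dist_def)

lemma dist_ab_nonneg: "0 \<le> dist_ab \<mu>0 \<mu>1"
  by (simp add: dist_ab_eq)

text \<open>
  At almost every time the action is finite and the flux can be replaced by the gradient of
  its potential without changing the curve.
\<close>
lemma squared_dist_le_path_energy:
  assumes path: "flux_path 0 1 \<mu> V h"
  shows "squared_dist (\<mu> 0) (\<mu> 1) \<le> path_energy 0 1 \<mu> V h"
proof (cases "path_energy 0 1 \<mu> V h = \<infinity>")
  case True then show ?thesis by simp
next
  case False
  define \<psi> where "\<psi> t = flux_potential (\<mu> t) (V t)" for t
  have quad: "quad_energy K \<pi> a b \<mu> V h = path_energy 0 1 \<mu> V h"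
    by (rule quad_energy_eq_path_energy[OF path])
  have CE: "(\<mu>, V, h) \<in> continuity_equation K p (\<mu> 0) (\<mu> 1)"
    using path by (simp add: continuity_equation_iff_flux_path)
  have "(\<integral>\<^sup>+t. flux_action K \<pi> (\<mu> t) (V t) \<partial>lebesgue_on {0..1}) \<noteq> \<infinity>"
  proof
    assume "(\<integral>\<^sup>+t. flux_action K \<pi> (\<mu> t) (V t) \<partial>lebesgue_on {0..1}) = \<infinity>"
    then have "quad_energy K \<pi> a b \<mu> V h = \<infinity>"
      using b_pos by (simp add: quad_energy_def ennreal_mult_top)
    then show False using quad False by simp
  qed
  then have fin: "AE t in lebesgue_on {0..1}. flux_action K \<pi> (\<mu> t) (V t) \<noteq> \<infinity>"
    using flux_path_measurable(4)[OF path] by (intro nn_integral_PInf_AE)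
  have in01: "AE t in lebesgue_on {0..1}. t \<in> {0..1::real}"
    using AE_space[of "lebesgue_on {0..1::real}"] by simp
  have nn: "\<mu> t \<in> nonneg_densities" if "t \<in> {0..1}" for t
    using path that by (simp add: flux_path_def)
  have "(\<mu>, \<psi>, h) \<in> potential_solutions K p (\<mu> 0) (\<mu> 1)"
    unfolding potential_solutions_def
  proof (simp only: mem_Collect_eq prod.case, intro conjI allI)
    show "ac_curve (\<mu> 0) (\<mu> 1) \<mu>" "h \<in> borel_measurable (lebesgue_on {0..1})"
      using CE by (auto simp: continuity_equation_def)
    show "(\<lambda>t. \<psi> t x) \<in> borel_measurable (lebesgue_on {0..1})" for x
      unfolding \<psi>_def by (rule flux_potential_measurable[OF path])
    have "AE t in lebesgue_on {0..1}. \<forall>x. \<exists>d.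
           ((\<lambda>s. \<mu> s x) has_real_derivative d) (at t within {0..1}) \<and>
           d + discrete_divergence K (V t) x = h t * p x"
      using CE by (auto simp: continuity_equation_def)
    with fin in01 show "AE t in lebesgue_on {0..1}. \<forall>x. \<exists>d.
           ((\<lambda>s. \<mu> s x) has_real_derivative d) (at t within {0..1}) \<and>
           d + (\<Sum>y\<in>UNIV. (\<psi> t y - \<psi> t x) * log_mean (\<mu> t x) (\<mu> t y) * K x y) = h t * p x"
    proof eventually_elim
      case (elim t)
      then show ?case using flux_potential_solves(1)[OF nn] by (simp add: \<psi>_def)
    qed
  qed
  then have "squared_dist (\<mu> 0) (\<mu> 1) \<le> potential_energy K \<pi> a b \<mu> \<psi> h"
    unfolding squared_dist_def by (rule INF_lower2) simp
  also have "\<dots> \<le> quad_energy K \<pi> a b \<mu> V h"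
    unfolding potential_energy_def quad_energy_def power2_abs
  proof (intro add_left_mono mult_left_mono nn_integral_mono_AE)
    show "AE t in lebesgue_on {0..1}. ennreal (1/2 * (\<Sum>x\<in>UNIV. \<Sum>y\<in>UNIV.
        (\<psi> t y - \<psi> t x)\<^sup>2 * log_mean (\<mu> t x) (\<mu> t y) * K x y * \<pi> x)) \<le> flux_action K \<pi> (\<mu> t) (V t)"
      using fin in01
    proof eventually_elim
      case (elim t)
      then show ?case unfolding \<psi>_def by (intro flux_potential_solves(2) nn)
    qed
  qed simp
  finally show ?thesis by (simp add: quad)
qed

text \<open>
  A potential \<open>\<psi>\<close> induces the antisymmetric flux \<open>(\<psi> y - \<psi> x) * \<theta>\<close>, whose action is the energy of \<open>\<psi>\<close>.
\<close>
lemma near_minimal_path: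
  assumes "squared_dist \<mu>0 \<mu>1 < e"
  obtains \<mu> V h where "flux_path 0 1 \<mu> V h" "\<mu> 0 = \<mu>0" "\<mu> 1 = \<mu>1" "path_energy 0 1 \<mu> V h < e"
proof -
  obtain \<mu> \<psi> h where sol: "(\<mu>, \<psi>, h) \<in> potential_solutions K p \<mu>0 \<mu>1" and e: "potential_energy K \<pi> a b \<mu> \<psi> h < e"
    using assms unfolding squared_dist_def INF_less_iff by auto
  define V where "V t x y = (\<psi> t y - \<psi> t x) * log_mean (\<mu> t x) (\<mu> t y)" for t x y
  have ac: "ac_curve \<mu>0 \<mu>1 \<mu>" and \<psi>[measurable]: "\<And>x. (\<lambda>t. \<psi> t x) \<in> borel_measurable (lebesgue_on {0..1})"
    and h: "h \<in> borel_measurable (lebesgue_on {0..1})"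
    and eq: "AE t in lebesgue_on {0..1}. \<forall>x. \<exists>d.
           ((\<lambda>s. \<mu> s x) has_real_derivative d) (at t within {0..1}) \<and>
           d + (\<Sum>y\<in>UNIV. (\<psi> t y - \<psi> t x) * log_mean (\<mu> t x) (\<mu> t y) * K x y) = h t * p x"
    using sol by (auto simp: potential_solutions_def)
  have in01: "AE t in lebesgue_on {0..1}. t \<in> {0..1::real}"
    using AE_space[of "lebesgue_on {0..1::real}"] by simp
  have nn: "0 \<le> \<mu> t x" if "t \<in> {0..1}" for t x
    using ac that by (simp add: ac_curve_def nonneg_densities_def)
  have \<mu>[measurable]: "(\<lambda>t. \<mu> t x) \<in> borel_measurable (lebesgue_on {0..1})" for x
    using ac by (intro continuous_imp_measurable_on_sets_lebesgue abs_continuous_on_interval_imp_continuous_on)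
      (auto simp: ac_curve_def)
  have [measurable]: "(\<lambda>t. log_mean (\<mu> t x) (\<mu> t y)) \<in> borel_measurable (lebesgue_on {0..1})" for x y
    using nn by (intro borel_measurable_log_mean \<mu>) auto
  have div: "discrete_divergence K (V t) x = (\<Sum>y\<in>UNIV. (\<psi> t y - \<psi> t x) * log_mean (\<mu> t x) (\<mu> t y) * K x y)"
    if "t \<in> {0..1}" for t x
    unfolding discrete_divergence_def V_def sum_distrib_left
    by (intro sum.cong) (simp_all add: log_mean_commute[OF nn[OF that] nn[OF that], of _ x] algebra_simps)
  have action: "flux_action K \<pi> (\<mu> t) (V t) = ennreal (1/2 * (\<Sum>x\<in>UNIV. \<Sum>y\<in>UNIV.
        (\<psi> t y - \<psi> t x)\<^sup>2 * log_mean (\<mu> t x) (\<mu> t y) * K x y * \<pi> x))" if "t \<in> {0..1}" for t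
  proof -
    let ?\<theta> = "\<lambda>x y. log_mean (\<mu> t x) (\<mu> t y)"
    have \<theta>: "0 \<le> ?\<theta> x y" for x y using nn[OF that] by (intro log_mean_nonneg)
    have Kpi: "0 \<le> K x y * \<pi> x" for x y using K_nonneg[of x y] \<pi>_pos[of x] by simp
    have cost: "flux_cost (V t x y) (\<mu> t x) (\<mu> t y) = ennreal ((\<psi> t y - \<psi> t x)\<^sup>2 * ?\<theta> x y)" for x y
    proof (cases "?\<theta> x y = 0")
      case True then show ?thesis by (simp add: flux_cost_zero_mean V_def)
    next
      case False
      then show ?thesis using \<theta>[of x y]
        by (simp add: flux_cost_pos_mean V_def power_mult_distrib power2_eq_square mult.assoc)
    qed
    have summand: "flux_cost (V t x y) (\<mu> t x) (\<mu> t y) * ennreal (K x y * \<pi> x)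
      = ennreal ((\<psi> t y - \<psi> t x)\<^sup>2 * ?\<theta> x y * K x y * \<pi> x)" for x y
      unfolding cost using \<theta>[of x y] Kpi[of x y] by (simp add: ennreal_mult[symmetric] mult.assoc)
    have nn': "0 \<le> (\<psi> t y - \<psi> t x)\<^sup>2 * ?\<theta> x y * K x y * \<pi> x" for x y
      using mult_nonneg_nonneg[OF mult_nonneg_nonneg[OF zero_le_power2[of "\<psi> t y - \<psi> t x"] \<theta>[of x y]] Kpi[of x y]]
      by (simp add: mult.assoc)
    show ?thesis
      unfolding flux_action_def summand
      by (simp only: sum_ennreal sum_nonneg nn') (simp only: ennreal_mult'[of "1/2", symmetric])
  qed
  have "(\<mu>, V, h) \<in> continuity_equation K p \<mu>0 \<mu>1"
    unfolding continuity_equation_def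
  proof (simp only: mem_Collect_eq prod.case, intro conjI allI ac h)
    show "(\<lambda>t. V t x y) \<in> borel_measurable (lebesgue_on {0..1})" for x y
      unfolding V_def by measurable
    show "AE t in lebesgue_on {0..1}. \<forall>x. \<exists>d.
           ((\<lambda>s. \<mu> s x) has_real_derivative d) (at t within {0..1}) \<and>
           d + discrete_divergence K (V t) x = h t * p x"
      using eq in01
    proof eventually_elim
      case (elim t) then show ?case by (simp add: div)
    qed
  qed
  then have path: "flux_path 0 1 \<mu> V h" "\<mu> 0 = \<mu>0" "\<mu> 1 = \<mu>1"
    by (auto simp: continuity_equation_iff_flux_path)
  have "path_energy 0 1 \<mu> V h = quad_energy K \<pi> a b \<mu> V h"
    by (rule quad_energy_eq_path_energy[OF path(1), symmetric])
  also have "\<dots> = potential_energy K \<pi> a b \<mu> \<psi> h"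
  proof -
    have "(\<integral>\<^sup>+t. flux_action K \<pi> (\<mu> t) (V t) \<partial>lebesgue_on {0..1}) = (\<integral>\<^sup>+t. ennreal (1/2 * (\<Sum>x\<in>UNIV. \<Sum>y\<in>UNIV.
        (\<psi> t y - \<psi> t x)\<^sup>2 * log_mean (\<mu> t x) (\<mu> t y) * K x y * \<pi> x)) \<partial>lebesgue_on {0..1})"
      by (intro nn_integral_cong action) simp
    then show ?thesis unfolding quad_energy_def potential_energy_def power2_abs by simp
  qed
  finally show thesis using e by (intro that[OF path]) simp
qed

lemma squared_dist_le_subpath:
  assumes "flux_path l r \<mu> V h" "l \<le> r"
  shows "squared_dist (\<mu> l) (\<mu> r) \<le> ennreal (r - l) * path_energy l r \<mu> V h"
    and "squared_dist (\<mu> r) (\<mu> l) \<le> ennreal (r - l) * path_energy l r \<mu> V h"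
proof -
  \<comment> \<open>A degenerate interval admits no affine change of variables.\<close>
  have const: "squared_dist (\<mu> l) (\<mu> l) = 0"
  proof -
    have "flux_path 0 1 (\<lambda>_. \<mu> l) (\<lambda>_ _ _. 0) (\<lambda>_. 0)"
      using assms by (auto simp: flux_path_def abs_continuous_on_interval_const discrete_divergence_def)
    from squared_dist_le_path_energy[OF this] show ?thesis
      by (simp add: path_energy_def action_density_def flux_action_def flux_cost_def)
  qed
  have *: "squared_dist (\<mu> s) (\<mu> (s + c)) \<le> ennreal \<bar>c\<bar> * path_energy l r \<mu> V h"
    if "c \<noteq> 0" and "\<And>t. t \<in> {0..1} \<longleftrightarrow> s + c * t \<in> {l..r}" for s c
    using squared_dist_le_path_energy[OF flux_path_affine(1)[OF assms(1) that]]
    unfolding flux_path_affine(2)[OF assms(1) that] by simp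
  have A: "squared_dist (\<mu> l) (\<mu> r) \<le> ennreal (r - l) * path_energy l r \<mu> V h \<and>
    squared_dist (\<mu> r) (\<mu> l) \<le> ennreal (r - l) * path_energy l r \<mu> V h"
  proof (cases "l = r")
    case True then show ?thesis using const by simp
  next
    case False
    then have "0 < r - l" using assms(2) by simp
    have "t \<in> {0..1} \<longleftrightarrow> l + (r - l) * t \<in> {l..r}" for t
    proof -
      have "l + (r - l) * t \<le> r \<longleftrightarrow> (r - l) * t \<le> (r - l) * 1" by auto
      then show ?thesis using \<open>0 < r - l\<close> by (simp add: zero_le_mult_iff del: mult_1_right)
    qed
    note 1 = *[OF _ this]
    have "t \<in> {0..1} \<longleftrightarrow> r + (l - r) * t \<in> {l..r}" for t
    proof -
      have "l \<le> r + (l - r) * t \<longleftrightarrow> (r - l) * t \<le> (r - l) * 1" by (auto simp: algebra_simps)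
      moreover have "r + (l - r) * t \<le> r \<longleftrightarrow> (r - l) * 0 \<le> (r - l) * t" by (auto simp: algebra_simps)
      ultimately show ?thesis using \<open>0 < r - l\<close> by (auto simp: zero_le_mult_iff simp del: mult_1_right)
    qed
    note 2 = *[OF _ this]
    show ?thesis using 1 2 \<open>0 < r - l\<close> by simp
  qed
  from A show "squared_dist (\<mu> l) (\<mu> r) \<le> ennreal (r - l) * path_energy l r \<mu> V h" ..
  from A show "squared_dist (\<mu> r) (\<mu> l) \<le> ennreal (r - l) * path_energy l r \<mu> V h" ..
qed

lemma squared_dist_commute: "squared_dist \<mu>0 \<mu>1 = squared_dist \<mu>1 \<mu>0"
proof -
  have "squared_dist \<nu>1 \<nu>0 \<le> squared_dist \<nu>0 \<nu>1" for \<nu>0 \<nu>1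
  proof (rule ccontr)
    assume "\<not> ?thesis"
    then obtain \<mu> V h where "flux_path 0 1 \<mu> V h" "\<mu> 0 = \<nu>0" "\<mu> 1 = \<nu>1"
      "path_energy 0 1 \<mu> V h < squared_dist \<nu>1 \<nu>0"
      by (auto simp: not_le elim: near_minimal_path)
    with squared_dist_le_subpath(2)[of 0 1 \<mu> V h] show False by simp
  qed
  then show ?thesis by (intro antisym)
qed

lemma squared_dist_self:
  assumes "\<mu> \<in> nonneg_densities"
  shows "squared_dist \<mu> \<mu> = 0"
proof -
  have "flux_path 0 0 (\<lambda>_. \<mu>) (\<lambda>_ _ _. 0) (\<lambda>_. 0)"
    using assms by (auto simp: flux_path_def abs_continuous_on_interval_const)
  from squared_dist_le_subpath(1)[OF this] show ?thesis by simp
qed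

text \<open>
  Two curves are run one after the other, each for a time proportional to the bound on its length. Of
  all time splittings this one has the smallest energy bound, namely the square of the sum.
\<close>
lemma squared_dist_triangle:
  assumes "squared_dist \<mu>0 \<mu>1 < ennreal (d\<^sup>2)" "squared_dist \<mu>1 \<mu>2 < ennreal (e\<^sup>2)" "0 < d" "0 < e"
  shows "squared_dist \<mu>0 \<mu>2 \<le> ennreal ((d + e)\<^sup>2)"
proof -
  obtain \<mu> V h where path1: "flux_path 0 1 \<mu> V h" "\<mu> 0 = \<mu>0" "\<mu> 1 = \<mu>1" "path_energy 0 1 \<mu> V h < ennreal (d\<^sup>2)"
    using near_minimal_path[OF assms(1)] .
  obtain \<nu> W k where path2: "flux_path 0 1 \<nu> W k" "\<nu> 0 = \<mu>1" "\<nu> 1 = \<mu>2" "path_energy 0 1 \<nu> W k < ennreal (e\<^sup>2)"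
    using near_minimal_path[OF assms(2)] .
  \<comment> \<open>The first curve occupies the fraction \<open>m\<close> of the time.\<close>
  define m where "m = d / (d + e)"
  have m: "0 < m" "m < 1" "1 - m = e / (d + e)" using assms by (auto simp: m_def field_simps)
  have s1: "t \<in> {0..m} \<longleftrightarrow> 0 + (1/m) * t \<in> {0..1}" for t
    using m by (simp add: field_simps)
  have s2: "t \<in> {m..1} \<longleftrightarrow> - m / (1 - m) + (1 / (1 - m)) * t \<in> {0..1}" for t
  proof -
    have "- m / (1 - m) + (1 / (1 - m)) * t = (t - m) / (1 - m)" by (simp add: diff_divide_distrib)
    then show ?thesis using m(1,2) by (simp add: zero_le_divide_iff divide_le_eq)
  qed
  have ne: "1 / m \<noteq> 0" "1 / (1 - m) \<noteq> 0" using m by auto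
  note p1 = flux_path_affine[OF path1(1) ne(1) s1]
  note p2 = flux_path_affine[OF path2(1) ne(2) s2]
  have glue: "\<mu> (0 + (1/m) * m) = \<nu> (- m / (1 - m) + (1 / (1 - m)) * m)"
    using m path1(3) path2(2) by simp
  have m': "0 \<le> m" "m \<le> 1" using m by auto
  note J = flux_path_join[OF p1(1) p2(1) m' glue]
  have "squared_dist \<mu>0 \<mu>2 \<le> ennreal (1/m) * path_energy 0 1 \<mu> V h + ennreal (1/(1 - m)) * path_energy 0 1 \<nu> W k"
  proof -
    have "- m / (1 - m) + 1 / (1 - m) = 1" using m by (simp add: field_simps)
    then show ?thesis
      using order_trans[OF squared_dist_le_path_energy[OF J(1)] J(2)] m(1,2) path1(2) path2(3)
      unfolding p1(2) p2(2) by simp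
  qed
  also have "\<dots> \<le> ennreal (1/m) * ennreal (d\<^sup>2) + ennreal (1/(1 - m)) * ennreal (e\<^sup>2)"
    using path1(4) path2(4) by (intro add_mono mult_left_mono) auto
  also have "\<dots> = ennreal (1/m * d\<^sup>2 + 1/(1-m) * e\<^sup>2)"
    using m(1,2) by (simp add: ennreal_plus ennreal_mult[symmetric])
  also have "1/m * d\<^sup>2 + 1/(1-m) * e\<^sup>2 = (d + e)\<^sup>2"
    unfolding m(3) m_def using assms by (simp add: power2_eq_square field_simps)
  finally show ?thesis .
qed

section \<open>Upper bounds for the distance\<close>

lemma discrete_divergence_add:
  "discrete_divergence K (\<lambda>i j. V i j + W i j) x = discrete_divergence K V x + discrete_divergence K W x"
proof -
  have "discrete_divergence K (\<lambda>i j. V i j + W i j) x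
      = 1/2 * (\<Sum>y\<in>UNIV. (V x y - V y x) * K x y + (W x y - W y x) * K x y)"
    unfolding discrete_divergence_def by (intro arg_cong[where f = "(*) (1/2)"] sum.cong) (simp_all add: algebra_simps)
  then show ?thesis unfolding sum.distrib distrib_left discrete_divergence_def .
qed

lemma discrete_divergence_sum:
  "finite A \<Longrightarrow> discrete_divergence K (\<lambda>i j. \<Sum>z\<in>A. V z i j) x = (\<Sum>z\<in>A. discrete_divergence K (V z) x)"
proof (induction A rule: finite_induct)
  case empty
  show ?case by (simp add: discrete_divergence_def)
next
  case (insert z A)
  then show ?case using discrete_divergence_add[of "V z" "\<lambda>i j. \<Sum>z\<in>A. V z i j" x] by simp
qed

text \<open>
  A unit flux on a single edge moves mass between its endpoints; irreducibility chains such fluxes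
  along a path.
\<close>
lemma flux_between_points:
  "\<exists>V. \<forall>y. discrete_divergence K V y = (if y = x then 1 / \<pi> x else 0) - (if y = z then 1 / \<pi> z else 0)"
proof -
  have "(x, z) \<in> {(u, v). 0 < K u v}\<^sup>*"
    using irreducible by (simp add: irreducible_kernel_def)
  then show ?thesis
  proof (induction rule: rtrancl_induct)
    case base
    show ?case by (intro exI[of _ "\<lambda>_ _. 0"]) (simp add: discrete_divergence_def)
  next
    case (step u v)
    then obtain V where V: "\<And>y. discrete_divergence K V y = (if y = x then 1 / \<pi> x else 0) - (if y = u then 1 / \<pi> u else 0)"
      by blast
    have K: "0 < K u v" using step.hyps by simp
    \<comment> \<open>The factor 2 offsets the 1/2 in the divergence, as only one orientation of the edge is used.\<close>
    define c where "c = 2 / (\<pi> u * K u v)"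
    define W where "W i j = (if i = u \<and> j = v then c else 0)" for i j
    have bal: "c * K v u = 2 / \<pi> v"
    proof -
      have "K v u = K u v * \<pi> u / \<pi> v"
        using detailed_balance[of u v] \<pi>_pos[of v] by (simp add: field_simps)
      then show ?thesis using K \<pi>_pos[of u] by (simp add: c_def)
    qed
    have "discrete_divergence K W y = (if y = u then 1 / \<pi> u else 0) - (if y = v then 1 / \<pi> v else 0)" for y
    proof -
      have "(\<Sum>j\<in>UNIV. W y j * K y j) = (if y = u then c * K u v else 0)"
      proof -
        have "(\<Sum>j\<in>UNIV. W y j * K y j) = (\<Sum>j\<in>UNIV. if j = v then (if y = u then c * K u v else 0) else 0)"
          by (intro sum.cong) (auto simp: W_def)
        then show ?thesis by simp
      qed
      moreover have "(\<Sum>j\<in>UNIV. W j y * K y j) = (if y = v then c * K v u else 0)"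
      proof -
        have "(\<Sum>j\<in>UNIV. W j y * K y j) = (\<Sum>j\<in>UNIV. if j = u then (if y = v then c * K v u else 0) else 0)"
          by (intro sum.cong) (auto simp: W_def)
        then show ?thesis by simp
      qed
      ultimately have "discrete_divergence K W y = 1/2 * ((if y = u then c * K u v else 0) - (if y = v then c * K v u else 0))"
        by (simp add: discrete_divergence_def left_diff_distrib sum_subtractf)
      moreover have "c * K u v = 2 / \<pi> u" using K by (simp add: c_def)
      ultimately have dW: "discrete_divergence K W y = 1/2 * ((if y = u then 2 / \<pi> u else 0) - (if y = v then 2 / \<pi> v else 0))"
        by (simp only: bal)
      show ?thesis unfolding dW by simp
    qed
    then have "\<forall>y. discrete_divergence K (\<lambda>i j. V i j + W i j) y = (if y = x then 1 / \<pi> x else 0) - (if y = v then 1 / \<pi> v else 0)"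
      by (simp add: discrete_divergence_add V)
    then show ?case by blast
  qed
qed

text \<open>
  Every state sends its mass to one fixed state \<open>z0\<close> along a unit flux chosen once and for all; this
  is linear in \<open>w\<close>, hence bounded, and the total arriving at \<open>z0\<close> is zero.
\<close>
lemma divergence_right_inverse_bounded:
  obtains C where "0 \<le> C"
    "\<And>w. (\<Sum>x\<in>UNIV. w x * \<pi> x) = 0 \<Longrightarrow>
       \<exists>V. (\<forall>x. discrete_divergence K V x = w x) \<and> (\<forall>x y. \<bar>V x y\<bar> \<le> C * (\<Sum>z\<in>UNIV. \<bar>w z\<bar>))"
proof -
  obtain z0 :: 'x where True by simp
  obtain F where F: "\<And>x y. discrete_divergence K (F x) y = (if y = x then 1 / \<pi> x else 0) - (if y = z0 then 1 / \<pi> z0 else 0)"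
    using flux_between_points[where z = z0] by metis
  define C where "C = (\<Sum>x\<in>UNIV. \<Sum>i\<in>UNIV. \<Sum>j\<in>UNIV. \<bar>\<pi> x * F x i j\<bar>)"
  have C: "\<bar>\<pi> x * F x i j\<bar> \<le> C" for x i j
  proof -
    have "\<bar>\<pi> x * F x i j\<bar> \<le> (\<Sum>j\<in>UNIV. \<bar>\<pi> x * F x i j\<bar>)"
      by (rule member_le_sum) auto
    also have "\<dots> \<le> (\<Sum>i\<in>UNIV. \<Sum>j\<in>UNIV. \<bar>\<pi> x * F x i j\<bar>)"
      by (rule member_le_sum[where f = "\<lambda>i. \<Sum>j\<in>UNIV. \<bar>\<pi> x * F x i j\<bar>"]) (auto intro: sum_nonneg)
    also have "\<dots> \<le> C" unfolding C_def
      by (rule member_le_sum[where f = "\<lambda>x. \<Sum>i\<in>UNIV. \<Sum>j\<in>UNIV. \<bar>\<pi> x * F x i j\<bar>"]) (auto intro!: sum_nonneg)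
    finally show ?thesis .
  qed
  show thesis
  proof (rule that)
    show "0 \<le> C" unfolding C_def by (intro sum_nonneg) auto
    fix w :: "'x \<Rightarrow> real" assume w: "(\<Sum>x\<in>UNIV. w x * \<pi> x) = 0"
    define V where "V i j = (\<Sum>z\<in>UNIV. (w z * \<pi> z) * F z i j)" for i j
    have "discrete_divergence K V x = w x" for x
    proof -
      have "discrete_divergence K V x = (\<Sum>z\<in>UNIV. (w z * \<pi> z) * discrete_divergence K (F z) x)"
        unfolding V_def by (simp add: discrete_divergence_sum discrete_divergence_scale)
      also have "\<dots> = (\<Sum>z\<in>UNIV. (if z = x then w z else 0) - (w z * \<pi> z) * (if x = z0 then 1 / \<pi> z0 else 0))"
        using \<pi>_pos by (intro sum.cong) (auto simp: F algebra_simps order_less_imp_not_eq2)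
      also have "\<dots> = w x"
        by (simp add: sum_subtractf w flip: sum_distrib_right)
      finally show ?thesis .
    qed
    moreover have "\<bar>V x y\<bar> \<le> C * (\<Sum>z\<in>UNIV. \<bar>w z\<bar>)" for x y
    proof -
      have "\<bar>V x y\<bar> \<le> (\<Sum>z\<in>UNIV. \<bar>(w z * \<pi> z) * F z x y\<bar>)" unfolding V_def by (rule sum_abs)
      also have "\<dots> \<le> (\<Sum>z\<in>UNIV. C * \<bar>w z\<bar>)"
      proof (rule sum_mono)
        fix z
        have "\<bar>(w z * \<pi> z) * F z x y\<bar> = \<bar>w z\<bar> * \<bar>\<pi> z * F z x y\<bar>" by (simp add: abs_mult)
        also have "\<dots> \<le> \<bar>w z\<bar> * C" by (intro mult_left_mono C) auto
        finally show "\<bar>(w z * \<pi> z) * F z x y\<bar> \<le> C * \<bar>w z\<bar>" by (simp add: mult.commute)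
      qed
      finally show ?thesis by (simp add: sum_distrib_left)
    qed
    ultimately show "\<exists>V. (\<forall>x. discrete_divergence K V x = w x) \<and> (\<forall>x y. \<bar>V x y\<bar> \<le> C * (\<Sum>z\<in>UNIV. \<bar>w z\<bar>))"
      by blast
  qed
qed

lemma sum_K_\<pi>: "(\<Sum>x\<in>UNIV. \<Sum>y\<in>UNIV. K x y * \<pi> x) = 1"
proof -
  have "(\<Sum>y\<in>UNIV. K x y * \<pi> x) = \<pi> x" for x
    using markov by (simp add: markov_kernel_def flip: sum_distrib_right)
  moreover have "(\<Sum>x\<in>UNIV. \<pi> x) = 1" using invariant unfolding invariant_probability_def by blast
  ultimately show ?thesis by (simp only:)
qed

lemma \<pi>_le_1: "\<pi> x \<le> 1"
proof -
  have "\<pi> x \<le> (\<Sum>x\<in>UNIV. \<pi> x)" using \<pi>_pos by (intro member_le_sum) (auto intro: less_imp_le)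
  moreover have "(\<Sum>x\<in>UNIV. \<pi> x) = 1" using invariant unfolding invariant_probability_def by blast
  ultimately show ?thesis by linarith
qed

lemma flux_action_le:
  assumes "0 < c" "\<And>x. c \<le> \<mu> x" "\<And>x y. \<bar>V x y\<bar> \<le> m" "0 \<le> m"
  shows "flux_action K \<pi> \<mu> V \<le> ennreal (m\<^sup>2 / c)"
proof -
  have Kpi: "0 \<le> K x y * \<pi> x" for x y using K_nonneg[of x y] \<pi>_pos[of x] by simp
  have "flux_cost (V x y) (\<mu> x) (\<mu> y) * ennreal (K x y * \<pi> x) \<le> ennreal (m\<^sup>2 / c * (K x y * \<pi> x))" for x y
  proof -
    have \<theta>: "c \<le> log_mean (\<mu> x) (\<mu> y)"
      by (rule log_mean_bounds(1)[of _ _ _ "max (\<mu> x) (\<mu> y)"]) (use assms in auto)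
    have "(V x y)\<^sup>2 \<le> m\<^sup>2" using power_mono[OF assms(3)[of x y], of 2] by simp
    then have "(V x y)\<^sup>2 / log_mean (\<mu> x) (\<mu> y) \<le> m\<^sup>2 / c"
      using \<theta> assms(1) by (intro frac_le) auto
    then have "flux_cost (V x y) (\<mu> x) (\<mu> y) \<le> ennreal (m\<^sup>2 / c)"
      using \<theta> assms(1) by (simp add: flux_cost_pos_mean ennreal_leI)
    then have "flux_cost (V x y) (\<mu> x) (\<mu> y) * ennreal (K x y * \<pi> x) \<le> ennreal (m\<^sup>2 / c) * ennreal (K x y * \<pi> x)"
      by (rule mult_right_mono) simp
    also have "\<dots> = ennreal (m\<^sup>2 / c * (K x y * \<pi> x))"
      using assms(1) by (intro ennreal_mult'[symmetric]) simp
    finally show ?thesis .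
  qed
  then have "flux_action K \<pi> \<mu> V \<le> ennreal (1/2) * (\<Sum>x\<in>UNIV. \<Sum>y\<in>UNIV. ennreal (m\<^sup>2 / c * (K x y * \<pi> x)))"
    unfolding flux_action_def by (intro mult_left_mono sum_mono) auto
  also have "(\<Sum>x\<in>UNIV. \<Sum>y\<in>UNIV. ennreal (m\<^sup>2 / c * (K x y * \<pi> x))) = ennreal (m\<^sup>2 / c)"
  proof -
    have nn: "0 \<le> m\<^sup>2 / c * (K x y * \<pi> x)" for x y using assms(1) by (intro mult_nonneg_nonneg[OF _ Kpi]) simp
    have "(\<Sum>x\<in>UNIV. \<Sum>y\<in>UNIV. ennreal (m\<^sup>2 / c * (K x y * \<pi> x))) = ennreal (\<Sum>x\<in>UNIV. \<Sum>y\<in>UNIV. m\<^sup>2 / c * (K x y * \<pi> x))"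
      by (simp only: sum_ennreal sum_nonneg nn)
    also have "(\<Sum>x\<in>UNIV. \<Sum>y\<in>UNIV. m\<^sup>2 / c * (K x y * \<pi> x)) = m\<^sup>2 / c * (\<Sum>x\<in>UNIV. \<Sum>y\<in>UNIV. K x y * \<pi> x)"
      by (simp only: sum_distrib_left)
    finally show ?thesis by (simp add: sum_K_\<pi>)
  qed
  also have "ennreal (1/2) * ennreal (m\<^sup>2 / c) = ennreal (1/2 * (m\<^sup>2 / c))"
    by (rule ennreal_mult'[symmetric]) simp
  also have "\<dots> \<le> ennreal (m\<^sup>2 / c)"
  proof (rule ennreal_leI)
    have "0 \<le> m\<^sup>2 / c" using assms(1) by simp
    then show "1/2 * (m\<^sup>2 / c) \<le> m\<^sup>2 / c" by linarith
  qed
  finally show ?thesis .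
qed

lemma squared_dist_linear_path:
  fixes \<mu> \<nu> :: "'x \<Rightarrow> real"
  assumes "\<mu> \<in> nonneg_densities" "\<nu> \<in> nonneg_densities"
    and eq: "\<And>x. \<nu> x - \<mu> x = h * p x - discrete_divergence K V x"
    and le: "\<And>t. t \<in> {0..1} \<Longrightarrow> action_density (\<lambda>x. \<mu> x + t * (\<nu> x - \<mu> x)) V h \<le> e"
  shows "squared_dist \<mu> \<nu> \<le> e"
proof -
  let ?\<mu> = "\<lambda>t x. \<mu> x + t * (\<nu> x - \<mu> x)"
  have "flux_path 0 1 ?\<mu> (\<lambda>_. V) (\<lambda>_. h)"
    unfolding flux_path_def
  proof (intro conjI ballI allI)
    show "?\<mu> t \<in> nonneg_densities" if "t \<in> {0..1}" for t
    proof -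
      have "0 \<le> (1 - t) * \<mu> x + t * \<nu> x" for x
        using that assms by (intro add_nonneg_nonneg mult_nonneg_nonneg) (auto simp: nonneg_densities_def)
      then show ?thesis by (simp add: nonneg_densities_def algebra_simps)
    qed
    show "abs_continuous_on_interval 0 1 (\<lambda>t. ?\<mu> t x)" for x
    proof (rule abs_continuous_on_interval_lipschitz)
      fix s t :: real assume "s \<le> t"
      have "?\<mu> t x - ?\<mu> s x = (\<nu> x - \<mu> x) * (t - s)" by (simp add: algebra_simps)
      then show "\<bar>?\<mu> t x - ?\<mu> s x\<bar> \<le> \<bar>\<nu> x - \<mu> x\<bar> * (t - s)"
        using \<open>s \<le> t\<close> by (simp add: abs_mult)
    qed
    have "((\<lambda>s. ?\<mu> s x) has_real_derivative h * p x - discrete_divergence K V x) (at t)" for t x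
      unfolding eq[symmetric] by (auto intro!: derivative_eq_intros)
    then show "AE t in lebesgue. 0 < t \<and> t < 1 \<longrightarrow> (\<forall>x. ((\<lambda>s. ?\<mu> s x) has_real_derivative h * p x - discrete_divergence K V x) (at t))"
      by simp
  qed auto
  from squared_dist_le_path_energy[OF this]
  have "squared_dist \<mu> \<nu> \<le> path_energy 0 1 ?\<mu> (\<lambda>_. V) (\<lambda>_. h)" by simp
  also have "\<dots> \<le> (\<integral>\<^sup>+t. e * indicator {0..1::real} t \<partial>lebesgue)"
    unfolding path_energy_def by (intro nn_integral_mono) (auto simp: indicator_def le)
  also have "\<dots> = e" by (simp add: nn_integral_cmult_indicator)
  finally show ?thesis .
qed

text \<open>
  Growth along \<open>p\<close> alone, without any transport.
\<close>
lemma squared_dist_add_p: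
  assumes "\<mu> \<in> nonneg_densities" "0 \<le> \<epsilon>"
  shows "squared_dist \<mu> (\<lambda>x. \<mu> x + \<epsilon> * p x) \<le> ennreal ((a * \<epsilon>)\<^sup>2)"
proof (rule squared_dist_linear_path[where V = "\<lambda>_ _. 0" and h = \<epsilon>])
  show "(\<lambda>x. \<mu> x + \<epsilon> * p x) \<in> nonneg_densities"
    using mult_nonneg_nonneg[OF assms(2) less_imp_le[OF p_pos]] assms(1)
    by (simp add: nonneg_densities_def add_nonneg_nonneg)
qed (use assms in \<open>auto simp: discrete_divergence_def action_density_def flux_action_def flux_cost_def
      power_mult_distrib ennreal_mult\<close>)

text \<open>
  Along the linear interpolation the logarithmic means are at least \<open>c\<close>. The constant growth
  rate \<open>h\<close> accounts for the difference of masses, and the remainder has zero mass and is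
  the divergence of a constant flux of comparable size.
\<close>
lemma squared_dist_bounded_below:
  assumes "0 < c"
  obtains C where "0 \<le> C"
    "\<And>\<mu> \<nu>. (\<And>x. c \<le> \<mu> x) \<Longrightarrow> (\<And>x. c \<le> \<nu> x) \<Longrightarrow> squared_dist \<mu> \<nu> \<le> ennreal ((C * (\<Sum>x\<in>UNIV. \<bar>\<nu> x - \<mu> x\<bar>))\<^sup>2)"
proof -
  obtain C where "0 \<le> C" and C: "\<And>w. (\<Sum>x\<in>UNIV. w x * \<pi> x) = 0 \<Longrightarrow>
       \<exists>V. (\<forall>x. discrete_divergence K V x = w x) \<and> (\<forall>x y. \<bar>V x y\<bar> \<le> C * (\<Sum>z\<in>UNIV. \<bar>w z\<bar>))"
    by (rule divergence_right_inverse_bounded) blast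
  define P where "P = (\<Sum>x\<in>UNIV. p x)"
  have "0 \<le> P" unfolding P_def using p_pos by (intro sum_nonneg) (auto intro: less_imp_le)
  define B where "B = a\<^sup>2 + b\<^sup>2 * (C * (P + 1))\<^sup>2 / c"
  have "0 \<le> B" using \<open>0 < c\<close> by (simp add: B_def)
  show thesis
  proof (rule that)
    show "0 \<le> sqrt B" using \<open>0 \<le> B\<close> by simp
    fix \<mu> \<nu> :: "'x \<Rightarrow> real" assume \<mu>: "\<And>x. c \<le> \<mu> x" and \<nu>: "\<And>x. c \<le> \<nu> x"
    define S where "S = (\<Sum>x\<in>UNIV. \<bar>\<nu> x - \<mu> x\<bar>)"
    define h where "h = (\<Sum>x\<in>UNIV. (\<nu> x - \<mu> x) * \<pi> x)"
    define w where "w x = h * p x - (\<nu> x - \<mu> x)" for x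
    have "0 \<le> S" unfolding S_def by (intro sum_nonneg) auto
    have "(\<Sum>x\<in>UNIV. w x * \<pi> x) = h * (\<Sum>x\<in>UNIV. p x * \<pi> x) - h"
      unfolding w_def h_def by (simp add: sum_subtractf left_diff_distrib sum_distrib_left mult.assoc)
    then have "(\<Sum>x\<in>UNIV. w x * \<pi> x) = 0" by (simp add: p_mass)
    then obtain V where V: "\<And>x. discrete_divergence K V x = w x" "\<And>x y. \<bar>V x y\<bar> \<le> C * (\<Sum>z\<in>UNIV. \<bar>w z\<bar>)"
      using C by blast
    \<comment> \<open>Both \<open>h\<close> and \<open>w\<close> are bounded by multiples of the total variation \<open>S\<close>.\<close>
    have h: "\<bar>h\<bar> \<le> S"
      unfolding h_def S_def
    proof (rule order_trans[OF sum_abs sum_mono])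
      fix x show "\<bar>(\<nu> x - \<mu> x) * \<pi> x\<bar> \<le> \<bar>\<nu> x - \<mu> x\<bar>"
        using \<pi>_le_1[of x] \<pi>_pos[of x] by (simp add: abs_mult mult_left_le)
    qed
    have "(\<Sum>z\<in>UNIV. \<bar>w z\<bar>) \<le> (\<Sum>z\<in>UNIV. \<bar>h\<bar> * p z + \<bar>\<nu> z - \<mu> z\<bar>)"
    proof (rule sum_mono)
      fix z
      have "\<bar>w z\<bar> \<le> \<bar>h * p z\<bar> + \<bar>\<nu> z - \<mu> z\<bar>" unfolding w_def by (rule abs_triangle_ineq4)
      then show "\<bar>w z\<bar> \<le> \<bar>h\<bar> * p z + \<bar>\<nu> z - \<mu> z\<bar>" using p_pos[of z] by (simp add: abs_mult)
    qed
    also have "\<dots> = \<bar>h\<bar> * P + S" by (simp add: sum.distrib P_def S_def sum_distrib_left)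
    also have "\<dots> \<le> S * P + S" using h \<open>0 \<le> P\<close> by (intro add_right_mono mult_right_mono)
    finally have "(\<Sum>z\<in>UNIV. \<bar>w z\<bar>) \<le> (P + 1) * S" by (simp add: algebra_simps)
    then have V': "\<bar>V x y\<bar> \<le> C * ((P + 1) * S)" for x y
      using V(2)[of x y] \<open>0 \<le> C\<close> by (meson mult_left_mono order_trans)
    have "squared_dist \<mu> \<nu> \<le> ennreal (B * S\<^sup>2)"
    proof (rule squared_dist_linear_path[where V = V and h = h])
      show "\<mu> \<in> nonneg_densities" "\<nu> \<in> nonneg_densities"
        using \<mu> \<nu> \<open>0 < c\<close> by (auto simp: nonneg_densities_def intro: order_trans[OF less_imp_le])
      show "\<nu> x - \<mu> x = h * p x - discrete_divergence K V x" for x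
        by (simp add: V(1) w_def)
      fix t :: real assume t: "t \<in> {0..1}"
      have c_le: "c \<le> \<mu> x + t * (\<nu> x - \<mu> x)" for x
      proof -
        have "(1 - t) * c + t * c \<le> (1 - t) * \<mu> x + t * \<nu> x"
          using t \<mu>[of x] \<nu>[of x] by (intro add_mono mult_left_mono) auto
        then show ?thesis by (simp add: algebra_simps)
      qed
      have "flux_action K \<pi> (\<lambda>x. \<mu> x + t * (\<nu> x - \<mu> x)) V \<le> ennreal ((C * ((P + 1) * S))\<^sup>2 / c)"
        by (rule flux_action_le[OF \<open>0 < c\<close> c_le V']) (use \<open>0 \<le> C\<close> \<open>0 \<le> P\<close> \<open>0 \<le> S\<close> in simp)
      moreover have "h\<^sup>2 \<le> S\<^sup>2" using power_mono[OF h, of 2] by simp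
      ultimately have "action_density (\<lambda>x. \<mu> x + t * (\<nu> x - \<mu> x)) V h \<le>
          ennreal (a\<^sup>2) * ennreal (S\<^sup>2) + ennreal (b\<^sup>2) * ennreal ((C * ((P + 1) * S))\<^sup>2 / c)"
        unfolding action_density_def by (intro add_mono mult_left_mono ennreal_leI) auto
      also have "\<dots> = ennreal (a\<^sup>2 * S\<^sup>2 + b\<^sup>2 * ((C * ((P + 1) * S))\<^sup>2 / c))"
        using \<open>0 < c\<close> by (simp add: ennreal_plus ennreal_mult'[symmetric])
      also have "a\<^sup>2 * S\<^sup>2 + b\<^sup>2 * ((C * ((P + 1) * S))\<^sup>2 / c) = B * S\<^sup>2"
      proof -
        have "(C * ((P + 1) * S))\<^sup>2 = (C * (P + 1))\<^sup>2 * S\<^sup>2" by (simp only: power_mult_distrib mult.assoc)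
        then show ?thesis by (simp only: B_def distrib_right times_divide_eq_right times_divide_eq_left mult.assoc)
      qed
      finally show "action_density (\<lambda>x. \<mu> x + t * (\<nu> x - \<mu> x)) V h \<le> ennreal (B * S\<^sup>2)" .
    qed
    then show "squared_dist \<mu> \<nu> \<le> ennreal ((sqrt B * (\<Sum>x\<in>UNIV. \<bar>\<nu> x - \<mu> x\<bar>))\<^sup>2)"
      using \<open>0 \<le> B\<close> by (simp add: S_def power_mult_distrib)
  qed
qed

lemma dist_ab_le: "squared_dist \<mu> \<nu> \<le> ennreal (d\<^sup>2) \<Longrightarrow> 0 \<le> d \<Longrightarrow> dist_ab \<mu> \<nu> \<le> d"
  unfolding dist_ab_eq by (rule real_le_lsqrt) (simp_all add: enn2real_leI)

lemma squared_dist_finite_trans: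
  assumes "squared_dist \<mu>0 \<mu>1 < \<infinity>" "squared_dist \<mu>1 \<mu>2 < \<infinity>"
  shows "squared_dist \<mu>0 \<mu>2 < \<infinity>"
proof -
  have "\<exists>d>0. e < ennreal (d\<^sup>2)" if fin: "e < \<infinity>" for e
  proof -
    obtain r where r: "e = ennreal r" "0 \<le> r" using fin by (cases e) auto
    have "(r + 1)\<^sup>2 = r * r + 2 * r + 1" by (simp add: power2_eq_square algebra_simps)
    then have "r < (r + 1)\<^sup>2" using r(2) mult_nonneg_nonneg[OF r(2) r(2)] by linarith
    then show ?thesis using r by (intro exI[of _ "r + 1"]) (auto simp: ennreal_less_iff)
  qed
  then obtain d e where "0 < d" "0 < e" "squared_dist \<mu>0 \<mu>1 < ennreal (d\<^sup>2)" "squared_dist \<mu>1 \<mu>2 < ennreal (e\<^sup>2)"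
    using assms by meson
  from squared_dist_triangle[OF this(3,4,1,2)] show ?thesis by (auto intro: le_less_trans)
qed

lemma squared_dist_finite:
  assumes "\<mu> \<in> nonneg_densities" "\<nu> \<in> nonneg_densities"
  shows "squared_dist \<mu> \<nu> < \<infinity>"
proof -
  define c where "c = Min (range p)"
  have c: "0 < c" "\<And>x. c \<le> p x" using p_pos by (auto simp: c_def)
  obtain C where C: "\<And>\<mu> \<nu>. (\<And>x. c \<le> \<mu> x) \<Longrightarrow> (\<And>x. c \<le> \<nu> x) \<Longrightarrow> squared_dist \<mu> \<nu> \<le> ennreal ((C * (\<Sum>x\<in>UNIV. \<bar>\<nu> x - \<mu> x\<bar>))\<^sup>2)"
    using squared_dist_bounded_below[OF c(1)] by blast
  have add: "squared_dist \<eta> (\<lambda>x. \<eta> x + p x) < \<infinity>" if "\<eta> \<in> nonneg_densities" for \<eta>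
    using squared_dist_add_p[OF that, of 1] by (simp add: order.strict_trans1 ennreal_less_top)
  have "squared_dist (\<lambda>x. \<mu> x + p x) (\<lambda>x. \<nu> x + p x) < \<infinity>"
    using assms c(2) by (intro le_less_trans[OF C]) (auto simp: nonneg_densities_def intro: add_increasing)
  then have "squared_dist (\<lambda>x. \<mu> x + p x) \<nu> < \<infinity>"
    using add[OF assms(2)] unfolding squared_dist_commute[of \<nu>] by (rule squared_dist_finite_trans)
  with add[OF assms(1)] show ?thesis by (rule squared_dist_finite_trans)
qed

lemma squared_dist_eq:
  assumes "\<mu> \<in> nonneg_densities" "\<nu> \<in> nonneg_densities"
  shows "squared_dist \<mu> \<nu> = ennreal ((dist_ab \<mu> \<nu>)\<^sup>2)"
  using squared_dist_finite[OF assms] by (simp add: dist_ab_eq)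

lemma dist_ab_triangle:
  assumes "\<mu>0 \<in> nonneg_densities" "\<mu>1 \<in> nonneg_densities" "\<mu>2 \<in> nonneg_densities"
  shows "dist_ab \<mu>0 \<mu>2 \<le> dist_ab \<mu>0 \<mu>1 + dist_ab \<mu>1 \<mu>2"
proof (rule field_le_epsilon)
  fix e :: real assume "0 < e"
  have "squared_dist \<mu> \<nu> < ennreal ((dist_ab \<mu> \<nu> + e / 2)\<^sup>2)" if "\<mu> \<in> nonneg_densities" "\<nu> \<in> nonneg_densities" for \<mu> \<nu>
    unfolding squared_dist_eq[OF that] using \<open>0 < e\<close> dist_ab_nonneg[of \<mu> \<nu>]
    by (simp add: ennreal_less_iff power_strict_mono)
  from squared_dist_triangle[OF this[OF assms(1,2)] this[OF assms(2,3)]]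
  have "squared_dist \<mu>0 \<mu>2 \<le> ennreal ((dist_ab \<mu>0 \<mu>1 + e/2 + (dist_ab \<mu>1 \<mu>2 + e/2))\<^sup>2)"
    using \<open>0 < e\<close> by (simp add: dist_ab_nonneg add_nonneg_pos)
  from dist_ab_le[OF this] show "dist_ab \<mu>0 \<mu>2 \<le> dist_ab \<mu>0 \<mu>1 + dist_ab \<mu>1 \<mu>2 + e"
    using \<open>0 < e\<close> by (simp add: dist_ab_nonneg add_nonneg_nonneg)
qed

lemma dist_ab_commute: "dist_ab \<mu> \<nu> = dist_ab \<nu> \<mu>"
  by (simp add: dist_ab_eq squared_dist_commute)

text \<open>
  Linear interpolation alone is too expensive near densities with zeros, so both densities are first
  lifted by \<open>\<epsilon> * p\<close>, at a cost that depends on \<open>\<epsilon>\<close> only.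
\<close>
lemma dist_ab_tendsto_0:
  assumes "\<And>n. \<nu> n \<in> nonneg_densities" "\<mu> \<in> nonneg_densities" "\<And>x. (\<lambda>n. \<nu> n x) \<longlonglongrightarrow> \<mu> x"
  shows "(\<lambda>n. dist_ab (\<nu> n) \<mu>) \<longlonglongrightarrow> 0"
proof (rule tendstoI)
  fix e :: real assume "0 < e"
  \<comment> \<open>Lifting either density then costs \<open>e / 3\<close>.\<close>
  define \<epsilon> where "\<epsilon> = e / (3 * a)"
  have \<epsilon>: "0 < \<epsilon>" "a * \<epsilon> = e / 3" using \<open>0 < e\<close> a_pos by (simp_all add: \<epsilon>_def)
  define c where "c = \<epsilon> * Min (range p)"
  have "0 < Min (range p)" using p_pos by auto
  then have "0 < c" using \<epsilon> by (simp add: c_def)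
  have c: "c \<le> \<eta> x + \<epsilon> * p x" if "\<eta> \<in> nonneg_densities" for \<eta> x
  proof -
    have "Min (range p) \<le> p x" by simp
    then have "c \<le> \<epsilon> * p x" using \<epsilon>(1) by (simp add: c_def)
    then show ?thesis using that by (simp add: nonneg_densities_def add_increasing)
  qed
  obtain C where "0 \<le> C" and C: "\<And>\<mu> \<nu>. (\<And>x. c \<le> \<mu> x) \<Longrightarrow> (\<And>x. c \<le> \<nu> x) \<Longrightarrow> squared_dist \<mu> \<nu> \<le> ennreal ((C * (\<Sum>x\<in>UNIV. \<bar>\<nu> x - \<mu> x\<bar>))\<^sup>2)"
    using squared_dist_bounded_below[OF \<open>0 < c\<close>] by blast
  let ?up = "\<lambda>\<eta> x. \<eta> x + \<epsilon> * p x"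
  have up_nn: "?up \<eta> \<in> nonneg_densities" if "\<eta> \<in> nonneg_densities" for \<eta>
    using c[OF that] \<open>0 < c\<close> by (auto simp: nonneg_densities_def intro: order_trans[OF less_imp_le])
  have up: "dist_ab \<eta> (?up \<eta>) \<le> e / 3" if "\<eta> \<in> nonneg_densities" for \<eta>
    using squared_dist_add_p[OF that, of \<epsilon>] \<epsilon> \<open>0 < e\<close> by (intro dist_ab_le) auto
  have "(\<lambda>n. C * (\<Sum>x\<in>UNIV. \<bar>\<mu> x - \<nu> n x\<bar>)) \<longlonglongrightarrow> C * (\<Sum>x\<in>UNIV. \<bar>\<mu> x - \<mu> x\<bar>)"
    by (intro tendsto_intros assms)
  then have "(\<lambda>n. C * (\<Sum>x\<in>UNIV. \<bar>\<mu> x - \<nu> n x\<bar>)) \<longlonglongrightarrow> 0" by simp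
  then have "\<forall>\<^sub>F n in sequentially. C * (\<Sum>x\<in>UNIV. \<bar>\<mu> x - \<nu> n x\<bar>) < e / 3"
    using \<open>0 < e\<close> by (intro order_tendstoD(2)) auto
  then show "\<forall>\<^sub>F n in sequentially. dist (dist_ab (\<nu> n) \<mu>) 0 < e"
  proof eventually_elim
    case (elim n)
    note \<nu>n = assms(1)[of n]
    have "dist_ab (?up (\<nu> n)) (?up \<mu>) \<le> C * (\<Sum>x\<in>UNIV. \<bar>\<mu> x - \<nu> n x\<bar>)"
    proof (rule dist_ab_le)
      show "squared_dist (?up (\<nu> n)) (?up \<mu>) \<le> ennreal ((C * (\<Sum>x\<in>UNIV. \<bar>\<mu> x - \<nu> n x\<bar>))\<^sup>2)"
        using C[of "?up (\<nu> n)" "?up \<mu>"] c[OF \<nu>n] c[OF assms(2)] by simp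
      show "0 \<le> C * (\<Sum>x\<in>UNIV. \<bar>\<mu> x - \<nu> n x\<bar>)" using \<open>0 \<le> C\<close> by (simp add: sum_nonneg)
    qed
    moreover have "dist_ab (\<nu> n) \<mu> \<le> dist_ab (\<nu> n) (?up (\<nu> n)) + (dist_ab (?up (\<nu> n)) (?up \<mu>) + dist_ab (?up \<mu>) \<mu>)"
      using dist_ab_triangle[OF \<nu>n up_nn[OF \<nu>n] assms(2)]
        dist_ab_triangle[OF up_nn[OF \<nu>n] up_nn[OF assms(2)] assms(2)] by linarith
    moreover have "dist_ab (?up \<mu>) \<mu> \<le> e / 3" using up[OF assms(2)] by (simp add: dist_ab_commute)
    ultimately have "dist_ab (\<nu> n) \<mu> < e" using elim up[OF \<nu>n] by linarith
    then show ?case by (simp add: dist_ab_nonneg)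
  qed
qed

section \<open>Curves of bounded energy\<close>

text \<open>
  Cauchy--Schwarz over pairs of states, after writing the divergence at \<open>x\<close> as the pairing of \<open>V\<close> with
  the gradient of the indicator function of \<open>x\<close>; the weights \<open>K i j * \<pi> i\<close> sum to one.
\<close>
lemma divergence_square_le:
  "(\<pi> x * discrete_divergence K V x)\<^sup>2 \<le> (\<Sum>i\<in>UNIV. \<Sum>j\<in>UNIV. (V i j)\<^sup>2 * (K i j * \<pi> i))"
proof -
  define \<phi> :: "'x \<Rightarrow> real" where "\<phi> i = (if i = x then 1 else 0)" for i
  have Kpi: "0 \<le> K i j * \<pi> i" for i j using K_nonneg[of i j] \<pi>_pos[of i] by simp
  have "\<pi> x * discrete_divergence K V x = (\<Sum>i\<in>UNIV. if i = x then \<pi> i * discrete_divergence K V i else 0)"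
    by simp
  also have "\<dots> = (\<Sum>i\<in>UNIV. \<phi> i * (\<pi> i * discrete_divergence K V i))"
    unfolding \<phi>_def by (intro sum.cong) auto
  also have "\<dots> = (\<Sum>i\<in>UNIV. \<Sum>j\<in>UNIV. (1/2 * (\<phi> i - \<phi> j) * sqrt (K i j * \<pi> i)) * (V i j * sqrt (K i j * \<pi> i)))"
    unfolding sum_divergence_by_parts sum_distrib_left
    by (intro sum.cong) (use Kpi in \<open>simp_all add: mult_ac real_sqrt_mult_self flip: power2_eq_square\<close>)
  also have "\<dots> = (\<Sum>(i, j)\<in>UNIV. (1/2 * (\<phi> i - \<phi> j) * sqrt (K i j * \<pi> i)) * (V i j * sqrt (K i j * \<pi> i)))"
    by (simp add: sum.cartesian_product)
  finally have "(\<pi> x * discrete_divergence K V x)\<^sup>2 \<le>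
     (\<Sum>(i, j)\<in>UNIV. (1/2 * (\<phi> i - \<phi> j) * sqrt (K i j * \<pi> i))\<^sup>2) * (\<Sum>(i, j)\<in>UNIV. (V i j * sqrt (K i j * \<pi> i))\<^sup>2)"
    using Cauchy_Schwarz_ineq_sum[of "\<lambda>(i, j). 1/2 * (\<phi> i - \<phi> j) * sqrt (K i j * \<pi> i)" "\<lambda>(i, j). V i j * sqrt (K i j * \<pi> i)" UNIV]
    by (simp add: case_prod_unfold)
  also have "\<dots> \<le> 1 * (\<Sum>(i, j)\<in>UNIV. (V i j * sqrt (K i j * \<pi> i))\<^sup>2)"
  proof (rule mult_right_mono)
    have "(\<Sum>(i, j)\<in>UNIV. (1/2 * (\<phi> i - \<phi> j) * sqrt (K i j * \<pi> i))\<^sup>2) \<le> (\<Sum>(i, j)\<in>UNIV. K i j * \<pi> i)"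
    proof (rule sum_mono, clarify)
      fix i j
      have "(1/2 * (\<phi> i - \<phi> j))\<^sup>2 \<le> 1" by (auto simp: \<phi>_def power2_eq_square)
      then have "(1/2 * (\<phi> i - \<phi> j))\<^sup>2 * (K i j * \<pi> i) \<le> 1 * (K i j * \<pi> i)" by (rule mult_right_mono[OF _ Kpi])
      then show "(1/2 * (\<phi> i - \<phi> j) * sqrt (K i j * \<pi> i))\<^sup>2 \<le> K i j * \<pi> i"
        unfolding power_mult_distrib[of _ "sqrt _"] real_sqrt_pow2[OF Kpi] by simp
    qed
    also have "\<dots> = 1" using sum_K_\<pi> by (simp add: sum.cartesian_product)
    finally show "(\<Sum>(i, j)\<in>UNIV. (1/2 * (\<phi> i - \<phi> j) * sqrt (K i j * \<pi> i))\<^sup>2) \<le> 1" .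
  qed (auto intro!: sum_nonneg)
  also have "\<dots> = (\<Sum>i\<in>UNIV. \<Sum>j\<in>UNIV. (V i j)\<^sup>2 * (K i j * \<pi> i))"
    using Kpi by (simp add: sum.cartesian_product power_mult_distrib)
  finally show ?thesis .
qed

lemma flux_action_ge:
  assumes "\<mu> \<in> nonneg_densities" "\<And>x. \<mu> x \<le> B" "0 < B"
  shows "ennreal (\<Sum>i\<in>UNIV. \<Sum>j\<in>UNIV. (V i j)\<^sup>2 * (K i j * \<pi> i)) \<le> ennreal (2 * B) * flux_action K \<pi> \<mu> V"
proof -
  have Kpi: "0 \<le> K i j * \<pi> i" for i j using K_nonneg[of i j] \<pi>_pos[of i] by simp
  let ?S = "\<Sum>x\<in>UNIV. \<Sum>y\<in>UNIV. flux_cost (V x y) (\<mu> x) (\<mu> y) * ennreal (K x y * \<pi> x)"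
  have "ennreal (\<Sum>i\<in>UNIV. \<Sum>j\<in>UNIV. (V i j)\<^sup>2 * (K i j * \<pi> i)) = (\<Sum>i\<in>UNIV. \<Sum>j\<in>UNIV. ennreal ((V i j)\<^sup>2) * ennreal (K i j * \<pi> i))"
    using Kpi by (simp only: sum_ennreal[symmetric] ennreal_mult'[symmetric] sum_nonneg zero_le_power2 mult_nonneg_nonneg)
  also have "\<dots> \<le> (\<Sum>i\<in>UNIV. \<Sum>j\<in>UNIV. ennreal B * flux_cost (V i j) (\<mu> i) (\<mu> j) * ennreal (K i j * \<pi> i))"
    using assms by (intro sum_mono mult_right_mono flux_cost_ge) (auto simp: nonneg_densities_def)
  also have "\<dots> = ennreal B * ?S" by (simp only: sum_distrib_left mult.assoc)
  also have "\<dots> = ennreal B * (ennreal 2 * ennreal (1/2)) * ?S"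
    by (subst ennreal_mult'[symmetric]) simp_all
  also have "\<dots> = ennreal (2 * B) * flux_action K \<pi> \<mu> V"
    using assms(3) by (simp add: flux_action_def ennreal_mult' mult_ac)
  finally show ?thesis .
qed

lemma flux_path_has_integral:
  assumes "flux_path l r \<mu> V h" "l \<le> s" "s \<le> t" "t \<le> r"
  shows "((\<lambda>\<tau>. h \<tau> * p x - discrete_divergence K (V \<tau>) x) has_integral \<mu> t x - \<mu> s x) {s..t}"
proof (rule fundamental_theorem_of_calculus_abs_continuous[OF \<open>s \<le> t\<close>])
  have path: "flux_path s t \<mu> V h" by (rule flux_path_subinterval[OF assms(1,2,4)])
  show "abs_continuous_on_interval s t (\<lambda>t. \<mu> t x)" using path by (simp add: flux_path_def)
  have "AE \<tau> in lebesgue. s < \<tau> \<and> \<tau> < t \<longrightarrow>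
    (\<forall>x. ((\<lambda>s. \<mu> s x) has_real_derivative h \<tau> * p x - discrete_divergence K (V \<tau>) x) (at \<tau>))"
    using path by (simp add: flux_path_def)
  then show "AE \<tau> in lebesgue. s < \<tau> \<and> \<tau> < t \<longrightarrow>
    ((\<lambda>s. \<mu> s x) has_real_derivative h \<tau> * p x - discrete_divergence K (V \<tau>) x) (at \<tau>)"
    by eventually_elim blast
qed

text \<open>
  By reversibility the divergence carries no total mass, and \<open>p\<close> has unit mass, so the mass of the
  curve has derivative \<open>h\<close>, whose square integral is controlled by the energy.
\<close>
lemma path_density_bound:
  assumes path: "flux_path 0 1 \<mu> V h" and E: "path_energy 0 1 \<mu> V h \<le> ennreal E" "0 \<le> E" and t: "t \<in> {0..1}"
  shows "\<mu> t x \<le> ((\<Sum>x\<in>UNIV. \<mu> 0 x * \<pi> x) + sqrt E / a) / Min (range \<pi>)"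
proof -
  let ?m = "\<lambda>t. \<Sum>x\<in>UNIV. \<mu> t x * \<pi> x"
  have "((\<lambda>\<tau>. \<Sum>x\<in>UNIV. (h \<tau> * p x - discrete_divergence K (V \<tau>) x) * \<pi> x) has_integral (\<Sum>x\<in>UNIV. (\<mu> t x - \<mu> 0 x) * \<pi> x)) {0..t}"
    using t by (intro has_integral_sum has_integral_mult_left flux_path_has_integral[OF path]) auto
  moreover have "(\<Sum>x\<in>UNIV. (h \<tau> * p x - discrete_divergence K (V \<tau>) x) * \<pi> x) = h \<tau>" for \<tau>
  proof -
    have "(\<Sum>x\<in>UNIV. (h \<tau> * p x - discrete_divergence K (V \<tau>) x) * \<pi> x)
       = h \<tau> * (\<Sum>x\<in>UNIV. p x * \<pi> x) - (\<Sum>x\<in>UNIV. 1 * (\<pi> x * discrete_divergence K (V \<tau>) x))"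
      unfolding left_diff_distrib sum_subtractf sum_distrib_left by (simp add: mult_ac)
    also have "\<dots> = h \<tau>" unfolding sum_divergence_by_parts p_mass by simp
    finally show ?thesis .
  qed
  moreover have "(\<Sum>x\<in>UNIV. (\<mu> t x - \<mu> 0 x) * \<pi> x) = ?m t - ?m 0"
    by (simp add: left_diff_distrib sum_subtractf)
  ultimately have int: "(h has_integral ?m t - ?m 0) {0..t}" by simp
  have "(\<integral>\<^sup>+\<tau>\<in>{0..t}. ennreal ((h \<tau>)\<^sup>2) \<partial>lebesgue) \<le> ennreal (E / a\<^sup>2)"
  proof -
    have "(\<integral>\<^sup>+\<tau>\<in>{0..t}. ennreal ((h \<tau>)\<^sup>2) \<partial>lebesgue) \<le> (\<integral>\<^sup>+\<tau>. ennreal (1 / a\<^sup>2) * (action_density (\<mu> \<tau>) (V \<tau>) (h \<tau>) * indicator {0..1} \<tau>) \<partial>lebesgue)"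
    proof (rule nn_integral_mono)
      fix \<tau> :: real
      have "ennreal ((h \<tau>)\<^sup>2) = ennreal (1 / a\<^sup>2) * (ennreal (a\<^sup>2) * ennreal ((h \<tau>)\<^sup>2))"
        using a_pos by (simp add: ennreal_mult'[symmetric])
      also have "\<dots> \<le> ennreal (1 / a\<^sup>2) * action_density (\<mu> \<tau>) (V \<tau>) (h \<tau>)"
        unfolding action_density_def by (intro mult_left_mono) auto
      finally show "ennreal ((h \<tau>)\<^sup>2) * indicator {0..t} \<tau> \<le> ennreal (1 / a\<^sup>2) * (action_density (\<mu> \<tau>) (V \<tau>) (h \<tau>) * indicator {0..1} \<tau>)"
        using t by (auto simp: indicator_def)
    qed
    also have "\<dots> = ennreal (1 / a\<^sup>2) * path_energy 0 1 \<mu> V h"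
      unfolding path_energy_def using flux_path_measurable(5)[OF path]
      by (subst (asm) borel_measurable_restrict_space_iff_ennreal) (auto intro: nn_integral_cmult)
    also have "\<dots> \<le> ennreal (1 / a\<^sup>2) * ennreal E" using E by (intro mult_left_mono) auto
    also have "\<dots> = ennreal (E / a\<^sup>2)" by (simp add: ennreal_mult'[symmetric])
    finally show ?thesis .
  qed
  from has_integral_square_le[OF _ int _ this]
  have "(?m t - ?m 0)\<^sup>2 \<le> t * (E / a\<^sup>2)" using t E(2) by simp
  also have "\<dots> \<le> 1 * (E / a\<^sup>2)" using t E(2) by (intro mult_right_mono) auto
  also have "\<dots> = (sqrt E / a)\<^sup>2" using E(2) by (simp add: power_divide)
  finally have "?m t - ?m 0 \<le> sqrt E / a"
    by (rule power2_le_imp_le) (use E(2) a_pos in simp)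
  moreover have "\<mu> t x * \<pi> x \<le> ?m t"
    using path t by (intro member_le_sum mult_nonneg_nonneg[OF _ less_imp_le[OF \<pi>_pos]])
      (auto simp: flux_path_def nonneg_densities_def)
  moreover have "\<mu> t x * Min (range \<pi>) \<le> \<mu> t x * \<pi> x"
    using path t by (intro mult_left_mono) (auto simp: flux_path_def nonneg_densities_def)
  moreover have "0 < Min (range \<pi>)" using \<pi>_pos by auto
  ultimately show ?thesis by (simp add: pos_le_divide_eq)
qed

lemma path_holder:
  assumes path: "flux_path 0 1 \<mu> V h" and E: "path_energy 0 1 \<mu> V h \<le> ennreal E" "0 \<le> E"
    and B: "\<And>t x. t \<in> {0..1} \<Longrightarrow> \<mu> t x \<le> B" "0 < B" and st: "0 \<le> s" "s \<le> t" "t \<le> 1"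
  shows "(\<pi> x * (\<mu> t x - \<mu> s x))\<^sup>2 \<le> (t - s) * ((2 * (p x)\<^sup>2 / a\<^sup>2 + 4 * B / b\<^sup>2) * E)"
proof (rule has_integral_square_le[OF \<open>s \<le> t\<close>])
  define Q where "Q = 2 * (p x)\<^sup>2 / a\<^sup>2 + 4 * B / b\<^sup>2"
  have "0 \<le> Q" using B(2) by (simp add: Q_def)
  let ?g = "\<lambda>\<tau>. \<pi> x * (h \<tau> * p x - discrete_divergence K (V \<tau>) x)"
  show "(?g has_integral \<pi> x * (\<mu> t x - \<mu> s x)) {s..t}"
    using st by (intro has_integral_mult_right flux_path_has_integral[OF path])
  show "0 \<le> (2 * (p x)\<^sup>2 / a\<^sup>2 + 4 * B / b\<^sup>2) * E" using \<open>0 \<le> Q\<close> E(2) by (simp add: Q_def)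
  have pointwise: "ennreal ((?g \<tau>)\<^sup>2) \<le> ennreal Q * action_density (\<mu> \<tau>) (V \<tau>) (h \<tau>)" if "\<tau> \<in> {0..1}" for \<tau>
  proof -
    let ?L = "\<Sum>i\<in>UNIV. \<Sum>j\<in>UNIV. (V \<tau> i j)\<^sup>2 * (K i j * \<pi> i)"
    let ?A = "flux_action K \<pi> (\<mu> \<tau>) (V \<tau>)"
    have "0 \<le> ?L" using K_nonneg \<pi>_pos by (intro sum_nonneg mult_nonneg_nonneg) (auto intro: less_imp_le)
    have "(?g \<tau>)\<^sup>2 \<le> 2 * (\<pi> x * (h \<tau> * p x))\<^sup>2 + 2 * (\<pi> x * discrete_divergence K (V \<tau>) x)\<^sup>2"
      using zero_le_power2[of "\<pi> x * (h \<tau> * p x) + \<pi> x * discrete_divergence K (V \<tau>) x"]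
      by (simp add: power2_eq_square algebra_simps)
    also have "\<dots> \<le> 2 * (h \<tau> * p x)\<^sup>2 + 2 * ?L"
    proof (intro add_mono mult_left_mono divergence_square_le)
      have "\<bar>\<pi> x * (h \<tau> * p x)\<bar> \<le> \<bar>h \<tau> * p x\<bar>"
        using \<pi>_le_1[of x] \<pi>_pos[of x] by (simp add: abs_mult mult_left_le_one_le)
      then show "(\<pi> x * (h \<tau> * p x))\<^sup>2 \<le> (h \<tau> * p x)\<^sup>2" by (simp add: abs_le_square_iff)
    qed auto
    finally have "ennreal ((?g \<tau>)\<^sup>2) \<le> ennreal (2 * (p x)\<^sup>2 / a\<^sup>2 * (a\<^sup>2 * (h \<tau>)\<^sup>2) + 2 * ?L)"
      using a_pos by (intro ennreal_leI) (simp add: power_mult_distrib mult_ac)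
    also have "\<dots> = ennreal (2 * (p x)\<^sup>2 / a\<^sup>2) * (ennreal (a\<^sup>2) * ennreal ((h \<tau>)\<^sup>2)) + ennreal 2 * ennreal ?L"
      using \<open>0 \<le> ?L\<close> by (simp only: ennreal_plus ennreal_mult' mult_nonneg_nonneg divide_nonneg_nonneg zero_le_power2 zero_le_numeral)
    also have "\<dots> \<le> ennreal (2 * (p x)\<^sup>2 / a\<^sup>2) * (ennreal (a\<^sup>2) * ennreal ((h \<tau>)\<^sup>2)) + ennreal 2 * (ennreal (2 * B) * ?A)"
      using path that B by (intro add_left_mono mult_left_mono flux_action_ge) (auto simp: flux_path_def)
    also have "ennreal 2 * (ennreal (2 * B) * ?A) = ennreal (4 * B / b\<^sup>2) * (ennreal (b\<^sup>2) * ?A)"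
    proof -
      have "2 * (2 * B) = 4 * B / b\<^sup>2 * b\<^sup>2" using b_pos by simp
      then show ?thesis using B(2) by (simp only: mult.assoc[symmetric] ennreal_mult'[symmetric] zero_le_numeral divide_nonneg_nonneg mult_nonneg_nonneg less_imp_le zero_le_power2)
    qed
    also have "ennreal (2 * (p x)\<^sup>2 / a\<^sup>2) * (ennreal (a\<^sup>2) * ennreal ((h \<tau>)\<^sup>2)) + ennreal (4 * B / b\<^sup>2) * (ennreal (b\<^sup>2) * ?A)
        \<le> ennreal Q * (ennreal (a\<^sup>2) * ennreal ((h \<tau>)\<^sup>2)) + ennreal Q * (ennreal (b\<^sup>2) * ?A)"
      using B(2) by (intro add_mono mult_right_mono ennreal_leI) (auto simp: Q_def)
    also have "\<dots> = ennreal Q * action_density (\<mu> \<tau>) (V \<tau>) (h \<tau>)"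
      by (simp only: action_density_def distrib_left)
    finally show ?thesis .
  qed
  have "(\<integral>\<^sup>+\<tau>\<in>{s..t}. ennreal ((?g \<tau>)\<^sup>2) \<partial>lebesgue) \<le> (\<integral>\<^sup>+\<tau>. ennreal Q * (action_density (\<mu> \<tau>) (V \<tau>) (h \<tau>) * indicator {0..1} \<tau>) \<partial>lebesgue)"
    using pointwise st by (intro nn_integral_mono) (auto simp: indicator_def)
  also have "\<dots> = ennreal Q * path_energy 0 1 \<mu> V h"
    unfolding path_energy_def using flux_path_measurable(5)[OF path]
    by (subst (asm) borel_measurable_restrict_space_iff_ennreal) (auto intro: nn_integral_cmult)
  also have "\<dots> \<le> ennreal Q * ennreal E" using E by (intro mult_left_mono) auto
  also have "\<dots> = ennreal (Q * E)" using \<open>0 \<le> Q\<close> by (simp add: ennreal_mult')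
  finally show "(\<integral>\<^sup>+\<tau>\<in>{s..t}. ennreal ((?g \<tau>)\<^sup>2) \<partial>lebesgue) \<le> ennreal ((2 * (p x)\<^sup>2 / a\<^sup>2 + 4 * B / b\<^sup>2) * E)"
    by (simp only: Q_def)
qed

text \<open>
  Curves of energy at most one from \<open>\<mu>0\<close> stay below a common bound, so the Hoelder estimate holds with
  one constant for them all, while their energies can be taken arbitrarily small.
\<close>
lemma dist_ab_eq_0_imp_eq:
  assumes nn: "\<mu>0 \<in> nonneg_densities" "\<mu>1 \<in> nonneg_densities" and "dist_ab \<mu>0 \<mu>1 = 0"
  shows "\<mu>0 = \<mu>1"
proof
  fix x
  define B where "B = ((\<Sum>x\<in>UNIV. \<mu>0 x * \<pi> x) + 1 / a) / Min (range \<pi>)"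
  define Q where "Q = 2 * (p x)\<^sup>2 / a\<^sup>2 + 4 * B / b\<^sup>2"
  have m: "0 < Min (range \<pi>)" using \<pi>_pos by auto
  have "0 \<le> (\<Sum>x\<in>UNIV. \<mu>0 x * \<pi> x)"
    using nn \<pi>_pos by (intro sum_nonneg mult_nonneg_nonneg) (auto simp: nonneg_densities_def intro: less_imp_le)
  then have "0 < B" using a_pos m by (simp add: B_def add_nonneg_pos)
  then have "0 \<le> Q" by (simp add: Q_def)
  have le: "(\<pi> x * (\<mu>1 x - \<mu>0 x))\<^sup>2 \<le> Q * E" if "0 < E" "E \<le> 1" for E
  proof -
    have "squared_dist \<mu>0 \<mu>1 < ennreal E"
      using squared_dist_eq[OF nn] assms(3) \<open>0 < E\<close> by simp
    then obtain \<mu> V h where path: "flux_path 0 1 \<mu> V h" "\<mu> 0 = \<mu>0" "\<mu> 1 = \<mu>1" "path_energy 0 1 \<mu> V h < ennreal E"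
      by (rule near_minimal_path)
    have "\<mu> t y \<le> B" if "t \<in> {0..1}" for t y
    proof -
      have "((\<Sum>x\<in>UNIV. \<mu>0 x * \<pi> x) + sqrt E / a) / Min (range \<pi>) \<le> B"
        unfolding B_def using a_pos \<open>0 < E\<close> \<open>E \<le> 1\<close>
        by (intro divide_right_mono[OF _ less_imp_le[OF m]] add_left_mono divide_right_mono) auto
      with path_density_bound[OF path(1) less_imp_le[OF path(4)] _ that, of y] \<open>0 < E\<close> show ?thesis
        by (simp add: path(2))
    qed
    from path_holder[OF path(1) less_imp_le[OF path(4)] _ this \<open>0 < B\<close>, of 0 1 x] \<open>0 < E\<close>
    show ?thesis by (simp add: path(2,3) Q_def)
  qed
  have "(\<pi> x * (\<mu>1 x - \<mu>0 x))\<^sup>2 \<le> 0"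
  proof (rule ccontr)
    assume "\<not> ?thesis"
    then have y: "0 < (\<pi> x * (\<mu>1 x - \<mu>0 x))\<^sup>2" (is "0 < ?y") by linarith
    \<comment> \<open>Small enough for the right-hand side to drop to half of the left-hand side.\<close>
    define E where "E = min 1 (?y / (2 * (Q + 1)))"
    have "0 < E" "E \<le> 1" using y \<open>0 \<le> Q\<close> by (auto simp: E_def)
    from le[OF this] have "?y \<le> Q * E" .
    also have "\<dots> \<le> (Q + 1) * (?y / (2 * (Q + 1)))"
      using \<open>0 \<le> Q\<close> y by (intro mult_mono) (auto simp: E_def)
    also have cancel: "(Q + 1) * (?y / (2 * (Q + 1))) = ?y / 2"
    proof -
      have gen: "c * (y / (2 * c)) = y / 2" if "c \<noteq> 0" for c y :: real using that by simp
      show ?thesis by (rule gen) (use \<open>0 \<le> Q\<close> in simp)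
    qed
    finally show False using y by simp
  qed
  then show "\<mu>0 x = \<mu>1 x" using \<pi>_pos[of x] by simp
qed

lemma Metric_space_dist_ab: "Metric_space nonneg_densities dist_ab"
proof
  fix x y z
  show "0 \<le> dist_ab x y" by (rule dist_ab_nonneg)
  show "dist_ab x y = dist_ab y x" by (rule dist_ab_commute)
  show "dist_ab x y = 0 \<longleftrightarrow> x = y" if "x \<in> nonneg_densities" "y \<in> nonneg_densities"
    using dist_ab_eq_0_imp_eq[OF that] squared_dist_self[OF that(1)] by (auto simp: dist_ab_eq)
  show "dist_ab x z \<le> dist_ab x y + dist_ab y z"
    if "x \<in> nonneg_densities" "y \<in> nonneg_densities" "z \<in> nonneg_densities"
    by (rule dist_ab_triangle[OF that])
qed

end

section \<open>Geodesics\<close>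

text \<open>
  Each segment of duration \<open>r\<close>, length \<open>X\<close> and energy \<open>e\<close> satisfies \<open>X\<^sup>2 \<le> r * e\<close>, so
  \<open>e - 2 * D * X + r * D\<^sup>2\<close> is nonnegative and, times \<open>r\<close>, bounds the square of \<open>X - r * D\<close>. The three
  expressions sum to at most \<open>E - D\<^sup>2\<close>, so each of them is at most that.
\<close>
lemma three_segment_inequality:
  fixes A B C D :: real
  assumes "0 \<le> s" "0 \<le> u" "0 \<le> v" "s + u + v = 1" "0 \<le> e1" "0 \<le> e3"
    and A: "A\<^sup>2 \<le> s * e1" and B: "B\<^sup>2 \<le> u * e2" and C: "C\<^sup>2 \<le> v * e3"
    and E: "e1 + e2 + e3 \<le> E" and D: "D \<le> A + B + C" "0 \<le> D"
  shows "(B - u * D)\<^sup>2 \<le> u * (E - D\<^sup>2)"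
proof -
  have seg: "2 * D * X \<le> e + r * D\<^sup>2" if "X\<^sup>2 \<le> r * e" "0 \<le> r" "0 \<le> e" for X r e
  proof (cases "r = 0")
    case True then show ?thesis using that by simp
  next
    case False
    then have "0 < r" using that by simp
    have "0 \<le> (X - r * D)\<^sup>2" by simp
    then have "r * (2 * D * X) \<le> X\<^sup>2 + r * (r * D\<^sup>2)" by (simp add: power2_eq_square algebra_simps)
    also have "\<dots> \<le> r * (e + r * D\<^sup>2)" using that by (simp add: distrib_left)
    finally show ?thesis using \<open>0 < r\<close> by simp
  qed
  have "(B - u * D)\<^sup>2 = B\<^sup>2 - u * (2 * D * B) + u * (u * D\<^sup>2)" by (simp add: power2_eq_square algebra_simps)
  also have "\<dots> \<le> u * (e2 - 2 * D * B + u * D\<^sup>2)" using B by (simp add: algebra_simps)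
  also have "\<dots> \<le> u * (E - D\<^sup>2)"
  proof (rule mult_left_mono[OF _ \<open>0 \<le> u\<close>])
    have "2 * D * D \<le> 2 * D * (A + B + C)" using D by (intro mult_left_mono) auto
    then have 1: "2 * D\<^sup>2 \<le> 2 * D * A + 2 * D * B + 2 * D * C" by (simp add: power2_eq_square algebra_simps)
    have "(s + u + v) * D\<^sup>2 = D\<^sup>2" using assms(4) by simp
    then have 2: "s * D\<^sup>2 + u * D\<^sup>2 + v * D\<^sup>2 = D\<^sup>2" by (simp add: distrib_right)
    show "e2 - 2 * D * B + u * D\<^sup>2 \<le> E - D\<^sup>2"
      using seg[OF A assms(1,5)] seg[OF C assms(3,6)] 1 2 E by linarith
  qed
  finally show ?thesis .
qed

context transport_setting
begin

lemma path_speed: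
  assumes path: "flux_path 0 1 \<mu> V h" and E: "path_energy 0 1 \<mu> V h \<le> ennreal E" "0 \<le> E"
    and st: "0 \<le> s" "s \<le> t" "t \<le> 1"
  shows "(dist_ab (\<mu> s) (\<mu> t) - (t - s) * dist_ab (\<mu> 0) (\<mu> 1))\<^sup>2 \<le> (t - s) * (E - (dist_ab (\<mu> 0) (\<mu> 1))\<^sup>2)"
proof -
  have nn: "\<mu> \<tau> \<in> nonneg_densities" if "0 \<le> \<tau>" "\<tau> \<le> 1" for \<tau>
    using path that by (simp add: flux_path_def)
  let ?e = "\<lambda>l r. path_energy l r \<mu> V h"
  have split: "?e 0 s + ?e s t + ?e t 1 = ?e 0 1"
    using path_energy_split[OF flux_path_subinterval[OF path, of 0 t], of s]
      path_energy_split[OF path, of t] st by simp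
  have fin: "?e 0 s < \<infinity>" "?e s t < \<infinity>" "?e t 1 < \<infinity>"
  proof -
    have "?e 0 s + ?e s t + ?e t 1 < \<infinity>" unfolding split using E(1) by (auto intro: le_less_trans)
    then show "?e 0 s < \<infinity>" "?e s t < \<infinity>" "?e t 1 < \<infinity>" by (auto simp: less_top)
  qed
  have sq: "(dist_ab (\<mu> l) (\<mu> r))\<^sup>2 \<le> (r - l) * enn2real (?e l r)" if "0 \<le> l" "l \<le> r" "r \<le> 1" "?e l r < \<infinity>" for l r
  proof -
    have "ennreal ((dist_ab (\<mu> l) (\<mu> r))\<^sup>2) \<le> ennreal (r - l) * ?e l r"
      using squared_dist_le_subpath(1)[OF flux_path_subinterval[OF path that(1,3)] that(2)] that
      by (subst squared_dist_eq[symmetric]) (auto intro: nn)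
    also have "\<dots> = ennreal ((r - l) * enn2real (?e l r))"
      using that by (simp add: ennreal_mult')
    finally show ?thesis using that by (subst (asm) ennreal_le_iff) auto
  qed
  have "ennreal (enn2real (?e 0 s) + enn2real (?e s t) + enn2real (?e t 1)) \<le> ennreal E"
    using split E(1) fin by (simp add: ennreal_plus)
  then have sum: "enn2real (?e 0 s) + enn2real (?e s t) + enn2real (?e t 1) \<le> E"
    using E(2) by (simp only: ennreal_le_iff)
  have tri: "dist_ab (\<mu> 0) (\<mu> 1) \<le> dist_ab (\<mu> 0) (\<mu> s) + dist_ab (\<mu> s) (\<mu> t) + dist_ab (\<mu> t) (\<mu> 1)"
    using dist_ab_triangle[OF nn[of 0] nn[of s] nn[of 1]] dist_ab_triangle[OF nn[of s] nn[of t] nn[of 1]] st by auto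
  show ?thesis
    by (rule three_segment_inequality[OF _ _ _ _ _ _ sq sq sq sum tri dist_ab_nonneg])
       (use st fin in auto)
qed

lemma constant_speed_geodesicI:
  assumes "\<And>t. t \<in> {0..1} \<Longrightarrow> \<gamma> t \<in> nonneg_densities"
    and "\<And>s t. 0 \<le> s \<Longrightarrow> s \<le> t \<Longrightarrow> t \<le> 1 \<Longrightarrow> dist_ab (\<gamma> s) (\<gamma> t) = (t - s) * dist_ab (\<gamma> 0) (\<gamma> 1)"
  shows "constant_speed_geodesic nonneg_densities dist_ab \<gamma>"
  unfolding constant_speed_geodesic_def
proof (intro conjI ballI assms(1))
  fix s t :: real assume "s \<in> {0..1}" "t \<in> {0..1}"
  then show "dist_ab (\<gamma> s) (\<gamma> t) = \<bar>t - s\<bar> * dist_ab (\<gamma> 0) (\<gamma> 1)"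
    using assms(2)[of s t] assms(2)[of t s] dist_ab_commute[of "\<gamma> s" "\<gamma> t"] by (cases "s \<le> t") auto
qed

lemma minimal_path_geodesic:
  assumes path: "flux_path 0 1 \<mu> V h" and E: "path_energy 0 1 \<mu> V h = ennreal ((dist_ab (\<mu> 0) (\<mu> 1))\<^sup>2)"
  shows "constant_speed_geodesic nonneg_densities dist_ab \<mu>"
proof (rule constant_speed_geodesicI)
  show "\<mu> t \<in> nonneg_densities" if "t \<in> {0..1}" for t
    using path that by (simp add: flux_path_def)
  fix s t :: real assume "0 \<le> s" "s \<le> t" "t \<le> 1"
  from path_speed[OF path order_eq_refl[OF E] _ this]
  show "dist_ab (\<mu> s) (\<mu> t) = (t - s) * dist_ab (\<mu> 0) (\<mu> 1)" by simp
qed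

lemma dist_ab_tendsto:
  assumes "\<And>n. \<mu> n \<in> nonneg_densities" "\<mu>' \<in> nonneg_densities" "\<And>x. (\<lambda>n. \<mu> n x) \<longlonglongrightarrow> \<mu>' x"
    and "\<And>n. \<nu> n \<in> nonneg_densities" "\<nu>' \<in> nonneg_densities" "\<And>x. (\<lambda>n. \<nu> n x) \<longlonglongrightarrow> \<nu>' x"
  shows "(\<lambda>n. dist_ab (\<mu> n) (\<nu> n)) \<longlonglongrightarrow> dist_ab \<mu>' \<nu>'"
proof (rule Lim_null[THEN iffD2], rule Lim_null_comparison)
  show "\<forall>\<^sub>F n in sequentially. norm (dist_ab (\<mu> n) (\<nu> n) - dist_ab \<mu>' \<nu>') \<le> dist_ab (\<mu> n) \<mu>' + dist_ab (\<nu> n) \<nu>'"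
  proof (rule always_eventually, rule allI)
    fix n
    show "norm (dist_ab (\<mu> n) (\<nu> n) - dist_ab \<mu>' \<nu>') \<le> dist_ab (\<mu> n) \<mu>' + dist_ab (\<nu> n) \<nu>'"
      using dist_ab_triangle[OF assms(1)[of n] assms(2) assms(4)[of n]] dist_ab_triangle[OF assms(2,5) assms(4)[of n]]
        dist_ab_triangle[OF assms(2) assms(1)[of n] assms(5)] dist_ab_triangle[OF assms(1)[of n] assms(4)[of n] assms(5)]
        dist_ab_commute[of \<mu>' "\<mu> n"] dist_ab_commute[of \<nu>' "\<nu> n"] by (simp add: abs_le_iff)
  qed
  show "(\<lambda>n. dist_ab (\<mu> n) \<mu>' + dist_ab (\<nu> n) \<nu>') \<longlonglongrightarrow> 0"
    using tendsto_add[OF dist_ab_tendsto_0[of \<mu> \<mu>'] dist_ab_tendsto_0[of \<nu> \<nu>']] assms by simp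
qed

text \<open>
  The density bound and the Hoelder estimate are uniform in \<open>n\<close>, which is what the theorem of Arzela and
  Ascoli requires.
\<close>
lemma bounded_energy_paths_subsequence:
  assumes paths: "\<And>n. flux_path 0 1 (\<mu> n) (V n) (h n)" "\<And>n. \<mu> n 0 = \<mu>0"
    and E: "\<And>n. path_energy 0 1 (\<mu> n) (V n) (h n) \<le> ennreal E" "0 \<le> E"
  obtains k :: "nat \<Rightarrow> nat" and \<gamma> where "strict_mono k" "\<And>t x. t \<in> {0..1} \<Longrightarrow> (\<lambda>n. \<mu> (k n) t x) \<longlonglongrightarrow> \<gamma> t x"
proof -
  \<comment> \<open>The summand 1 keeps the bound positive when \<open>\<mu>0\<close> and \<open>E\<close> vanish.\<close>
  define B where "B = ((\<Sum>x\<in>UNIV. \<mu>0 x * \<pi> x) + sqrt E / a) / Min (range \<pi>) + 1"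
  have m: "0 < Min (range \<pi>)" using \<pi>_pos by auto
  have nn: "0 \<le> \<mu> n t x" if "t \<in> {0..1}" for n t x
    using paths(1)[of n] that by (simp add: flux_path_def nonneg_densities_def)
  have bound: "\<mu> n t x \<le> B" if "t \<in> {0..1}" for n t x
    using path_density_bound[OF paths(1) E that, of n x] by (simp add: B_def paths(2))
  have "0 \<le> (\<Sum>x\<in>UNIV. \<mu>0 x * \<pi> x)"
    using nn[of 0 0] \<pi>_pos by (intro sum_nonneg mult_nonneg_nonneg) (auto simp: paths(2) intro: less_imp_le)
  then have "0 \<le> ((\<Sum>x\<in>UNIV. \<mu>0 x * \<pi> x) + sqrt E / a) / Min (range \<pi>)"
    using a_pos E(2) by (intro divide_nonneg_nonneg[OF _ less_imp_le[OF m]] add_nonneg_nonneg) auto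
  then have "0 < B" by (simp add: B_def)
  define Q where "Q x = (2 * (p x)\<^sup>2 / a\<^sup>2 + 4 * B / b\<^sup>2) * E" for x
  have "0 \<le> Q x" for x using \<open>0 < B\<close> E(2) by (simp add: Q_def)
  define R where "R = (\<Sum>x\<in>UNIV. sqrt (Q x) / \<pi> x)"
  have "0 \<le> R" unfolding R_def using \<pi>_pos \<open>\<And>x. 0 \<le> Q x\<close> by (intro sum_nonneg divide_nonneg_pos) auto
  define F where "F n t = (\<chi> x. \<mu> n t x)" for n t
  have holder': "norm (F n t - F n s) \<le> R * sqrt (t - s)" if "0 \<le> s" "s \<le> t" "t \<le> 1" for n s t
  proof -
    have "norm (F n t - F n s) \<le> (\<Sum>x\<in>UNIV. \<bar>\<mu> n t x - \<mu> n s x\<bar>)"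
      using norm_le_l1_cart[of "F n t - F n s"] by (simp add: F_def)
    also have "\<dots> \<le> (\<Sum>x\<in>UNIV. sqrt (Q x) / \<pi> x * sqrt (t - s))"
    proof (rule sum_mono)
      fix x
      have "\<bar>\<pi> x * (\<mu> n t x - \<mu> n s x)\<bar> \<le> sqrt ((t - s) * Q x)"
        using path_holder[OF paths(1)[of n] E(1)[of n] E(2) bound \<open>0 < B\<close> that, of x]
        by (intro real_le_rsqrt) (simp add: Q_def)
      then have "\<bar>\<mu> n t x - \<mu> n s x\<bar> * \<pi> x \<le> sqrt (Q x) * sqrt (t - s)"
        using \<pi>_pos[of x] unfolding abs_mult real_sqrt_mult by (simp add: mult.commute)
      then show "\<bar>\<mu> n t x - \<mu> n s x\<bar> \<le> sqrt (Q x) / \<pi> x * sqrt (t - s)"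
        using \<pi>_pos[of x] by (simp add: pos_le_divide_eq)
    qed
    finally show ?thesis by (simp add: R_def sum_distrib_right)
  qed
  have holder: "norm (F n s - F n t) \<le> R * sqrt \<bar>s - t\<bar>" if "s \<in> {0..1}" "t \<in> {0..1}" for n s t
    using that holder'[of s t n] holder'[of t s n] by (cases "s \<le> t") (auto simp: norm_minus_commute abs_minus_commute)
  obtain g and k :: "nat \<Rightarrow> nat" where k: "strict_mono k" and
    g: "\<And>e. 0 < e \<Longrightarrow> \<exists>N. \<forall>n x. n \<ge> N \<and> x \<in> {0..1::real} \<longrightarrow> norm (F (k n) x - g x) < e"
  proof (rule Arzela_Ascoli[of "{0..1::real}" F "real CARD('x) * B"])
    show "norm (F n t) \<le> real CARD('x) * B" if "t \<in> {0..1}" for n t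
    proof -
      have "norm (F n t) \<le> (\<Sum>x\<in>UNIV. \<bar>\<mu> n t x\<bar>)" using norm_le_l1_cart[of "F n t"] by (simp add: F_def)
      also have "\<dots> \<le> (\<Sum>x\<in>(UNIV :: 'x set). B)" using nn[OF that] bound[OF that] by (intro sum_mono) simp
      finally show ?thesis by simp
    qed
    fix t e :: real assume t: "t \<in> {0..1}" and "0 < e"
    show "\<exists>d>0. \<forall>n y. y \<in> {0..1} \<and> norm (t - y) < d \<longrightarrow> norm (F n t - F n y) < e"
    proof (intro exI conjI allI impI)
      show "0 < (e / (R + 1))\<^sup>2" using \<open>0 < e\<close> \<open>0 \<le> R\<close> by simp
      fix n y assume y: "y \<in> {0..1} \<and> norm (t - y) < (e / (R + 1))\<^sup>2"
      then have "sqrt \<bar>t - y\<bar> < e / (R + 1)"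
        using \<open>0 < e\<close> \<open>0 \<le> R\<close> by (intro real_less_lsqrt) auto
      then have "(R + 1) * sqrt \<bar>t - y\<bar> < e" using \<open>0 \<le> R\<close> by (simp add: field_simps)
      moreover have "R * sqrt \<bar>t - y\<bar> \<le> (R + 1) * sqrt \<bar>t - y\<bar>" by (intro mult_right_mono) auto
      ultimately show "norm (F n t - F n y) < e" using holder[OF t, of y n] y by linarith
    qed
  qed auto
  show thesis
  proof (rule that[OF k])
    fix t :: real and x assume t: "t \<in> {0..1}"
    have "(\<lambda>n. F (k n) t) \<longlonglongrightarrow> g t"
      unfolding LIMSEQ_iff using g t by meson
    from tendsto_vec_nth[OF this, of x] show "(\<lambda>n. \<mu> (k n) t x) \<longlonglongrightarrow> g t $ x" by (simp add: F_def)
  qed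
qed

lemma geodesic_exists:
  assumes nn: "\<mu>0 \<in> nonneg_densities" "\<mu>1 \<in> nonneg_densities"
  obtains \<gamma> where "\<gamma> 0 = \<mu>0" "\<gamma> 1 = \<mu>1" "constant_speed_geodesic nonneg_densities dist_ab \<gamma>"
proof -
  define D where "D = dist_ab \<mu>0 \<mu>1"
  have "squared_dist \<mu>0 \<mu>1 < ennreal (D\<^sup>2 + 1 / real (Suc n))" for n
    unfolding squared_dist_eq[OF nn] D_def by (simp add: ennreal_less_iff)
  then have "\<exists>\<mu> V h. flux_path 0 1 \<mu> V h \<and> \<mu> 0 = \<mu>0 \<and> \<mu> 1 = \<mu>1 \<and>
      path_energy 0 1 \<mu> V h < ennreal (D\<^sup>2 + 1 / real (Suc n))" for n
    by (meson near_minimal_path)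
  then obtain \<mu> V h where path: "\<And>n. flux_path 0 1 (\<mu> n) (V n) (h n)" and ends: "\<And>n. \<mu> n 0 = \<mu>0" "\<And>n. \<mu> n 1 = \<mu>1"
    and en: "\<And>n. path_energy 0 1 (\<mu> n) (V n) (h n) < ennreal (D\<^sup>2 + 1 / real (Suc n))"
    by metis
  have bnd: "path_energy 0 1 (\<mu> n) (V n) (h n) \<le> ennreal (D\<^sup>2 + 1)" for n
    by (rule order_trans[OF less_imp_le[OF en] ennreal_leI]) simp
  obtain k :: "nat \<Rightarrow> nat" and \<gamma> where k: "strict_mono k" and \<gamma>: "\<And>t x. t \<in> {0..1} \<Longrightarrow> (\<lambda>n. \<mu> (k n) t x) \<longlonglongrightarrow> \<gamma> t x"
    by (rule bounded_energy_paths_subsequence[of \<mu> V h \<mu>0, OF path ends(1) bnd]) auto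
  have \<mu>nn: "\<mu> n t \<in> nonneg_densities" if "t \<in> {0..1}" for n t
    using path[of n] that by (simp add: flux_path_def)
  have \<gamma>nn: "\<gamma> t \<in> nonneg_densities" if "t \<in> {0..1}" for t
    unfolding nonneg_densities_def
  proof (rule CollectI, rule allI)
    fix x show "0 \<le> \<gamma> t x"
      by (rule LIMSEQ_le_const[OF \<gamma>[OF that]]) (use \<mu>nn[OF that] in \<open>auto simp: nonneg_densities_def\<close>)
  qed
  have "\<gamma> 0 = \<mu>0" "\<gamma> 1 = \<mu>1"
    using \<gamma>[of 0] \<gamma>[of 1] by (auto simp: ends LIMSEQ_const_iff fun_eq_iff)
  moreover have "constant_speed_geodesic nonneg_densities dist_ab \<gamma>"
  proof (rule constant_speed_geodesicI[OF \<gamma>nn])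
    fix s t :: real assume st: "0 \<le> s" "s \<le> t" "t \<le> 1"
    then have in01: "s \<in> {0..1}" "t \<in> {0..1}" by auto
    let ?d = "\<lambda>n. dist_ab (\<mu> (k n) s) (\<mu> (k n) t)"
    have lim: "?d \<longlonglongrightarrow> dist_ab (\<gamma> s) (\<gamma> t)"
      by (intro dist_ab_tendsto \<mu>nn \<gamma>nn \<gamma> in01)
    have sq: "(?d n - (t - s) * D)\<^sup>2 \<le> 1 / real (Suc n)" for n
    proof -
      have "(?d n - (t - s) * D)\<^sup>2 \<le> (t - s) * (D\<^sup>2 + 1 / real (Suc (k n)) - D\<^sup>2)"
        using path_speed[OF path less_imp_le[OF en] _ st, of "k n"] by (simp add: ends D_def)
      also have "\<dots> \<le> 1 * (1 / real (Suc n))"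
        using st seq_suble[OF k, of n] by (intro mult_mono) (auto simp: frac_le)
      finally show ?thesis by simp
    qed
    have "(\<lambda>n. (?d n - (t - s) * D)\<^sup>2) \<longlonglongrightarrow> 0"
      by (rule real_tendsto_sandwich[OF _ _ tendsto_const LIMSEQ_Suc[OF lim_1_over_n]]) (use sq in \<open>auto intro!: always_eventually\<close>)
    moreover have "(\<lambda>n. (?d n - (t - s) * D)\<^sup>2) \<longlonglongrightarrow> (dist_ab (\<gamma> s) (\<gamma> t) - (t - s) * D)\<^sup>2"
      by (intro tendsto_intros lim)
    ultimately have "(dist_ab (\<gamma> s) (\<gamma> t) - (t - s) * D)\<^sup>2 = 0"
      using LIMSEQ_unique by blast
    then show "dist_ab (\<gamma> s) (\<gamma> t) = (t - s) * dist_ab (\<gamma> 0) (\<gamma> 1)"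
      by (simp add: D_def \<open>\<gamma> 0 = \<mu>0\<close> \<open>\<gamma> 1 = \<mu>1\<close>)
  qed
  ultimately show thesis by (rule that)
qed

end

theorem corollary3p5:
  fixes K :: "'x::finite \<Rightarrow> 'x \<Rightarrow> real"
    and \<pi> p :: "'x \<Rightarrow> real"
    and a b :: real
  assumes "markov_kernel K"
    and "irreducible_kernel K"
    and "invariant_probability K \<pi>"
    and "reversible_kernel K \<pi>"
    and "0 < a" and "0 < b"
    and "p \<in> pos_densities"
    and "(\<Sum>x\<in>UNIV. p x * \<pi> x) = 1"
  shows "geodesic_space nonneg_densities (transport_dist K \<pi> p a b) \<and>
    (\<forall>\<mu>0\<in>nonneg_densities. \<forall>\<mu>1\<in>nonneg_densities.
      \<forall>(\<mu>, V, h)\<in>continuity_equation K p \<mu>0 \<mu>1.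
        quad_energy K \<pi> a b \<mu> V h = ennreal ((transport_dist K \<pi> p a b \<mu>0 \<mu>1)\<^sup>2) \<longrightarrow>
        constant_speed_geodesic nonneg_densities (transport_dist K \<pi> p a b) \<mu>)"
proof -
  interpret transport_setting K \<pi> p a b
    by unfold_locales (rule assms)+
  have "geodesic_space nonneg_densities dist_ab"
    unfolding geodesic_space_def using Metric_space_dist_ab geodesic_exists by metis
  moreover have "constant_speed_geodesic nonneg_densities dist_ab \<mu>"
    if CE: "(\<mu>, V, h) \<in> continuity_equation K p \<mu>0 \<mu>1"
      and min: "quad_energy K \<pi> a b \<mu> V h = ennreal ((dist_ab \<mu>0 \<mu>1)\<^sup>2)" for \<mu>0 \<mu>1 \<mu> V h
  proof -
    have path: "flux_path 0 1 \<mu> V h" "\<mu> 0 = \<mu>0" "\<mu> 1 = \<mu>1"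
      using CE by (auto simp: continuity_equation_iff_flux_path)
    then show ?thesis
      using minimal_path_geodesic[OF path(1)] quad_energy_eq_path_energy[OF path(1)] min by simp
  qed
  ultimately show ?thesis by blast
qed

end
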